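(* Let $P$ be a Borel probability measure on $\mathbb{R}_+$ with finite mean $\mu\neq0$ and Laplace transform $\phi(t)=\int_{\mathbb{R}_+}e^{-tx}P(dx)$, and let $\mathbf{w}^{(n)}=(w_1^{(n)},\ldots,w_n^{(n)})$, $n\in\mathbb{N}$, be (random or deterministic) vectors of nonnegative real numbers. For $\lambda\geq0$ and $t\geq0$ define $$B_n(t,\lambda):=\mathbb{E}\Bigl(\exp\{-\lambda S_{\mathbf{o}}^{(n)}(t)\}\,\mathbf{1}_{\{S_{\mathbf{o}}^{(n)}(t)>0\}}\Bigr),$$ where $S_{\mathbf{o}}^{(n)}(t)$ is the out-of-equilibrium part of the search-cost in the move-to-front Markov chain with popularities $p^{(n)}_i=w^{(n)}_i/\sum_{j=1}^n w^{(n)}_j$. Then the limit $L(\mu,t,\lambda):=\lim_{n\to\infty}B_n(n\mu t,\lambda/n)$ exists in the following cases (the conditions LLN-$P$-ex, LLN-$P^-$, LLN-$P^+$ being defined in the context). (i) If LLN-$P$-ex holds, and then $$L(\mu,t,\lambda)=\frac{|\phi'(t)|}{\mu}\left(\frac{e^{-\lambda(1-\phi(t))}-e^{-\lambda}}{\lambda\phi(t)}\right)=\frac{|\phi'(t)|}{\mu}\int_0^1e^{-\lambda\phi(t)x}\,dx\,\exp\{-\lambda(1-\phi(t))\}$$ (the first expression being read as its limit when $\lambda=0$). (ii) If LLN-$P^-$ holds, and then $$L(\mu,t,\lambda)=\frac1\mu\int_0^\infty xe^{-xt}\exp\Bigl\{-\lambda\int_{x^+}^\infty e^{-yt}P(dy)\Bigr\}P(dx)\,\exp\{-\lambda(1-\phi(t))\}.$$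 (iii) If LLN-$P^+$ holds, and then $$L(\mu,t,\lambda)=\frac1\mu\int_0^\infty xe^{-xt}\exp\Bigl\{-\lambda\int_0^xe^{-yt}P(dy)\Bigr\}P(dx)\,\exp\{-\lambda(1-\phi(t))\}.$$
   Context: Notation: $\int_{x^+}^\infty$ denotes integration over the open half-line $(x,\infty)$ and $\int_0^x$ integration over $[0,x]$. Condition LLN-$P$. A sequence of random or deterministic vectors $\mathbf{w}^{(n)}=(w_1^{(n)},\ldots,w_n^{(n)})$, $n\in\mathbb{N}$, with nonnegative coordinates satisfies LLN-$P$, where $P$ is a Borel probability measure on $\mathbb{R}_+=[0,\infty)$ with finite first moment $\mu\neq0$, if there exist positive random variables $Z_n$ (with $Z_n$ defined on the same probability space as $\mathbf{w}^{(n)}$) such that the random probability measures $\hat\nu^{(n)}:=\frac1n\sum_{i=1}^n\delta_{Z_nw_i^{(n)}}$ converge in law to the deterministic limit $P$ (as random elements of the space $\mathcal{P}(\mathbb{R}_+)$ of Borel probability measures with the weak topology), and the empirical means $\frac1n\sum_{i=1}^nZ_nw_i^{(n)}$ converge in law to $\mu$. Move-to-front chain. Let $p_i^{(n)}:=w_i^{(n)}/\sum_{j=1}^nw_j^{(n)}$ (convention $0/0:=0$). Objects labeled $1,\ldots,n$ are kept in a list; at time $0$ object $i$ is at position $\pi(i)$, where $\pi$ is some permutation of $\{1,\ldots,n\}$ (position $1$ is the front of the list). Conditionally on $\mathbf{w}^{(n)}$, object $i$ is requested at the instants of a Poisson process on $[0,\infty)$ of rate $p_i^{(n)}$, independently for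 different $i$. Instantaneously after a request the requested object is moved to the front of the list, the relative order of the other objects being unchanged. $N_t$ is the total number of requests up to time $t$, and $I_k\in\{1,\ldots,n\}$ is the label of the $k$-th requested object, so that $I_{N_{t^-}+1}$ is the first object requested in $[t,\infty)$. $S^{(n,i)}(t)$ is the position of object $i$ at time $t$ (left-continuous in $t$: a request occurring exactly at time $t$ has not yet modified the list). The search-cost is $S^{(n)}(t):=\sum_{i=1}^nS^{(n,i)}(t)\mathbf{1}_{\{I_{N_{t^-}+1}=i\}}$; if all $w_j^{(n)}$ are zero there are no requests and $S^{(n)}(t)=0$. $R_t$ is the set of objects requested at least once in $[0,t)$. The out-of-equilibrium part of the search-cost is $S_{\mathbf{o}}^{(n)}(t):=S^{(n)}(t)\mathbf{1}_{\{I_{N_{t^-}+1}\notin R_t\}}$; one has $\{S_{\mathbf{o}}^{(n)}(t)>0\}=\{S^{(n)}(t)>|R_t|\}$. Conditions on the initial order: LLN-$P$-ex: LLN-$P$ holds, $\pi$ is the identity, and for each $n$ the vector $\mathbf{w}^{(n)}$ is exchangeable (its law is invariant under permutations of its coordinates). LLN-$P^-$: LLN-$P$ holds, $\pi$ is the identity, and for each $n$ the vector $\mathbf{w}^{(n)}$ is a.s. decreasing, i.e. $w_1^{(n)}\ge\cdots\ge w_n^{(n)}$. LLN-$P^+$: LLN-$P$ holds, $\pi$ is the identity, and for each $n$ the vector $\mathbf{w}^{(n)}$ is a.s. increasing, i.e. $w_1^{(n)}\le\cdots\le w_n^{(n)}$.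
   Formalization: In (ii) and (iii) it is additionally assumed, when λ>0, that P has no atom in (0,∞); otherwise the formulas fail (e.g. P=δ_1, all weights 1, t=0: the limit is (1−e^{−λ})/λ, whereas (ii) gives 1 and (iii) gives e^{−λ}). *)

theory Defs
  imports "HOL-Probability.Probability"
begin

section \<open>Condition LLN-P\<close>

definition Rplus :: "real measure" where
  "Rplus = restrict_space borel {0..}"

definition bounded_continuous_Rplus :: "(real \<Rightarrow> real) set" where
  "bounded_continuous_Rplus = {f. continuous_on {0..} f \<and> bounded (f ` {0..})}"

text \<open>The weak topology on the set \<^term>\<open>space (prob_algebra Rplus)\<close> of Borel probability
  measures on the half-line, as the initial topology of the maps taking \<open>Q\<close> to the integral of
  \<open>f\<close> with respect to \<open>Q\<close>, where \<open>f\<close> ranges over the bounded continuous functions.\<close>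

definition weak_topology_Rplus :: "real measure topology" where
  "weak_topology_Rplus =
     pullback_topology (space (prob_algebra Rplus))
       (\<lambda>Q. \<lambda>f\<in>bounded_continuous_Rplus. LINT x|Q. f x)
       (product_topology (\<lambda>_. euclideanreal) bounded_continuous_Rplus)"

text \<open>Convergence in law, to the constant \<open>c\<close>, of random elements \<open>X n\<close> of a topological space;
  each \<open>X n\<close> may live on its own probability space \<open>M n\<close>.\<close>

definition converges_in_law_to_const ::
    "'b topology \<Rightarrow> (nat \<Rightarrow> 'a measure) \<Rightarrow> (nat \<Rightarrow> 'a \<Rightarrow> 'b) \<Rightarrow> 'b \<Rightarrow> bool" where
  "converges_in_law_to_const T M X c \<longleftrightarrow>
     (\<forall>F. continuous_map T euclideanreal F \<and> bounded (F ` topspace T) \<longrightarrow>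
       (\<lambda>n. LINT \<omega>|M n. F (X n \<omega>)) \<longlonglongrightarrow> F c)"

text \<open>The measure putting mass \<open>1/n\<close> (with multiplicity) on each of \<open>x 1, \<dots>, x n\<close>.\<close>

definition empirical_measure :: "nat \<Rightarrow> (nat \<Rightarrow> real) \<Rightarrow> real measure" where
  "empirical_measure n x = distr (uniform_count_measure {1..n}) Rplus x"

text \<open>The weights are \<open>w n i\<close> with \<open>1 \<le> i \<le> n\<close>, random variables on \<open>M n\<close>. Here and below the
  index \<open>n = 0\<close> carries no information. That \<open>P\<close> is a probability measure on the half-line with
  finite nonzero mean is a hypothesis of its own.\<close>

definition LLN :: "real measure \<Rightarrow> (nat \<Rightarrow> 'a measure) \<Rightarrow> (nat \<Rightarrow> nat \<Rightarrow> 'a \<Rightarrow> real) \<Rightarrow> bool" where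
  "LLN P M w \<longleftrightarrow>
     (\<exists>Z. (\<forall>n\<ge>1. Z n \<in> borel_measurable (M n) \<and> (\<forall>\<omega>\<in>space (M n). 0 < Z n \<omega>)) \<and>
          converges_in_law_to_const weak_topology_Rplus M
            (\<lambda>n \<omega>. empirical_measure n (\<lambda>i. Z n \<omega> * w n i \<omega>)) P \<and>
          weak_conv_m
            (\<lambda>n. distr (M n) borel (\<lambda>\<omega>. (\<Sum>i=1..n. Z n \<omega> * w n i \<omega>) / real n))
            (return borel (LINT x|P. x)))"

definition weight_vector :: "nat \<Rightarrow> (nat \<Rightarrow> 'a \<Rightarrow> real) \<Rightarrow> 'a \<Rightarrow> nat \<Rightarrow> real" where
  "weight_vector n v \<omega> = (\<lambda>i\<in>{1..n}. v i \<omega>)"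

definition exchangeable :: "'a measure \<Rightarrow> nat \<Rightarrow> (nat \<Rightarrow> 'a \<Rightarrow> real) \<Rightarrow> bool" where
  "exchangeable N n v \<longleftrightarrow>
     (\<forall>\<sigma>. \<sigma> permutes {1..n} \<longrightarrow>
        distr N (\<Pi>\<^sub>M i\<in>{1..n}. borel) (weight_vector n (\<lambda>i. v (\<sigma> i))) =
        distr N (\<Pi>\<^sub>M i\<in>{1..n}. borel) (weight_vector n v))"

text \<open>\<open>\<pi> n i\<close> is the position of object \<open>i\<close> at time 0 in the list of \<open>n\<close> objects.\<close>

definition LLN_ex where
  "LLN_ex P M w \<pi> \<longleftrightarrow>
     LLN P M w \<and> (\<forall>n\<ge>1. \<pi> n = id) \<and> (\<forall>n\<ge>1. exchangeable (M n) n (w n))"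

definition LLN_minus where
  "LLN_minus P M w \<pi> \<longleftrightarrow>
     LLN P M w \<and> (\<forall>n\<ge>1. \<pi> n = id) \<and>
     (\<forall>n\<ge>1. AE \<omega> in M n. \<forall>i j. 1 \<le> i \<and> i \<le> j \<and> j \<le> n \<longrightarrow> w n j \<omega> \<le> w n i \<omega>)"

definition LLN_plus where
  "LLN_plus P M w \<pi> \<longleftrightarrow>
     LLN P M w \<and> (\<forall>n\<ge>1. \<pi> n = id) \<and>
     (\<forall>n\<ge>1. AE \<omega> in M n. \<forall>i j. 1 \<le> i \<and> i \<le> j \<and> j \<le> n \<longrightarrow> w n i \<omega> \<le> w n j \<omega>)"


section \<open>Requests\<close>

definition popularity :: "nat \<Rightarrow> (nat \<Rightarrow> real) \<Rightarrow> nat \<Rightarrow> real" where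
  "popularity n x i = x i / (\<Sum>j=1..n. x j)"

text \<open>The library's \<open>poisson_pmf\<close> requires a positive rate, while popularities may vanish.\<close>

definition poisson_mass :: "real \<Rightarrow> nat \<Rightarrow> real" where
  "poisson_mass r k = r ^ k / fact k * exp (- r)"

text \<open>\<open>T i \<omega>\<close> is the random locally finite set of instants at which object \<open>i\<close> is requested.
  Conditionally on the weights these sets are independent Poisson processes of rates
  \<open>p\<^sub>1, \<dots>, p\<^sub>n\<close>: for all \<open>0 \<le> s 0 \<le> \<dots> \<le> s m\<close> the numbers of points of \<open>T i\<close> in
  \<open>[s j, s (j+1))\<close> are conditionally independent over all \<open>i\<close> and \<open>j\<close>, with Poisson laws of
  parameters \<open>p\<^sub>i (s (j+1) - s j)\<close>.\<close>

definition cond_poisson_requests ::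
    "'a measure \<Rightarrow> nat \<Rightarrow> (nat \<Rightarrow> 'a \<Rightarrow> real) \<Rightarrow> (nat \<Rightarrow> 'a \<Rightarrow> real set) \<Rightarrow> bool" where
  "cond_poisson_requests N n v T \<longleftrightarrow>
     (\<forall>i\<in>{1..n}. \<forall>\<omega>\<in>space N. T i \<omega> \<subseteq> {0..} \<and> (\<forall>t. finite (T i \<omega> \<inter> {0..<t}))) \<and>
     (\<forall>i\<in>{1..n}. \<forall>a\<ge>0. \<forall>b. (\<lambda>\<omega>. card (T i \<omega> \<inter> {a..<b})) \<in> measurable N (count_space UNIV)) \<and>
     (\<forall>(m::nat) (s :: nat \<Rightarrow> real) (k :: nat \<Rightarrow> nat \<Rightarrow> nat).
        0 \<le> s 0 \<and> (\<forall>j<m. s j \<le> s (Suc j)) \<longrightarrow>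
        (AE \<omega> in N.
          real_cond_exp N
            (vimage_algebra (space N) (weight_vector n v) (\<Pi>\<^sub>M i\<in>{1..n}. borel))
            (\<lambda>\<omega>'. of_bool (\<forall>i\<in>{1..n}. \<forall>j<m. card (T i \<omega>' \<inter> {s j..<s (Suc j)}) = k i j)) \<omega> =
          (\<Prod>i=1..n. \<Prod>j<m.
             poisson_mass (popularity n (\<lambda>l. v l \<omega>) i * (s (Suc j) - s j)) (k i j))))"


section \<open>The move-to-front list\<close>

text \<open>In this section \<open>T i\<close> is a fixed realization of the set of instants of requests of object
  \<open>i\<close>. Conditionally on the weights, requests at the same instant have probability zero; the
  value given to the functions below on that event is arbitrary.\<close>

definition request_times :: "nat \<Rightarrow> (nat \<Rightarrow> real set) \<Rightarrow> real set" where
  "request_times n T = (\<Union>i\<in>{1..n}. T i)"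

definition label_at :: "nat \<Rightarrow> (nat \<Rightarrow> real set) \<Rightarrow> real \<Rightarrow> nat" where
  "label_at n T s = (LEAST i. i \<in> {1..n} \<and> s \<in> T i)"

text \<open>The number of requests up to time \<open>t\<close>, its left limit, and the label \<open>I\<^sub>k\<close> of the \<open>k\<close>-th
  requested object (\<^term>\<open>None\<close> if there are fewer than \<open>k\<close> requests altogether).\<close>

definition num_requests :: "nat \<Rightarrow> (nat \<Rightarrow> real set) \<Rightarrow> real \<Rightarrow> nat" where
  "num_requests n T t = card (request_times n T \<inter> {0..t})"

definition num_requests_left :: "nat \<Rightarrow> (nat \<Rightarrow> real set) \<Rightarrow> real \<Rightarrow> nat" where
  "num_requests_left n T t = card (request_times n T \<inter> {0..<t})"

definition request_label :: "nat \<Rightarrow> (nat \<Rightarrow> real set) \<Rightarrow> nat \<Rightarrow> nat option" where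
  "request_label n T k =
     (if \<exists>s\<in>request_times n T. num_requests n T s = k
      then Some (label_at n T (THE s. s \<in> request_times n T \<and> num_requests n T s = k))
      else None)"

definition next_label :: "nat \<Rightarrow> (nat \<Rightarrow> real set) \<Rightarrow> real \<Rightarrow> nat option" where
  "next_label n T t = request_label n T (num_requests_left n T t + 1)"

definition move_to_front :: "nat \<Rightarrow> nat list \<Rightarrow> nat list" where
  "move_to_front i l = i # remove1 i l"

definition initial_list :: "nat \<Rightarrow> (nat \<Rightarrow> nat) \<Rightarrow> nat list" where
  "initial_list n \<rho> = map (inv \<rho>) [1..<Suc n]"

definition list_at :: "nat \<Rightarrow> (nat \<Rightarrow> nat) \<Rightarrow> (nat \<Rightarrow> real set) \<Rightarrow> real \<Rightarrow> nat list" where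
  "list_at n \<rho> T t =
     fold move_to_front
       (map (label_at n T) (sorted_list_of_set (request_times n T \<inter> {0..<t})))
       (initial_list n \<rho>)"

definition position :: "nat \<Rightarrow> (nat \<Rightarrow> nat) \<Rightarrow> (nat \<Rightarrow> real set) \<Rightarrow> nat \<Rightarrow> real \<Rightarrow> nat" where
  "position n \<rho> T i t = Suc (length (takeWhile (\<lambda>j. j \<noteq> i) (list_at n \<rho> T t)))"

definition search_cost :: "nat \<Rightarrow> (nat \<Rightarrow> nat) \<Rightarrow> (nat \<Rightarrow> real set) \<Rightarrow> real \<Rightarrow> nat" where
  "search_cost n \<rho> T t = (\<Sum>i=1..n. position n \<rho> T i t * of_bool (next_label n T t = Some i))"

definition requested_before :: "nat \<Rightarrow> (nat \<Rightarrow> real set) \<Rightarrow> real \<Rightarrow> nat set" where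
  "requested_before n T t = {i\<in>{1..n}. T i \<inter> {0..<t} \<noteq> {}}"

definition out_search_cost :: "nat \<Rightarrow> (nat \<Rightarrow> nat) \<Rightarrow> (nat \<Rightarrow> real set) \<Rightarrow> real \<Rightarrow> nat" where
  "out_search_cost n \<rho> T t =
     search_cost n \<rho> T t * of_bool (next_label n T t \<notin> Some ` requested_before n T t)"

text \<open>\<open>B\<^sub>n(t, l)\<close>\<close>

definition out_transform ::
    "'a measure \<Rightarrow> nat \<Rightarrow> (nat \<Rightarrow> nat) \<Rightarrow> (nat \<Rightarrow> 'a \<Rightarrow> real set) \<Rightarrow> real \<Rightarrow> real \<Rightarrow> real" where
  "out_transform N n \<rho> T t l =
     (LINT \<omega>|N. exp (- l * real (out_search_cost n \<rho> (\<lambda>i. T i \<omega>) t)) *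
                of_bool (out_search_cost n \<rho> (\<lambda>i. T i \<omega>) t > 0))"


section \<open>Laplace transform\<close>

definition laplace :: "real measure \<Rightarrow> real \<Rightarrow> real" where
  "laplace P t = (LINT x|P. exp (- t * x))"

text \<open>The derivative is taken relative to the half-line, where the transform is defined; at
  \<open>t = 0\<close> it is the right derivative.\<close>

definition laplace_deriv :: "real measure \<Rightarrow> real \<Rightarrow> real" where
  "laplace_deriv P t = vector_derivative (laplace P) (at t within {0..})"

end

theory Submission
  imports Defs
begin

text \<open>Write \<open>p i\<close> for the popularity of object \<open>i\<close>, put \<open>s = n * \<mu> * t\<close>, and let \<open>h i = exp (- p i * s)\<close> be
the conditional probability that \<open>i\<close> has not been requested before time \<open>s\<close>. If the next requested object
\<open>i\<close> has not been requested before, it stands behind all objects requested so far and behind the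
objects that preceded it initially, so, the initial order being the identity, its position is the
number of elements of \<open>R \<union> {1..i}\<close>, where \<open>R\<close> is the set of requested objects. Given the weights, the next request falls on
\<open>i\<close> with probability \<open>p i\<close>, independently of \<open>R\<close>, to which the objects belong independently of each
other. Hence the transform is the expectation, over the weights, of the sum over \<open>i\<close> of

\<open>p i * h i * exp (- a * i) * (\<Prod>j>i. 1 - (1 - h j) * (1 - exp (- a)))\<close>  with  \<open>a = l / n\<close>

(lemma \<open>out_transform_eq\<close>). For this value of \<open>a\<close> each factor of the product differs from
\<open>exp (- a * (1 - h j))\<close> by at most the square of \<open>a\<close>, so up to an error \<open>l^2 / n\<close> the sum may be replaced by
the sum of

\<open>p i * h i * exp (- l * (1 - \<Phi> + (1/n) * (\<Sum>j\<le>i. h j)))\<close>  with  \<open>\<Phi> = (1/n) * (\<Sum>j\<le>n. h j)\<close>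

(\<open>cost_sum_diff\<close>); this is \<open>exponential_cost\<close>. It depends on the weights only up to a common factor,
so the weights may be normalized as in the law of large numbers. Then \<open>h j\<close> is close to
\<open>exp (- x j * t)\<close>, where \<open>x j\<close> is the normalized weight, and \<open>\<Phi>\<close> to the Laplace transform at \<open>t\<close>; what
distinguishes the three cases is the partial sum \<open>\<Sum>j\<le>i. h j\<close>.

If the weights are monotone, \<open>{1..i}\<close> lies between the sets of the \<open>j\<close> with \<open>x j < x i\<close> and with \<open>x j \<le> x i\<close>
(or with the reversed relations). The partial sums are therefore squeezed between two
integrals against the empirical measure, which have the same limit since, for \<open>l \<noteq> 0\<close>, \<open>P\<close> has no atom at a
positive point (\<open>comparison_cost_lim\<close>). The empirical measures are realized as laws of random variables on one
probability space, by the Skorohod representation, where these variables converge pointwise; convergence of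
the means and Scheffe's argument then supply the uniform integrability that the factor \<open>p i\<close> requires
(\<open>weighted_mean_lim\<close>).

If the weights are exchangeable, the partial sum up to \<open>i\<close> is close to \<open>i * \<Phi>\<close>: the deviation has second
moment at most \<open>i\<close>, as in sampling without replacement (\<open>second_moment_le\<close>), and averaging over the
positions turns the sum into a symmetric function of the weights, \<open>averaged_cost\<close>, whose limit depends on
the empirical measure alone (\<open>averaged_cost_lim\<close>).

The limits are first proved for deterministic vectors whose empirical measures and means
converge. They carry over to random weights because weak convergence to \<open>P\<close> is tested by
countably many functions, so that closeness of finitely many empirical averages and of the mean
forces closeness of the cost (\<open>LLN_transfer\<close>).\<close>

section \<open>The list along a fixed realization of the requests\<close>

definition locally_finite_times :: "nat \<Rightarrow> (nat \<Rightarrow> real set) \<Rightarrow> bool" where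
  "locally_finite_times n T \<longleftrightarrow> (\<forall>i\<in>{1..n}. T i \<subseteq> {0..} \<and> (\<forall>t. finite (T i \<inter> {0..<t})))"

text \<open>The objects that have actually been moved to the front. It may be smaller than the set of
requested objects, because of several objects requested at the same instant only the one with the least
label is moved.\<close>

definition moved_before :: "nat \<Rightarrow> (nat \<Rightarrow> real set) \<Rightarrow> real \<Rightarrow> nat set" where
  "moved_before n T t = label_at n T ` (request_times n T \<inter> {0..<t})"

lemma locally_finite_timesD:
  assumes "locally_finite_times n T" "i \<in> {1..n}"
  shows "T i \<subseteq> {0..}" "finite (T i \<inter> {0..<t})"
  using assms by (auto simp: locally_finite_times_def)

lemma finite_requests:
  assumes "locally_finite_times n T"
  shows "finite (request_times n T \<inter> {0..<t})" "finite (request_times n T \<inter> {0..t})"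
proof -
  have *: "finite (request_times n T \<inter> {0..<u})" for u
  proof -
    have "request_times n T \<inter> {0..<u} = (\<Union>i\<in>{1..n}. T i \<inter> {0..<u})"
      by (auto simp: request_times_def)
    moreover have "finite (\<Union>i\<in>{1..n}. T i \<inter> {0..<u})"
      using locally_finite_timesD(2)[OF assms] by (intro finite_UN_I) auto
    ultimately show ?thesis by simp
  qed
  show "finite (request_times n T \<inter> {0..<t})" by (rule *)
  show "finite (request_times n T \<inter> {0..t})"
    by (rule finite_subset[OF _ *[of "t + 1"]]) auto
qed

lemma label_at_request_time:
  assumes "s \<in> request_times n T"
  shows "label_at n T s \<in> {1..n}" "s \<in> T (label_at n T s)"
proof -
  obtain i where "i \<in> {1..n} \<and> s \<in> T i" using assms by (auto simp: request_times_def)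
  hence "label_at n T s \<in> {1..n} \<and> s \<in> T (label_at n T s)"
    unfolding label_at_def by (rule LeastI)
  thus "label_at n T s \<in> {1..n}" "s \<in> T (label_at n T s)" by auto
qed

lemma label_at_eq_iff:
  assumes "s \<in> request_times n T"
  shows "label_at n T s = i \<longleftrightarrow> i \<in> {1..n} \<and> s \<in> T i \<and> (\<forall>j\<in>{1..<i}. s \<notin> T j)"
proof
  assume L: "label_at n T s = i"
  have i: "i \<in> {1..n}" "s \<in> T i" using label_at_request_time[OF assms] L by auto
  moreover have "s \<notin> T j" if "j \<in> {1..<i}" for j
  proof -
    have "\<not> (j \<in> {1..n} \<and> s \<in> T j)"
      using that L not_less_Least[of j "\<lambda>i. i \<in> {1..n} \<and> s \<in> T i"]
      unfolding label_at_def by (metis atLeastLessThan_iff)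
    thus ?thesis using that i(1) by auto
  qed
  ultimately show "i \<in> {1..n} \<and> s \<in> T i \<and> (\<forall>j\<in>{1..<i}. s \<notin> T j)" by blast
next
  assume R: "i \<in> {1..n} \<and> s \<in> T i \<and> (\<forall>j\<in>{1..<i}. s \<notin> T j)"
  show "label_at n T s = i" unfolding label_at_def
  proof (rule Least_equality)
    show "i \<le> j" if "j \<in> {1..n} \<and> s \<in> T j" for j
      using R that by (metis atLeastAtMost_iff atLeastLessThan_iff not_less)
  qed (use R in blast)
qed

lemma moved_before_subset: "moved_before n T t \<subseteq> requested_before n T t"
proof
  fix i assume "i \<in> moved_before n T t"
  then obtain u where "u \<in> request_times n T" "u \<in> {0..<t}" "i = label_at n T u"
    by (auto simp: moved_before_def)
  thus "i \<in> requested_before n T t"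
    using label_at_request_time[of u n T] unfolding requested_before_def by blast
qed

lemma takeWhile_remove1:
  assumes "x \<noteq> i" "distinct l" "i \<in> set l"
  shows "takeWhile (\<lambda>j. j \<noteq> i) (remove1 x l) = remove1 x (takeWhile (\<lambda>j. j \<noteq> i) l)"
  using assms by (induction l) auto

text \<open>Only the set of objects in front of an object \<open>i\<close> that is never moved matters for its
position: moves of other objects add exactly those objects to it.\<close>

lemma fold_move_to_front:
  assumes "distinct l" "i \<in> set l" "i \<notin> set xs" "set xs \<subseteq> set l"
  shows "distinct (fold move_to_front xs l) \<and> set (fold move_to_front xs l) = set l \<and>
    set (takeWhile (\<lambda>j. j \<noteq> i) (fold move_to_front xs l)) = set xs \<union> set (takeWhile (\<lambda>j. j \<noteq> i) l)"
  using assms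
proof (induction xs arbitrary: l)
  case (Cons x xs)
  let ?l = "move_to_front x l"
  have s: "set ?l = set l" "distinct ?l"
    using Cons.prems by (auto simp: move_to_front_def)
  have "set (takeWhile (\<lambda>j. j \<noteq> i) ?l) = insert x (set (takeWhile (\<lambda>j. j \<noteq> i) l))"
    using Cons.prems by (auto simp: move_to_front_def takeWhile_remove1 set_remove1_eq distinct_takeWhile)
  moreover have "distinct (fold move_to_front xs ?l) \<and> set (fold move_to_front xs ?l) = set ?l \<and>
    set (takeWhile (\<lambda>j. j \<noteq> i) (fold move_to_front xs ?l)) = set xs \<union> set (takeWhile (\<lambda>j. j \<noteq> i) ?l)"
    using Cons.prems s by (intro Cons.IH) auto
  ultimately show ?case using s by auto
qed simp

lemma position_not_moved:
  assumes T: "locally_finite_times n T" and i: "i \<in> {1..n}" "i \<notin> moved_before n T t"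
  shows "position n id T i t = Suc (card (moved_before n T t \<union> {1..<i}))"
proof -
  define xs where "xs = map (label_at n T) (sorted_list_of_set (request_times n T \<inter> {0..<t}))"
  have xs: "set xs = moved_before n T t"
    using finite_requests[OF T] by (simp add: xs_def moved_before_def)
  have l: "initial_list n id = [1..<Suc n]" by (simp add: initial_list_def del: upt_Suc)
  have tk: "takeWhile (\<lambda>j. j \<noteq> i) [1..<Suc n] = [1..<i]"
  proof -
    have "[1..<Suc n] = [1..<i] @ i # [Suc i..<Suc n]"
      using i upt_add_eq_append[of 1 i "Suc n - i"] by (simp add: upt_conv_Cons del: upt_Suc)
    moreover have "takeWhile (\<lambda>j. j \<noteq> i) ([1..<i] @ i # [Suc i..<Suc n]) = [1..<i]"
      by (subst takeWhile_append2) auto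
    ultimately show ?thesis by metis
  qed
  have "set xs \<subseteq> set [1..<Suc n]"
    using xs moved_before_subset[of n T t] by (auto simp: requested_before_def)
  hence "distinct (list_at n id T t) \<and>
    set (takeWhile (\<lambda>j. j \<noteq> i) (list_at n id T t)) = set xs \<union> set [1..<i]"
    using fold_move_to_front[of "[1..<Suc n]" i xs] i xs tk
    by (auto simp: list_at_def xs_def l simp del: upt_Suc)
  thus ?thesis unfolding position_def
    by (metis xs distinct_card distinct_takeWhile set_upt)
qed

text \<open>The request with index one more than the number of requests before \<open>t\<close> is the earliest one
in \<open>[t, \<infinity>)\<close>, which exists as soon as there is any since the requests are locally finite.\<close>

lemma next_label_eq_Some_iff:
  assumes T: "locally_finite_times n T" and t: "0 \<le> t"
  shows "next_label n T t = Some i \<longleftrightarrow>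
    (\<exists>u\<in>T i. t \<le> u \<and> i \<in> {1..n} \<and> (\<forall>j\<in>{1..n}. T j \<inter> {t..<u} = {}) \<and> (\<forall>j\<in>{1..<i}. u \<notin> T j))"
    (is "?L \<longleftrightarrow> (\<exists>u\<in>T i. ?P u)")
proof -
  let ?R = "request_times n T"
  have first: "next_label n T t = Some (label_at n T u)"
    if u: "u \<in> ?R" "t \<le> u" "?R \<inter> {t..<u} = {}" for u
  proof -
    have N: "num_requests n T u = num_requests_left n T t + 1"
    proof -
      have "?R \<inter> {0..u} = insert u (?R \<inter> {0..<t})"
      proof (intro equalityI subsetI)
        fix v assume v: "v \<in> ?R \<inter> {0..u}"
        show "v \<in> insert u (?R \<inter> {0..<t})"
          using v u by (cases "v < t"; cases "v = u") auto
      qed (use u t in auto)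
      thus ?thesis using finite_requests(1)[OF T, of t] u
        by (auto simp: num_requests_def num_requests_left_def card_insert_if)
    qed
    have uniq: "v = u" if v: "v \<in> ?R" "num_requests n T v = num_requests_left n T t + 1" for v
    proof (rule ccontr)
      assume "v \<noteq> u"
      have vu: "v < t \<or> u < v" using v u \<open>v \<noteq> u\<close> by fastforce
      have v0: "0 \<le> v" using v T by (auto simp: request_times_def locally_finite_times_def)
      show False
      proof (cases "v < t")
        case True
        have "card (?R \<inter> {0..v}) \<le> card (?R \<inter> {0..<t})"
          using True by (intro card_mono finite_requests T) auto
        thus False using v by (simp add: num_requests_def num_requests_left_def)
      next
        case False
        hence "?R \<inter> {0..u} \<subseteq> ?R \<inter> {0..v}" "v \<in> ?R \<inter> {0..v}" "v \<notin> ?R \<inter> {0..u}"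
          using vu v u v0 by auto
        hence "?R \<inter> {0..u} \<subset> ?R \<inter> {0..v}" by blast
        hence "card (?R \<inter> {0..u}) < card (?R \<inter> {0..v})"
          by (intro psubset_card_mono finite_requests T)
        thus False using v N by (simp add: num_requests_def)
      qed
    qed
    have "(THE s. s \<in> ?R \<and> num_requests n T s = num_requests_left n T t + 1) = u"
    proof (rule the_equality)
      show "u \<in> ?R \<and> num_requests n T u = num_requests_left n T t + 1" using N u by blast
    qed (use uniq in blast)
    moreover have "\<exists>s\<in>?R. num_requests n T s = num_requests_left n T t + 1" using N u by blast
    ultimately show ?thesis by (simp add: next_label_def request_label_def)
  qed
  show ?thesis
  proof
    assume L: ?L
    then obtain v where v: "v \<in> ?R" "num_requests n T v = num_requests_left n T t + 1"
      by (auto simp: next_label_def request_label_def split: if_splits)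
    have "t \<le> v"
    proof (rule ccontr)
      assume "\<not> t \<le> v"
      hence "card (?R \<inter> {0..v}) \<le> card (?R \<inter> {0..<t})"
        by (intro card_mono finite_requests T) auto
      thus False using v by (simp add: num_requests_def num_requests_left_def)
    qed
    let ?S = "?R \<inter> {t..v}"
    have fin: "finite ?S" by (rule finite_subset[OF _ finite_requests(2)[OF T, of v]]) (use t in auto)
    have ne: "?S \<noteq> {}" using v \<open>t \<le> v\<close> by auto
    define u where "u = Min ?S"
    have u: "u \<in> ?S" unfolding u_def using fin ne by (rule Min_in)
    have un: "?R \<inter> {t..<u} = {}"
    proof (rule ccontr)
      assume "?R \<inter> {t..<u} \<noteq> {}"
      then obtain x where "x \<in> ?R" "t \<le> x" "x < u" by auto
      moreover have "x \<in> ?S" using calculation u by auto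
      ultimately show False using Min_le[OF fin, of x] by (simp add: u_def)
    qed
    have "label_at n T u = i" using first[of u] u un L by auto
    hence "i \<in> {1..n} \<and> u \<in> T i \<and> (\<forall>j\<in>{1..<i}. u \<notin> T j)"
      using u label_at_eq_iff[of u n T i] by auto
    moreover have "\<forall>j\<in>{1..n}. T j \<inter> {t..<u} = {}" using un by (auto simp: request_times_def)
    ultimately show "\<exists>u\<in>T i. ?P u" using u by auto
  next
    assume "\<exists>u\<in>T i. ?P u"
    then obtain u where u: "u \<in> T i" "?P u" by auto
    have uR: "u \<in> ?R" using u by (auto simp: request_times_def)
    have "label_at n T u = i" using u uR by (subst label_at_eq_iff) auto
    moreover have "?R \<inter> {t..<u} = {}" using u by (auto simp: request_times_def)
    ultimately show ?L using first[of u] u uR by auto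
  qed
qed

lemma next_label_range:
  assumes "locally_finite_times n T" "0 \<le> t" "next_label n T t = Some i"
  shows "i \<in> {1..n}"
  using assms(3) unfolding next_label_eq_Some_iff[OF assms(1,2)] by (elim bexE conjE)

lemma out_search_cost_eq:
  assumes T: "locally_finite_times n T" and t: "0 \<le> t"
  shows "out_search_cost n id T t =
    (\<Sum>i=1..n. of_bool (next_label n T t = Some i \<and> i \<notin> requested_before n T t) *
       Suc (card (moved_before n T t \<union> {1..<i})))"
proof -
  have "out_search_cost n id T t =
    (\<Sum>i=1..n. of_bool (next_label n T t = Some i \<and> i \<notin> requested_before n T t) * position n id T i t)"
    unfolding out_search_cost_def search_cost_def sum_distrib_right
    by (intro sum.cong) (auto simp: of_bool_def)
  also have "\<dots> = (\<Sum>i=1..n. of_bool (next_label n T t = Some i \<and> i \<notin> requested_before n T t) *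
       Suc (card (moved_before n T t \<union> {1..<i})))"
    using position_not_moved[OF T] moved_before_subset[of n T t]
    by (intro sum.cong) (auto simp: of_bool_def)
  finally show ?thesis .
qed

section \<open>Request counts determine the search cost\<close>

lemma gap_left_right:
  fixes F :: "real set"
  assumes "finite F"
  shows "\<exists>d>0. \<forall>x\<in>F. x = u \<or> d \<le> \<bar>x - u\<bar>"
proof -
  obtain d where "d > 0" "\<forall>x\<in>F. x \<noteq> u \<longrightarrow> d \<le> dist u x"
    using finite_set_avoid[OF assms, of u] by blast
  thus ?thesis by (intro exI[of _ d]) (auto simp: dist_real_def abs_minus_commute)
qed

lemma cell_exists:
  fixes u t :: real
  assumes "0 \<le> u" "u < t" "m \<ge> 1"
  shows "\<exists>k<m. u \<in> {real k * t / real m..<real (Suc k) * t / real m}"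
proof -
  have t: "t > 0" using assms by simp
  define k where "k = nat \<lfloor>u * real m / t\<rfloor>"
  have x0: "0 \<le> u * real m / t" using assms t by simp
  have k: "real k \<le> u * real m / t" "u * real m / t < real k + 1"
    unfolding k_def using x0 by (simp_all add: of_nat_nat)
  have "u * real m / t < real m" using assms t by (simp add: field_simps)
  hence "k < m" using k by (metis le_less_trans of_nat_less_iff)
  moreover have "real k * t / real m \<le> u" using k t assms by (simp add: field_simps)
  moreover have "u < real (Suc k) * t / real m" using k t assms by (simp add: field_simps)
  ultimately show ?thesis by auto
qed

text \<open>The probabilistic hypotheses speak of the requests only through these counts. The search cost is
expressed through them exactly, also for realizations with simultaneous requests: a null set of
exceptions would not do for the measurability of the cost, the underlying probability spaces not being complete.\<close>

definition count_in :: "(nat \<Rightarrow> real set) \<Rightarrow> nat \<Rightarrow> real \<Rightarrow> real \<Rightarrow> nat" where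
  "count_in T i a b = card (T i \<inter> {a..<b})"

lemma count_in_eq_0_iff:
  assumes "locally_finite_times n T" "i \<in> {1..n}" "0 \<le> a"
  shows "count_in T i a b = 0 \<longleftrightarrow> T i \<inter> {a..<b} = {}"
proof -
  have "finite (T i \<inter> {a..<b})"
    by (rule finite_subset[OF _ locally_finite_timesD(2)[OF assms(1,2), of b]]) (use assms in auto)
  thus ?thesis by (simp add: count_in_def)
qed

text \<open>A request of \<open>j\<close> at an instant without requests of smaller labels is visible on a grid
that is finer than the gaps between the finitely many instants of requests.\<close>

lemma moved_before_iff_counts:
  assumes T: "locally_finite_times n T" and t: "0 \<le> t"
  shows "j \<in> moved_before n T t \<longleftrightarrow> j \<in> {1..n} \<and>
    (\<exists>m\<ge>1. \<exists>k<m. count_in T j (real k * t / real m) (real (Suc k) * t / real m) \<noteq> 0 \<and>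
       (\<forall>i\<in>{1..<j}. count_in T i (real k * t / real m) (real (Suc k) * t / real m) = 0))"
    (is "_ \<longleftrightarrow> _ \<and> ?R")
proof (cases "j \<in> {1..n}")
  case j: True
  have eq0: "count_in T i (real k * t / real m) b = 0 \<longleftrightarrow> T i \<inter> {real k * t / real m..<b} = {}"
    if "i \<in> {1..j}" for i k m b
    using that j t by (intro count_in_eq_0_iff[OF T]) auto
  have pos: "0 < count_in T i (real k * t / real m) b \<longleftrightarrow> T i \<inter> {real k * t / real m..<b} \<noteq> {}"
    if "i \<in> {1..j}" for i k m b
    using eq0[OF that, of k m b] by linarith
  have "j \<in> moved_before n T t \<longleftrightarrow> (\<exists>u\<in>T j. 0 \<le> u \<and> u < t \<and> (\<forall>i\<in>{1..<j}. u \<notin> T i))"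
  proof
    assume "j \<in> moved_before n T t"
    then obtain u where "u \<in> request_times n T" "0 \<le> u" "u < t" "label_at n T u = j"
      by (auto simp: moved_before_def)
    thus "\<exists>u\<in>T j. 0 \<le> u \<and> u < t \<and> (\<forall>i\<in>{1..<j}. u \<notin> T i)"
      using label_at_eq_iff[of u n T j] by auto
  next
    assume "\<exists>u\<in>T j. 0 \<le> u \<and> u < t \<and> (\<forall>i\<in>{1..<j}. u \<notin> T i)"
    then obtain u where u: "u \<in> T j" "0 \<le> u" "u < t" "\<forall>i\<in>{1..<j}. u \<notin> T i" by auto
    hence "u \<in> request_times n T" using j by (auto simp: request_times_def)
    moreover from this have "label_at n T u = j" using u j by (simp add: label_at_eq_iff)
    ultimately show "j \<in> moved_before n T t" using u by (force simp: moved_before_def)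
  qed
  also have "\<dots> \<longleftrightarrow> ?R"
  proof
    assume "\<exists>u\<in>T j. 0 \<le> u \<and> u < t \<and> (\<forall>i\<in>{1..<j}. u \<notin> T i)"
    then obtain u where u: "u \<in> T j" "0 \<le> u" "u < t" "\<forall>i\<in>{1..<j}. u \<notin> T i" by auto
    obtain d where d: "d > 0" "\<forall>x\<in>request_times n T \<inter> {0..<t}. x = u \<or> d \<le> \<bar>x - u\<bar>"
      using gap_left_right[OF finite_requests(1)[OF T]] by metis
    obtain m :: nat where m: "t / d < real m" using reals_Archimedean2 by blast
    have m1: "m \<ge> 1" using m d u by (cases m) (auto simp: field_simps)
    hence md: "t / real m < d" using m d by (simp add: field_simps)
    obtain k where k: "k < m" "u \<in> {real k * t / real m..<real (Suc k) * t / real m}"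
      using cell_exists[OF u(2,3) m1] by auto
    have wid: "real (Suc k) * t / real m = real k * t / real m + t / real m"
      by (simp add: add_divide_distrib algebra_simps)
    have up: "real (Suc k) * t / real m \<le> t" 
    proof -
      have "real (Suc k) * t \<le> real m * t" using k t by (intro mult_right_mono) auto
      thus ?thesis using m1 by (simp add: field_simps)
    qed
    have "T i \<inter> {real k * t / real m..<real (Suc k) * t / real m} = {}" if i: "i \<in> {1..<j}" for i
    proof (rule ccontr)
      assume "T i \<inter> {real k * t / real m..<real (Suc k) * t / real m} \<noteq> {}"
      then obtain x where x: "x \<in> T i" "real k * t / real m \<le> x" "x < real (Suc k) * t / real m" by auto
      have "x \<ge> 0" using x t by (meson divide_nonneg_nonneg mult_nonneg_nonneg of_nat_0_le_iff order_trans)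
      hence "x \<in> request_times n T \<inter> {0..<t}" using x i j up by (force simp: request_times_def)
      moreover have "x \<noteq> u" using u x i by auto
      ultimately have "d \<le> \<bar>x - u\<bar>" using d by auto
      thus False using x k(2) wid md by auto
    qed
    moreover have "T j \<inter> {real k * t / real m..<real (Suc k) * t / real m} \<noteq> {}" using u k by auto
    ultimately show ?R using m1 k(1) j by (intro exI[of _ m] exI[of _ k] conjI) (auto simp: eq0 pos simp del: of_nat_Suc)
  next
    assume ?R
    then obtain m k where m: "m \<ge> 1" "k < m"
      and c: "T j \<inter> {real k * t / real m..<real (Suc k) * t / real m} \<noteq> {}"
       "\<forall>i\<in>{1..<j}. T i \<inter> {real k * t / real m..<real (Suc k) * t / real m} = {}"
      using j by (auto simp: eq0 pos simp del: of_nat_Suc)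
    then obtain u where u: "u \<in> T j" "u \<in> {real k * t / real m..<real (Suc k) * t / real m}"
      by blast
    have "real (Suc k) * t \<le> real m * t" using m t by (intro mult_right_mono) auto
    hence "real (Suc k) * t / real m \<le> t" using m by (simp add: field_simps)
    moreover have "0 \<le> real k * t / real m" using t by simp
    ultimately have "0 \<le> u" "u < t" using u by (auto simp del: of_nat_Suc)
    thus "\<exists>u\<in>T j. 0 \<le> u \<and> u < t \<and> (\<forall>i\<in>{1..<j}. u \<notin> T i)" using u c by blast
  qed
  finally show ?thesis using j by simp
next
  case False
  thus ?thesis using moved_before_subset[of n T t] by (auto simp: requested_before_def)
qed

text \<open>Both comparisons of first request times after \<open>t\<close> that occur here, strict for smaller labels and
weak for all others, can be decided at rational distances from \<open>t\<close>.\<close>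

lemma next_label_iff_counts:
  assumes T: "locally_finite_times n T" and t: "0 \<le> t"
  shows "next_label n T t = Some i \<longleftrightarrow> i \<in> {1..n} \<and>
    (\<exists>q\<in>\<rat>. count_in T i t (t + q) \<noteq> 0 \<and> (\<forall>j\<in>{1..<i}. count_in T j t (t + q) = 0)) \<and>
    (\<forall>j\<in>{1..n}. \<forall>q\<in>\<rat>. count_in T j t (t + q) \<noteq> 0 \<longrightarrow> count_in T i t (t + q) \<noteq> 0)"
proof (cases "i \<in> {1..n}")
  case i: True
  have eq0: "count_in T j t b = 0 \<longleftrightarrow> T j \<inter> {t..<b} = {}" if "j \<in> {1..n}" for j b
    using that t by (intro count_in_eq_0_iff[OF T]) auto
  have pos: "0 < count_in T j t b \<longleftrightarrow> T j \<inter> {t..<b} \<noteq> {}" if "j \<in> {1..n}" for j b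
    using eq0[OF that, of b] by linarith
  have sub: "{1..<i} \<subseteq> {1..n}" using i by auto
  show ?thesis
  proof (intro iffI conjI)
    assume "next_label n T t = Some i"
    then obtain u where u: "u \<in> T i" "t \<le> u" "\<forall>j\<in>{1..n}. T j \<inter> {t..<u} = {}" "\<forall>j\<in>{1..<i}. u \<notin> T j"
      using next_label_eq_Some_iff[OF T t] by auto
    obtain d where d: "d > 0" "\<forall>x\<in>request_times n T \<inter> {0..<u+1}. x = u \<or> d \<le> \<bar>x - u\<bar>"
      using gap_left_right[OF finite_requests(1)[OF T]] by metis
    obtain q where q: "q \<in> \<rat>" "u - t < q" "q < u - t + min d 1"
      using Rats_dense_in_real[of "u - t" "u - t + min d 1"] d by auto
    have "T j \<inter> {t..<t+q} = {}" if j: "j \<in> {1..<i}" for j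
    proof (rule ccontr)
      assume "T j \<inter> {t..<t+q} \<noteq> {}"
      then obtain x where x: "x \<in> T j" "t \<le> x" "x < t + q" by auto
      have "x \<noteq> u" using x u j by auto
      moreover have "\<not> x < u" using u(3) x j i by force
      moreover have "x \<in> request_times n T \<inter> {0..<u+1}" using x j i q t by (auto simp: request_times_def)
      ultimately show False using d x q by auto
    qed
    moreover have "T i \<inter> {t..<t+q} \<noteq> {}" using u q by auto
    ultimately show "\<exists>q\<in>\<rat>. count_in T i t (t + q) \<noteq> 0 \<and> (\<forall>j\<in>{1..<i}. count_in T j t (t + q) = 0)"
      using q(1) i sub by (intro bexI[of _ q] conjI) (auto simp: eq0 pos simp del: of_nat_Suc)
    show "\<forall>j\<in>{1..n}. \<forall>q\<in>\<rat>. count_in T j t (t + q) \<noteq> 0 \<longrightarrow> count_in T i t (t + q) \<noteq> 0"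
    proof (intro ballI impI)
      fix j q assume j: "j \<in> {1..n}" and "count_in T j t (t + q) \<noteq> 0"
      then obtain x where x: "x \<in> T j" "t \<le> x" "x < t + q" by (auto simp: eq0 pos simp del: of_nat_Suc)
      have "u \<le> x" using u(3) j x by force
      hence "u \<in> T i \<inter> {t..<t+q}" using u x by auto
      thus "count_in T i t (t + q) \<noteq> 0" using i by (auto simp: eq0 pos simp del: of_nat_Suc)
    qed
  next
    assume R: "i \<in> {1..n} \<and>
      (\<exists>q\<in>\<rat>. count_in T i t (t + q) \<noteq> 0 \<and> (\<forall>j\<in>{1..<i}. count_in T j t (t + q) = 0)) \<and>
      (\<forall>j\<in>{1..n}. \<forall>q\<in>\<rat>. count_in T j t (t + q) \<noteq> 0 \<longrightarrow> count_in T i t (t + q) \<noteq> 0)"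
    hence R3: "\<And>j q. j \<in> {1..n} \<Longrightarrow> q \<in> \<rat> \<Longrightarrow> count_in T j t (t + q) \<noteq> 0 \<Longrightarrow> count_in T i t (t + q) \<noteq> 0"
      by blast
    from R obtain q where q: "T i \<inter> {t..<t+q} \<noteq> {}" "\<And>j. j \<in> {1..<i} \<Longrightarrow> T j \<inter> {t..<t+q} = {}"
      using i sub by (auto simp: eq0 pos subset_iff)
    let ?S = "T i \<inter> {t..<t+q}"
    have fin: "finite ?S"
      by (rule finite_subset[OF _ locally_finite_timesD(2)[OF T i, of "t+q"]]) (use t in auto)
    define u where "u = Min ?S"
    have u: "u \<in> ?S" unfolding u_def using fin q(1) by (rule Min_in)
    have first: "u \<le> x" if "x \<in> T i" "t \<le> x" for x
    proof (rule ccontr)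
      assume "\<not> u \<le> x"
      hence "x \<in> ?S" using that u by auto
      thus False using Min_le[OF fin] \<open>\<not> u \<le> x\<close> by (auto simp: u_def)
    qed
    have "T j \<inter> {t..<u} = {}" if j: "j \<in> {1..n}" for j
    proof (rule ccontr)
      assume "T j \<inter> {t..<u} \<noteq> {}"
      then obtain x where x: "x \<in> T j" "t \<le> x" "x < u" by auto
      obtain r where r: "r \<in> \<rat>" "x - t < r" "r < u - t"
        using Rats_dense_in_real[of "x - t" "u - t"] x by auto
      have "x \<in> T j \<inter> {t..<t+r}" using x r by auto
      hence "count_in T j t (t + r) \<noteq> 0" using j by (auto simp: eq0 pos simp del: of_nat_Suc)
      hence "count_in T i t (t + r) \<noteq> 0" by (rule R3[OF j r(1)])
      hence "T i \<inter> {t..<t+r} \<noteq> {}" using eq0[OF i, of "t + r"] by simp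
      then obtain y where "y \<in> T i" "t \<le> y" "y < t + r" by auto
      thus False using first[of y] r by auto
    qed
    moreover have "u \<notin> T j" if "j \<in> {1..<i}" for j using q(2)[OF that] u by auto
    moreover have "u \<in> T i" "t \<le> u" using u by auto
    ultimately show "next_label n T t = Some i"
      unfolding next_label_eq_Some_iff[OF T t] using i by (intro bexI[of _ u] conjI ballI) simp_all
  qed (use i in auto)
next
  case False thus ?thesis using next_label_range[OF T t] by auto
qed

lemma requested_before_eq:
  assumes T: "locally_finite_times n T"
  shows "requested_before n T t = {i\<in>{1..n}. count_in T i 0 t \<noteq> 0}"
  unfolding requested_before_def
proof (intro Collect_cong conj_cong refl)
  fix i assume "i \<in> {1..n}"
  from count_in_eq_0_iff[OF T this, of 0 t]
  show "T i \<inter> {0..<t} \<noteq> {} \<longleftrightarrow> count_in T i 0 t \<noteq> 0" by simp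
qed

section \<open>Poisson counts\<close>

definition poisson_prob :: "real \<Rightarrow> nat set \<Rightarrow> real" where
  "poisson_prob r K = (\<Sum>k. of_bool (k \<in> K) * poisson_mass r k)"

lemma poisson_mass_nonneg: "0 \<le> r \<Longrightarrow> 0 \<le> poisson_mass r k"
  by (simp add: poisson_mass_def)

lemma poisson_mass_sums: "(\<lambda>k. poisson_mass r k) sums 1"
proof -
  have "(\<lambda>k. r ^ k /\<^sub>R fact k * exp (- r)) sums (exp r * exp (- r))"
    by (intro sums_mult2 exp_converges)
  thus ?thesis by (simp add: poisson_mass_def field_simps exp_minus)
qed

lemma summable_poisson_prob:
  assumes "0 \<le> r"
  shows "summable (\<lambda>k. of_bool (k \<in> K) * poisson_mass r k)"
  by (rule summable_comparison_test_ev[OF _ sums_summable[OF poisson_mass_sums[of r]]])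
     (use poisson_mass_nonneg[OF assms] in auto)

lemma poisson_prob_singleton: "poisson_prob r {k} = poisson_mass r k"
proof -
  have "(\<lambda>j. of_bool (j \<in> {k}) * poisson_mass r j) = (\<lambda>j. if j = k then poisson_mass r j else 0)"
    by auto
  hence "(\<lambda>j. of_bool (j \<in> {k}) * poisson_mass r j) sums poisson_mass r k"
    using sums_single[of k "poisson_mass r"] by simp
  thus ?thesis unfolding poisson_prob_def by (rule sums_unique[symmetric])
qed

lemma poisson_prob_UNIV: "poisson_prob r UNIV = 1"
  unfolding poisson_prob_def using sums_unique[OF poisson_mass_sums[of r]] by simp

lemma poisson_prob_0: "poisson_prob r {0} = exp (- r)"
  by (simp add: poisson_prob_singleton poisson_mass_def)

lemma poisson_prob_1: "poisson_prob r {1} = r * exp (- r)"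
  by (subst poisson_prob_singleton) (simp add: poisson_mass_def)

lemma poisson_prob_pos: "0 \<le> r \<Longrightarrow> poisson_prob r (- {0}) = 1 - exp (- r)"
proof -
  assume r: "0 \<le> r"
  have "poisson_prob r (- {0}) + poisson_prob r {0} = poisson_prob r UNIV"
    unfolding poisson_prob_def
    by (subst suminf_add[OF summable_poisson_prob[OF r] summable_poisson_prob[OF r]])
       (auto intro!: suminf_cong)
  thus ?thesis by (simp add: poisson_prob_0 poisson_prob_UNIV)
qed

lemma poisson_prob_nonneg: "0 \<le> r \<Longrightarrow> 0 \<le> poisson_prob r K"
  unfolding poisson_prob_def by (intro suminf_nonneg summable_poisson_prob) (auto simp: poisson_mass_nonneg)

lemma poisson_prob_le_1: assumes "0 \<le> r" shows "poisson_prob r K \<le> 1"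
proof -
  have "poisson_prob r K \<le> poisson_prob r UNIV"
    unfolding poisson_prob_def
    by (intro suminf_le summable_poisson_prob assms) (auto simp: poisson_mass_nonneg assms)
  thus ?thesis by (simp add: poisson_prob_UNIV)
qed

lemma ennreal_poisson_prob:
  assumes "0 \<le> r"
  shows "ennreal (poisson_prob r K) = (\<Sum>k. of_bool (k \<in> K) * ennreal (poisson_mass r k))"
proof -
  have "ennreal (poisson_prob r K) = (\<Sum>k. ennreal (of_bool (k \<in> K) * poisson_mass r k))"
    unfolding poisson_prob_def
    by (intro suminf_ennreal2[symmetric] summable_poisson_prob assms) (auto simp: poisson_mass_nonneg assms)
  thus ?thesis by (auto simp: of_bool_def intro!: suminf_cong)
qed

lemma popularity_nonneg:
  assumes "\<And>i. i \<in> {1..n} \<Longrightarrow> 0 \<le> x i" "i \<in> {1..n}"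
  shows "0 \<le> popularity n x i"
  unfolding popularity_def using assms by (intro divide_nonneg_nonneg sum_nonneg) auto

lemma sum_popularity: "(\<Sum>i=1..n. popularity n x i) = of_bool ((\<Sum>i=1..n. x i) \<noteq> 0)"
  by (simp add: popularity_def flip: sum_divide_distrib)

lemma popularity_eq_0:
  assumes "(\<Sum>i=1..n. x i) = 0" shows "popularity n x i = 0"
  by (simp only: popularity_def assms div_by_0)

locale poisson_requests = prob_space N for N :: "'a measure" +
  fixes n :: nat and v :: "nat \<Rightarrow> 'a \<Rightarrow> real" and T :: "nat \<Rightarrow> 'a \<Rightarrow> real set"
  assumes v_meas [measurable]: "\<And>i. i \<in> {1..n} \<Longrightarrow> v i \<in> borel_measurable N"
    and v_nonneg: "\<And>i \<omega>. i \<in> {1..n} \<Longrightarrow> \<omega> \<in> space N \<Longrightarrow> 0 \<le> v i \<omega>"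
    and requests: "cond_poisson_requests N n v T"
begin

abbreviation p :: "nat \<Rightarrow> 'a \<Rightarrow> real" where
  "p i \<omega> \<equiv> popularity n (\<lambda>l. v l \<omega>) i"

abbreviation cnt :: "nat \<Rightarrow> real \<Rightarrow> real \<Rightarrow> 'a \<Rightarrow> nat" where
  "cnt i a b \<omega> \<equiv> count_in (\<lambda>l. T l \<omega>) i a b"

lemma p_measurable [measurable]: "i \<in> {1..n} \<Longrightarrow> p i \<in> borel_measurable N"
  unfolding popularity_def by measurable

lemma p_nonneg: "i \<in> {1..n} \<Longrightarrow> \<omega> \<in> space N \<Longrightarrow> 0 \<le> p i \<omega>"
  by (intro popularity_nonneg) (auto simp: v_nonneg)

lemma p_le_1: assumes "i \<in> {1..n}" "\<omega> \<in> space N" shows "p i \<omega> \<le> 1"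
proof -
  have "p i \<omega> \<le> (\<Sum>j=1..n. p j \<omega>)"
    using assms by (intro member_le_sum p_nonneg) auto
  also have "\<dots> \<le> 1" unfolding sum_popularity by simp
  finally show ?thesis .
qed

lemma locally_finite: "\<omega> \<in> space N \<Longrightarrow> locally_finite_times n (\<lambda>l. T l \<omega>)"
  using requests by (auto simp: cond_poisson_requests_def locally_finite_times_def)

lemma c_measurable [measurable]:
  assumes "i \<in> {1..n}" "0 \<le> a"
  shows "cnt i a b \<in> measurable N (count_space UNIV)"
  using requests assms unfolding cond_poisson_requests_def count_in_def by blast

text \<open>Integrating out the conditioning turns the product of Poisson laws into its mixture over the weights. The
cost being a nonrandom function of the next label and of the set of requested objects,
its expectation is determined by such mixtures.\<close>

lemma counts_law_exact:
  fixes s :: "nat \<Rightarrow> real"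
  assumes s: "0 \<le> s 0" "\<And>j. j < m \<Longrightarrow> s j \<le> s (Suc j)"
  shows "emeasure N {\<omega>\<in>space N. \<forall>i\<in>{1..n}. \<forall>j<m. cnt i (s j) (s (Suc j)) \<omega> = k i j} =
    (\<integral>\<^sup>+ \<omega>. ennreal (\<Prod>i=1..n. \<Prod>j<m. poisson_mass (p i \<omega> * (s (Suc j) - s j)) (k i j)) \<partial>N)"
proof -
  let ?F = "vimage_algebra (space N) (weight_vector n v) (\<Pi>\<^sub>M i\<in>{1..n}. borel)"
  let ?f = "\<lambda>\<omega>. of_bool (\<forall>i\<in>{1..n}. \<forall>j<m. cnt i (s j) (s (Suc j)) \<omega> = k i j) :: real"
  let ?g = "\<lambda>\<omega>. \<Prod>i=1..n. \<Prod>j<m. poisson_mass (p i \<omega> * (s (Suc j) - s j)) (k i j)"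
  have s0: "0 \<le> s j" if "j \<le> m" for j
    using that by (induction j) (use s in \<open>auto intro: order_trans\<close>)
  have wv [measurable]: "weight_vector n v \<in> measurable N (\<Pi>\<^sub>M i\<in>{1..n}. borel)"
    unfolding weight_vector_def by measurable
  have sub: "subalgebra N ?F"
    unfolding subalgebra_def by (intro conjI sets_image_in_sets wv) simp_all
  interpret finite_measure_subalgebra N ?F
    by (unfold_locales) (rule sub)
  have cm [measurable]: "cnt i (s j) (s (Suc j)) \<in> measurable N (count_space UNIV)" if "i \<in> {1..n}" "j < m" for i j
    using that s0[of j] by (intro c_measurable) auto
  have meas [measurable]: "Measurable.pred N (\<lambda>\<omega>. \<forall>i\<in>{1..n}. \<forall>j<m. cnt i (s j) (s (Suc j)) \<omega> = k i j)"
  proof -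
    have "(\<lambda>\<omega>. \<forall>i\<in>{1..n}. \<forall>j<m. cnt i (s j) (s (Suc j)) \<omega> = k i j) =
       (\<lambda>\<omega>. \<forall>i\<in>{1..n}. \<forall>j\<in>{..<m}. cnt i (s j) (s (Suc j)) \<omega> = k i j)" by auto
    also have "Measurable.pred N \<dots>"
      by (intro pred_intros_finite) (auto intro!: measurable_compose[OF cm])
    finally show ?thesis .
  qed
  have fint: "integrable N ?f"
    by (rule integrable_const_bound[where B=1]) auto
  have AE: "AE \<omega> in N. real_cond_exp N ?F ?f \<omega> = ?g \<omega>"
    using requests s unfolding cond_poisson_requests_def count_in_def by blast
  have gm: "?g \<in> borel_measurable N" unfolding poisson_mass_def by measurable
  have gnn: "AE \<omega> in N. 0 \<le> ?g \<omega>"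
    by (intro AE_I2 prod_nonneg ballI poisson_mass_nonneg mult_nonneg_nonneg p_nonneg) (auto simp: s)
  have int: "integrable N ?g"
    using integrable_cong_AE[THEN iffD1, OF _ gm AE real_cond_exp_int(1)[OF fint]] by auto
  have "prob {\<omega>\<in>space N. \<forall>i\<in>{1..n}. \<forall>j<m. cnt i (s j) (s (Suc j)) \<omega> = k i j} = (LINT \<omega>|N. ?f \<omega>)"
  proof -
    have "(LINT \<omega>|N. ?f \<omega>) = (LINT \<omega>|N. indicator {\<omega>\<in>space N. \<forall>i\<in>{1..n}. \<forall>j<m. cnt i (s j) (s (Suc j)) \<omega> = k i j} \<omega>)"
      by (intro Bochner_Integration.integral_cong) (auto simp: indicator_def)
    thus ?thesis by simp
  qed
  also have "\<dots> = (LINT \<omega>|N. real_cond_exp N ?F ?f \<omega>)"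
    by (rule real_cond_exp_int(2)[OF fint, symmetric])
  also have "\<dots> = (LINT \<omega>|N. ?g \<omega>)"
    by (rule integral_cong_AE[OF _ gm AE]) auto
  finally show ?thesis
    unfolding emeasure_eq_measure nn_integral_eq_integral[OF int gnn] by simp
qed

lemma counts_law_nn:
  fixes s :: "nat \<Rightarrow> real"
  assumes s: "0 \<le> s 0" "\<And>j. j < m \<Longrightarrow> s j \<le> s (Suc j)"
  shows "emeasure N {\<omega>\<in>space N. \<forall>i\<in>{1..n}. \<forall>j<m. cnt i (s j) (s (Suc j)) \<omega> \<in> K i j} =
    (\<integral>\<^sup>+ \<omega>. (\<Prod>i=1..n. \<Prod>j<m. ennreal (poisson_prob (p i \<omega> * (s (Suc j) - s j)) (K i j))) \<partial>N)"
proof -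
  let ?I = "{1..n} \<times> {..<m}"
  define cc where "cc = (\<lambda>x. cnt (fst x) (s (snd x)) (s (Suc (snd x))))"
  define r where "r = (\<lambda>x \<omega>. p (fst x) \<omega> * (s (Suc (snd x)) - s (snd x)))"
  have s0: "0 \<le> s j" if "j \<le> m" for j
    using that by (induction j) (use s in \<open>auto intro: order_trans\<close>)
  have ccm [measurable]: "cc x \<in> measurable N (count_space UNIV)" if "x \<in> ?I" for x
    using that s0[of "snd x"] unfolding cc_def by (intro c_measurable) auto
  have r0: "0 \<le> r x \<omega>" if "x \<in> ?I" "\<omega> \<in> space N" for x \<omega>
    using that s unfolding r_def by (intro mult_nonneg_nonneg p_nonneg) auto
  have rm [measurable]: "r x \<in> borel_measurable N" if "x \<in> ?I" for x
    using that unfolding r_def by (intro borel_measurable_times p_measurable) auto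
  have pm [measurable]: "(\<lambda>\<omega>. poisson_prob (r x \<omega>) A) \<in> borel_measurable N" if "x \<in> ?I" for x A
    unfolding poisson_prob_def poisson_mass_def using rm[OF that] by measurable
  have ev [measurable]: "{\<omega>\<in>space N. \<forall>x\<in>?I. cc x \<omega> \<in> K x} \<in> sets N" for K
  proof -
    have "Measurable.pred N (\<lambda>\<omega>. \<forall>x\<in>?I. cc x \<omega> \<in> K x)"
      by (intro pred_intros_finite) (auto intro!: measurable_compose[OF ccm])
    thus ?thesis by measurable
  qed
  \<comment> \<open>Free one coordinate at a time: a constraint to a set is a countable disjoint union of
    constraints to points.\<close>
  have main: "emeasure N {\<omega>\<in>space N. \<forall>x\<in>?I. cc x \<omega> \<in> K x} =
      (\<integral>\<^sup>+ \<omega>. (\<Prod>x\<in>?I. ennreal (poisson_prob (r x \<omega>) (K x))) \<partial>N)"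
    if "J \<subseteq> ?I" "\<forall>x\<in>?I - J. \<exists>k. K x = {k}" for J K
  proof -
    have "finite J" using that(1) by (rule finite_subset) simp
    thus ?thesis using that
    proof (induction J arbitrary: K rule: finite_induct)
      case empty
      then obtain k where k: "\<And>x. x \<in> ?I \<Longrightarrow> K x = {k x}" by (metis Diff_empty)
      have "{\<omega>\<in>space N. \<forall>x\<in>?I. cc x \<omega> \<in> K x} =
        {\<omega>\<in>space N. \<forall>i\<in>{1..n}. \<forall>j<m. cnt i (s j) (s (Suc j)) \<omega> = k (i, j)}"
        using k by (auto simp: cc_def)
      moreover have "ennreal (\<Prod>i=1..n. \<Prod>j<m. poisson_mass (p i \<omega> * (s (Suc j) - s j)) (k (i, j))) =
        (\<Prod>x\<in>?I. ennreal (poisson_prob (r x \<omega>) (K x)))" if "\<omega> \<in> space N" for \<omega>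
      proof -
        have "(\<Prod>i=1..n. \<Prod>j<m. poisson_mass (p i \<omega> * (s (Suc j) - s j)) (k (i, j))) =
          (\<Prod>x\<in>?I. poisson_prob (r x \<omega>) (K x))"
          unfolding prod.cartesian_product
          by (intro prod.cong) (use k in \<open>auto simp: r_def poisson_prob_singleton\<close>)
        also have "ennreal \<dots> = (\<Prod>x\<in>?I. ennreal (poisson_prob (r x \<omega>) (K x)))"
          by (intro prod_ennreal[symmetric] poisson_prob_nonneg r0 that)
        finally show ?thesis .
      qed
      ultimately show ?case
        using counts_law_exact[of s m "\<lambda>i j. k (i, j)", OF s] by (simp cong: nn_integral_cong)
    next
      case (insert y J)
      have y: "y \<in> ?I" using insert.prems by auto
      let ?K = "\<lambda>k. K(y := {k})"
      let ?E = "\<lambda>K. {\<omega>\<in>space N. \<forall>x\<in>?I. cc x \<omega> \<in> K x}"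
      have IH: "emeasure N (?E (?K k)) = (\<integral>\<^sup>+ \<omega>. (\<Prod>x\<in>?I. ennreal (poisson_prob (r x \<omega>) (?K k x))) \<partial>N)" for k
        using insert.prems by (intro insert.IH) auto
      define D where "D = (\<lambda>k. if k \<in> K y then ?E (?K k) else {})"
      have D: "range D \<subseteq> sets N" unfolding D_def using ev by (intro image_subsetI) (simp split: if_split)
      have disj: "disjoint_family D"
        unfolding disjoint_family_on_def D_def using y by auto
      have un: "?E K = (\<Union>k. D k)"
        using y by (auto simp: D_def split: if_splits)
      have "emeasure N (?E K) = (\<Sum>k. emeasure N (D k))"
        by (subst un) (rule suminf_emeasure[OF D disj, symmetric])
      also have "\<dots> = (\<Sum>k. \<integral>\<^sup>+ \<omega>. of_bool (k \<in> K y) * ennreal (poisson_mass (r y \<omega>) k) *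
          (\<Prod>x\<in>?I - {y}. ennreal (poisson_prob (r x \<omega>) (K x))) \<partial>N)"
      proof (rule suminf_cong)
        fix k
        show "emeasure N (D k) = (\<integral>\<^sup>+ \<omega>. of_bool (k \<in> K y) * ennreal (poisson_mass (r y \<omega>) k) *
          (\<Prod>x\<in>?I - {y}. ennreal (poisson_prob (r x \<omega>) (K x))) \<partial>N)"
        proof (cases "k \<in> K y")
          case True
          have "(\<Prod>x\<in>?I. ennreal (poisson_prob (r x \<omega>) (?K k x))) =
            ennreal (poisson_mass (r y \<omega>) k) * (\<Prod>x\<in>?I - {y}. ennreal (poisson_prob (r x \<omega>) (K x)))" for \<omega>
            by (subst prod.remove[OF _ y]) (auto simp: poisson_prob_singleton intro!: prod.cong)
          thus ?thesis using True IH[of k] by (simp add: D_def)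
        qed (simp add: D_def)
      qed
      also have "\<dots> = (\<integral>\<^sup>+ \<omega>. (\<Sum>k. of_bool (k \<in> K y) * ennreal (poisson_mass (r y \<omega>) k) *
          (\<Prod>x\<in>?I - {y}. ennreal (poisson_prob (r x \<omega>) (K x)))) \<partial>N)"
        unfolding poisson_mass_def
        by (intro nn_integral_suminf[symmetric]) (use rm[OF y] in measurable)
      also have "\<dots> = (\<integral>\<^sup>+ \<omega>. (\<Prod>x\<in>?I. ennreal (poisson_prob (r x \<omega>) (K x))) \<partial>N)"
        by (intro nn_integral_cong, subst prod.remove[OF _ y])
           (use y r0 in \<open>auto simp: ennreal_poisson_prob\<close>)
      finally show ?case .
    qed
  qed
  have "{\<omega>\<in>space N. \<forall>i\<in>{1..n}. \<forall>j<m. cnt i (s j) (s (Suc j)) \<omega> \<in> K i j} =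
     {\<omega>\<in>space N. \<forall>x\<in>?I. cc x \<omega> \<in> case_prod K x}"
    by (auto simp: cc_def)
  also have "emeasure N \<dots> = (\<integral>\<^sup>+ \<omega>. (\<Prod>x\<in>?I. ennreal (poisson_prob (r x \<omega>) (case_prod K x))) \<partial>N)"
    by (rule main[of ?I]) auto
  also have "\<dots> = (\<integral>\<^sup>+ \<omega>. (\<Prod>i=1..n. \<Prod>j<m. ennreal (poisson_prob (p i \<omega> * (s (Suc j) - s j)) (K i j))) \<partial>N)"
    unfolding prod.cartesian_product by (intro nn_integral_cong prod.cong) (auto simp: r_def)
  finally show ?thesis .
qed

lemma counts_law:
  fixes s :: "nat \<Rightarrow> real"
  assumes s: "0 \<le> s 0" "\<And>j. j < m \<Longrightarrow> s j \<le> s (Suc j)"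
  shows "prob {\<omega>\<in>space N. \<forall>i\<in>{1..n}. \<forall>j<m. cnt i (s j) (s (Suc j)) \<omega> \<in> K i j} =
    (LINT \<omega>|N. (\<Prod>i=1..n. \<Prod>j<m. poisson_prob (p i \<omega> * (s (Suc j) - s j)) (K i j)))"
proof -
  let ?g = "\<lambda>\<omega>. \<Prod>i=1..n. \<Prod>j<m. poisson_prob (p i \<omega> * (s (Suc j) - s j)) (K i j)"
  have r0: "0 \<le> p i \<omega> * (s (Suc j) - s j)" if "i \<in> {1..n}" "j < m" "\<omega> \<in> space N" for i j \<omega>
    using that s by (intro mult_nonneg_nonneg p_nonneg) auto
  have gm: "?g \<in> borel_measurable N" unfolding poisson_prob_def poisson_mass_def by measurable
  have gb: "0 \<le> ?g \<omega> \<and> ?g \<omega> \<le> 1" if "\<omega> \<in> space N" for \<omega>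
    using that by (intro conjI prod_nonneg prod_le_1 ballI poisson_prob_nonneg poisson_prob_le_1 r0) auto
  have int: "integrable N ?g"
    by (rule integrable_const_bound[where B=1]) (use gm gb in auto)
  have "ennreal (LINT \<omega>|N. ?g \<omega>) = (\<integral>\<^sup>+ \<omega>. ennreal (?g \<omega>) \<partial>N)"
    by (intro nn_integral_eq_integral[symmetric] int) (use gb in auto)
  also have "\<dots> = (\<integral>\<^sup>+ \<omega>. (\<Prod>i=1..n. \<Prod>j<m. ennreal (poisson_prob (p i \<omega> * (s (Suc j) - s j)) (K i j))) \<partial>N)"
  proof (rule nn_integral_cong)
    fix \<omega> assume \<omega>: "\<omega> \<in> space N"
    have nn: "0 \<le> poisson_prob (p i \<omega> * (s (Suc j) - s j)) (K i j)" if "i \<in> {1..n}" "j \<in> {..<m}" for i j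
      using that \<omega> by (intro poisson_prob_nonneg r0) auto
    have "ennreal (?g \<omega>) = (\<Prod>i=1..n. ennreal (\<Prod>j<m. poisson_prob (p i \<omega> * (s (Suc j) - s j)) (K i j)))"
      by (intro prod_ennreal[symmetric] prod_nonneg nn)
    also have "\<dots> = (\<Prod>i=1..n. \<Prod>j<m. ennreal (poisson_prob (p i \<omega> * (s (Suc j) - s j)) (K i j)))"
      by (intro prod.cong refl prod_ennreal[symmetric] nn)
    finally show "ennreal (?g \<omega>) = \<dots>" .
  qed
  also have "\<dots> = emeasure N {\<omega>\<in>space N. \<forall>i\<in>{1..n}. \<forall>j<m. cnt i (s j) (s (Suc j)) \<omega> \<in> K i j}"
    by (rule counts_law_nn[symmetric]) (use s in auto)
  finally show ?thesis using gb by (simp add: emeasure_eq_measure integral_nonneg_AE)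
qed

section \<open>Simultaneous requests and measurability\<close>

abbreviation reqs :: "'a \<Rightarrow> nat \<Rightarrow> real set" where "reqs \<omega> \<equiv> (\<lambda>l. T l \<omega>)"

lemma two_requests_prob_le:
  assumes ij: "i \<in> {1..n}" "j \<in> {1..n}" "i \<noteq> j" and ab: "0 \<le> a" "a \<le> b"
  shows "prob {\<omega>\<in>space N. cnt i a b \<omega> \<noteq> 0 \<and> cnt j a b \<omega> \<noteq> 0} \<le> (b - a)\<^sup>2"
proof -
  define s where "s = (\<lambda>k::nat. if k = 0 then a else b)"
  define K where "K = (\<lambda>l (k::nat). if l = i \<or> l = j then - {0::nat} else UNIV)"
  have "prob {\<omega>\<in>space N. cnt i a b \<omega> \<noteq> 0 \<and> cnt j a b \<omega> \<noteq> 0} =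
     prob {\<omega>\<in>space N. \<forall>l\<in>{1..n}. \<forall>k<1. cnt l (s k) (s (Suc k)) \<omega> \<in> K l k}"
    using ij by (intro arg_cong[where f=prob]) (auto simp: s_def K_def)
  also have "\<dots> = (LINT \<omega>|N. (\<Prod>l=1..n. \<Prod>k<1. poisson_prob (p l \<omega> * (s (Suc k) - s k)) (K l k)))"
    by (rule counts_law[of s 1 K]) (use ab in \<open>auto simp: s_def\<close>)
  also have "\<dots> = (LINT \<omega>|N. (\<Prod>l=1..n. poisson_prob (p l \<omega> * (b - a)) (K l 0)))"
  proof (intro Bochner_Integration.integral_cong prod.cong refl)
    fix \<omega> l
    have "s 0 = a" "s (Suc 0) = b" by (simp_all add: s_def)
    moreover have "{..<1} = {0::nat}" by auto
    ultimately show "(\<Prod>k<1. poisson_prob (p l \<omega> * (s (Suc k) - s k)) (K l k)) = poisson_prob (p l \<omega> * (b - a)) (K l 0)"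
      by simp
  qed
  also have "\<dots> \<le> (LINT \<omega>|N. (b - a)\<^sup>2)"
  proof (rule integral_mono')
    fix \<omega> assume \<omega>: "\<omega> \<in> space N"
    have pp: "0 \<le> p l \<omega> * (b - a)" "p l \<omega> * (b - a) \<le> b - a" if "l \<in> {1..n}" for l
      using p_nonneg[OF that \<omega>] p_le_1[OF that \<omega>] ab
      by (simp_all add: mult_left_le_one_le)
    have q: "poisson_prob (p l \<omega> * (b - a)) (- {0}) \<le> b - a" if "l \<in> {1..n}" for l
      using pp[OF that] exp_ge_add_one_self[of "- (p l \<omega> * (b - a))"] by (simp add: poisson_prob_pos)
    have "(\<Prod>l=1..n. poisson_prob (p l \<omega> * (b - a)) (K l 0)) =
      (\<Prod>l\<in>{i,j}. poisson_prob (p l \<omega> * (b - a)) (- {0}))"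
      using ij by (intro prod.mono_neutral_cong_right) (auto simp: K_def poisson_prob_UNIV)
    also have "\<dots> \<le> (b - a) * (b - a)"
      using ij q[OF ij(1)] q[OF ij(2)] ab poisson_prob_nonneg[OF pp(1)[OF ij(1)]] poisson_prob_nonneg[OF pp(1)[OF ij(2)]]
      by (auto intro!: mult_mono)
    finally show "(\<Prod>l=1..n. poisson_prob (p l \<omega> * (b - a)) (K l 0)) \<le> (b - a)\<^sup>2"
      by (simp add: power2_eq_square)
  qed auto
  finally show ?thesis by (simp add: prob_space)
qed

text \<open>An object requested but not moved shares each of its instants of requests with another object. So on every
grid with \<open>m\<close> cells of \<open>[0, s)\<close> some cell contains requests of two different objects, which
has probability at most \<open>n^2 * s^2 / m\<close>.\<close>

lemma AE_moved_eq_requested: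
  assumes s: "0 \<le> s"
  shows "AE \<omega> in N. moved_before n (reqs \<omega>) s = requested_before n (reqs \<omega>) s"
proof -
  define C where "C = (\<lambda>m k i j. {\<omega>\<in>space N.
    cnt i (real k * s / real m) (real (Suc k) * s / real m) \<omega> \<noteq> 0 \<and>
    cnt j (real k * s / real m) (real (Suc k) * s / real m) \<omega> \<noteq> 0})"
  define Q where "Q = {(i, j). i \<in> {1..n} \<and> j \<in> {1..n} \<and> i \<noteq> j}"
  define D where "D = (\<lambda>m. \<Union>x\<in>{..<m} \<times> Q. C m (fst x) (fst (snd x)) (snd (snd x)))"
  have Q: "finite Q" "card Q \<le> n * n"
  proof -
    have "Q \<subseteq> {1..n} \<times> {1..n}" by (auto simp: Q_def)
    thus "finite Q" by (rule finite_subset) simp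
    have "card Q \<le> card ({1..n} \<times> {1..n})" by (intro card_mono \<open>Q \<subseteq> _\<close>) simp
    thus "card Q \<le> n * n" by simp
  qed
  have Cm: "C m k i j \<in> sets N" if "(i, j) \<in> Q" for m k i j
  proof -
    have [measurable]: "cnt l (real k * s / real m) (real (Suc k) * s / real m) \<in> measurable N (count_space UNIV)"
      if "l = i \<or> l = j" for l
      using that \<open>(i, j) \<in> Q\<close> s by (intro c_measurable) (auto simp: Q_def)
    show ?thesis unfolding C_def by measurable
  qed
  have Dm: "D m \<in> sets N" for m
    unfolding D_def using Q(1) Cm by (intro sets.finite_UN) auto
  have Dle: "prob (D m) \<le> real (n * n) * s\<^sup>2 / real m" if m: "m \<ge> 1" for m
  proof -
    have "prob (D m) \<le> (\<Sum>x\<in>{..<m} \<times> Q. prob (C m (fst x) (fst (snd x)) (snd (snd x))))"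
      unfolding D_def using Q(1) Cm by (intro finite_measure_subadditive_finite) auto
    also have "\<dots> \<le> (\<Sum>x\<in>{..<m} \<times> Q. (s / real m)\<^sup>2)"
    proof (intro sum_mono)
      fix x assume x: "x \<in> {..<m} \<times> Q"
      have "prob (C m (fst x) (fst (snd x)) (snd (snd x))) \<le>
          (real (Suc (fst x)) * s / real m - real (fst x) * s / real m)\<^sup>2"
        unfolding C_def using x s m
        by (intro two_requests_prob_le) (auto simp: Q_def intro!: divide_right_mono mult_right_mono)
      also have "real (Suc (fst x)) * s / real m - real (fst x) * s / real m = s / real m"
        by (simp add: add_divide_distrib algebra_simps)
      finally show "prob (C m (fst x) (fst (snd x)) (snd (snd x))) \<le> (s / real m)\<^sup>2" .
    qed
    also have "\<dots> = real (card Q) * (s\<^sup>2 / real m)"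
      using m by (simp add: power2_eq_square card_cartesian_product field_simps)
    also have "\<dots> \<le> real (n * n) * (s\<^sup>2 / real m)"
      by (intro mult_right_mono) (use Q(2) in \<open>auto simp flip: of_nat_mult\<close>)
    finally show ?thesis by simp
  qed
  let ?Z = "\<Inter>m. D (Suc m)"
  have Zm: "?Z \<in> sets N" using Dm by (intro sets.countable_INT) auto
  have "prob ?Z \<le> real (n * n) * s\<^sup>2 / real (Suc m)" for m
  proof -
    have "prob ?Z \<le> prob (D (Suc m))" by (intro finite_measure_mono Dm) auto
    thus ?thesis using Dle[of "Suc m"] by simp
  qed
  moreover have "(\<lambda>m. real (n * n) * s\<^sup>2 / real (Suc m)) \<longlonglongrightarrow> 0"
    using tendsto_mult_right_zero[OF LIMSEQ_inverse_real_of_nat, of "real (n * n) * s\<^sup>2"] by (simp add: field_simps)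
  ultimately have "prob ?Z \<le> 0" by (intro LIMSEQ_le_const) auto
  hence Z: "?Z \<in> null_sets N"
    using Zm by (simp add: null_sets_def emeasure_eq_measure measure_le_0_iff)
  show ?thesis
  proof (rule AE_I'[OF Z], rule subsetI)
    fix \<omega> assume "\<omega> \<in> {\<omega> \<in> space N. moved_before n (reqs \<omega>) s \<noteq> requested_before n (reqs \<omega>) s}"
    hence \<omega>: "\<omega> \<in> space N" and ne: "moved_before n (reqs \<omega>) s \<noteq> requested_before n (reqs \<omega>) s" by auto
    note lf = locally_finite[OF \<omega>]
    obtain j where j: "j \<in> requested_before n (reqs \<omega>) s" "j \<notin> moved_before n (reqs \<omega>) s"
      using ne moved_before_subset[of n "reqs \<omega>" s] by blast
    have jn: "j \<in> {1..n}" and "T j \<omega> \<inter> {0..<s} \<noteq> {}" using j(1) by (auto simp: requested_before_def)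
    then obtain u where u: "u \<in> T j \<omega>" "0 \<le> u" "u < s" by auto
    show "\<omega> \<in> ?Z"
    proof
      fix m
      obtain k where k: "k < Suc m" "u \<in> {real k * s / real (Suc m)..<real (Suc k) * s / real (Suc m)}"
        using cell_exists[OF u(2,3), of "Suc m"] by auto
      let ?a = "real k * s / real (Suc m)" and ?b = "real (Suc k) * s / real (Suc m)"
      have "T j \<omega> \<inter> {?a..<?b} \<noteq> {}" using u k by blast
      hence cj: "cnt j ?a ?b \<omega> \<noteq> 0" using count_in_eq_0_iff[OF lf jn, of ?a ?b] s by auto
      have "Suc m \<ge> 1" by simp
      then obtain i where i: "i \<in> {1..<j}" "cnt i ?a ?b \<omega> \<noteq> 0"
        using j(2) jn cj k(1) unfolding moved_before_iff_counts[OF lf s] by blast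
      hence "(i, j) \<in> Q" using jn by (auto simp: Q_def)
      moreover have "\<omega> \<in> C (Suc m) k i j" using \<omega> i cj unfolding C_def by blast
      ultimately show "\<omega> \<in> D (Suc m)" unfolding D_def using k(1) by force
    qed
  qed
qed

lemma requested_before_iff:
  assumes "\<omega> \<in> space N"
  shows "l \<in> requested_before n (reqs \<omega>) s \<longleftrightarrow> l \<in> {1..n} \<and> cnt l 0 s \<omega> \<noteq> 0"
  unfolding requested_before_eq[OF locally_finite[OF assms]] mem_Collect_eq ..

lemma measurable_requested [measurable]:
  "Measurable.pred N (\<lambda>\<omega>. l \<in> requested_before n (reqs \<omega>) s)"
proof (cases "l \<in> {1..n}")
  case True
  have [measurable]: "cnt l 0 s \<in> measurable N (count_space UNIV)" using True by (intro c_measurable) auto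
  show ?thesis
    by (subst measurable_cong[OF requested_before_iff]) (assumption, measurable)
next
  case False
  hence "l \<notin> requested_before n (reqs \<omega>) s" for \<omega>
    by (auto simp: requested_before_def)
  thus ?thesis by simp
qed

lemma measurable_moved [measurable]:
  assumes s: "0 \<le> s"
  shows "Measurable.pred N (\<lambda>\<omega>. j \<in> moved_before n (reqs \<omega>) s)"
proof (cases "j \<in> {1..n}")
  case True
  have cm: "Measurable.pred N (\<lambda>\<omega>. cnt i (real k * s / real m) b \<omega> = 0)" if "i \<in> {1..j}" for i k m b
  proof -
    have [measurable]: "cnt i (real k * s / real m) b \<in> measurable N (count_space UNIV)"
      using that s True by (intro c_measurable) auto
    show ?thesis by measurable
  qed
  show ?thesis
    by (subst measurable_cong[OF moved_before_iff_counts[OF locally_finite s]], assumption)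
       (use True in \<open>intro pred_intros_logic pred_intros_countable pred_intros_finite cm; auto\<close>)
next
  case False
  hence "j \<notin> moved_before n (reqs \<omega>) s" for \<omega>
    using moved_before_subset[of n "reqs \<omega>" s] by (auto simp: requested_before_def)
  thus ?thesis by simp
qed

lemma measurable_next [measurable]:
  assumes s: "0 \<le> s"
  shows "Measurable.pred N (\<lambda>\<omega>. next_label n (reqs \<omega>) s = Some i)"
proof (cases "i \<in> {1..n}")
  case True
  have Rats: "(\<exists>q\<in>\<rat>. P q) \<longleftrightarrow> (\<exists>q. P (real_of_rat q))" "(\<forall>q\<in>\<rat>. P q) \<longleftrightarrow> (\<forall>q. P (real_of_rat q))" for P
    by (auto elim!: Rats_cases)
  have cm: "Measurable.pred N (\<lambda>\<omega>. cnt j s b \<omega> = 0)" if "j \<in> {1..n}" for j b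
  proof -
    have [measurable]: "cnt j s b \<in> measurable N (count_space UNIV)"
      using that s by (intro c_measurable) auto
    show ?thesis by measurable
  qed
  show ?thesis
    by (subst measurable_cong[OF next_label_iff_counts[OF locally_finite s, unfolded Rats]], assumption)
       (use True in \<open>intro pred_intros_logic pred_intros_finite pred_intros_countable cm; auto\<close>)
next
  case False
  show ?thesis
  proof (subst measurable_cong)
    show "next_label n (reqs \<omega>) s = Some i \<longleftrightarrow> False" if "\<omega> \<in> space N" for \<omega>
      using next_label_range[OF locally_finite[OF that] s] False by blast
  qed simp
qed

end

section \<open>The next request and the set of requested objects\<close>

lemma sum_of_bool_delta:
  fixes f :: "'b \<Rightarrow> 'c :: semiring_1"
  assumes "finite A" "i \<in> A"
  shows "(\<Sum>j\<in>A. of_bool (j = i) * f j) = f i"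
proof -
  have "(\<Sum>j\<in>A. of_bool (j = i) * f j) = (\<Sum>j\<in>A. if j = i then f j else 0)"
    by (intro sum.cong) auto
  thus ?thesis using assms by simp
qed

context poisson_requests begin

abbreviation unreq :: "real \<Rightarrow> nat \<Rightarrow> 'a \<Rightarrow> real" where
  "unreq s l \<omega> \<equiv> exp (- (p l \<omega> * s))"

definition pattern_prob :: "real \<Rightarrow> nat set \<Rightarrow> 'a \<Rightarrow> real" where
  "pattern_prob s B \<omega> = (\<Prod>l\<in>B. 1 - unreq s l \<omega>) * (\<Prod>l\<in>{1..n}-B. unreq s l \<omega>)"

lemma unreq_bounds:
  assumes "0 \<le> s" "l \<in> {1..n}" "\<omega> \<in> space N"
  shows "0 \<le> unreq s l \<omega>" "unreq s l \<omega> \<le> 1"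
  using assms p_nonneg by auto

lemma pattern_prob_alt:
  assumes "B \<subseteq> {1..n}"
  shows "pattern_prob s B \<omega> = (\<Prod>l=1..n. if l \<in> B then 1 - unreq s l \<omega> else unreq s l \<omega>)"
proof -
  have "{1..n} \<inter> B = B" "{1..n} \<inter> - B = {1..n} - B" using assms by auto
  thus ?thesis unfolding pattern_prob_def by (simp add: prod.If_cases)
qed

lemma pattern_prob_measurable [measurable]:
  assumes "B \<subseteq> {1..n}" shows "pattern_prob s B \<in> borel_measurable N"
  unfolding pattern_prob_def using assms
  by (intro borel_measurable_times borel_measurable_prod borel_measurable_diff borel_measurable_const
      borel_measurable_exp[THEN measurable_compose[rotated]] borel_measurable_uminus p_measurable) auto

lemma pattern_prob_bounds:
  assumes "B \<subseteq> {1..n}" "0 \<le> s" "\<omega> \<in> space N"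
  shows "0 \<le> pattern_prob s B \<omega>" "pattern_prob s B \<omega> \<le> 1"
  unfolding pattern_prob_alt[OF assms(1)] using unreq_bounds[OF assms(2) _ assms(3)]
  by (auto intro!: prod_nonneg prod_le_1)

definition next_pattern :: "real \<Rightarrow> nat \<Rightarrow> nat set \<Rightarrow> 'a set" where
  "next_pattern s i B =
     {\<omega>\<in>space N. next_label n (reqs \<omega>) s = Some i \<and> requested_before n (reqs \<omega>) s = B}"

lemma next_pattern_measurable [measurable]:
  assumes s: "0 \<le> s" and B: "B \<subseteq> {1..n}"
  shows "next_pattern s i B \<in> sets N"
proof -
  have "requested_before n (reqs \<omega>) s = B \<longleftrightarrow> (\<forall>l\<in>{1..n}. l \<in> requested_before n (reqs \<omega>) s \<longleftrightarrow> l \<in> B)" for \<omega>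
    using B by (auto simp: requested_before_def)
  hence eq: "next_pattern s i B = {\<omega>\<in>space N. next_label n (reqs \<omega>) s = Some i \<and>
      (\<forall>l\<in>{1..n}. l \<in> requested_before n (reqs \<omega>) s \<longleftrightarrow> l \<in> B)}"
    unfolding next_pattern_def by blast
  have [measurable]: "Measurable.pred N (\<lambda>\<omega>. next_label n (reqs \<omega>) s = Some i)"
    by (rule measurable_next[OF s])
  show ?thesis unfolding eq by measurable
qed

text \<open>The event that the objects requested before \<open>s\<close> are those in \<open>B\<close> and that the first request after \<open>s\<close> occurs in
the cell of length \<open>h\<close> with index \<open>j\<close> and belongs to \<open>i\<close>, which is requested there exactly
once and alone. As there is no other request in the cell, \<open>i\<close> is then the next label, whatever the order of events inside the cell.\<close>

lemma first_request_cell_prob: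
  assumes s: "0 \<le> s" and i: "i \<in> {1..n}" and B: "B \<subseteq> {1..n}" and h: "0 \<le> h"
  defines "E \<equiv> (\<lambda>j::nat. {\<omega>\<in>space N. \<forall>l\<in>{1..n}.
      cnt l 0 s \<omega> \<in> (if l \<in> B then - {0} else {0}) \<and> cnt l s (s + real j * h) \<omega> \<in> {0} \<and>
      cnt l (s + real j * h) (s + real (Suc j) * h) \<omega> \<in> (if l = i then {1} else {0})})"
  shows "prob (E j) = (LINT \<omega>|N. p i \<omega> * pattern_prob s B \<omega>) * (h * exp (- h) ^ Suc j)"
    and "E j \<in> sets N" and "E j \<subseteq> next_pattern s i B" and "disjoint_family E"
proof -
  have E_eq: "E = (\<lambda>j. {\<omega>\<in>space N. \<forall>l\<in>{1..n}.
      cnt l 0 s \<omega> \<in> (if l \<in> B then - {0} else {0}) \<and> cnt l s (s + real j * h) \<omega> \<in> {0} \<and>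
      cnt l (s + real j * h) (s + real (Suc j) * h) \<omega> \<in> (if l = i then {1} else {0})})"
    unfolding E_def ..
  \<comment> \<open>The three intervals are \<open>[0, s)\<close>, the time from \<open>s\<close> to the cell, and the cell.\<close>
  define r where "r = (\<lambda>k::nat. if k = 0 then 0 else if k = 1 then s else if k = 2 then s + real j * h
    else s + real (Suc j) * h)"
  define K where "K = (\<lambda>l (k::nat). if k = 0 then (if l \<in> B then - {0::nat} else {0})
    else if k = 1 then {0} else (if l = i then {1} else {0}))"
  have r: "r 0 = 0" "r (Suc 0) = s" "r (Suc (Suc 0)) = s + real j * h"
      "r (Suc (Suc (Suc 0))) = s + real (Suc j) * h" by (simp_all add: r_def)
  have K: "K l 0 = (if l \<in> B then - {0::nat} else {0})" "K l (Suc 0) = {0}"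
     "K l (Suc (Suc 0)) = (if l = i then {1} else {0})" for l by (simp_all add: K_def)
  have all3: "(\<forall>k<3. Q k) \<longleftrightarrow> Q 0 \<and> Q (Suc 0) \<and> Q (Suc (Suc 0))" for Q :: "nat \<Rightarrow> bool"
    by (auto simp: numeral_3_eq_3 less_Suc_eq)
  have prod3: "(\<Prod>k<3. f k) = f 0 * (f (Suc 0) * f (Suc (Suc 0)))" for f :: "nat \<Rightarrow> real"
    by (simp add: numeral_3_eq_3 mult.assoc)
  have "prob (E j) = prob {\<omega>\<in>space N. \<forall>l\<in>{1..n}. \<forall>k<3. cnt l (r k) (r (Suc k)) \<omega> \<in> K l k}"
    unfolding E_eq all3 r K ..
  also have "\<dots> = (LINT \<omega>|N. (\<Prod>l=1..n. \<Prod>k<3. poisson_prob (p l \<omega> * (r (Suc k) - r k)) (K l k)))"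
  proof (rule counts_law[of r 3 K])
    show "r k \<le> r (Suc k)" if "k < 3" for k
    proof -
      have "\<forall>k<3. r k \<le> r (Suc k)" unfolding all3 r using s h by (auto intro: mult_right_mono)
      thus ?thesis using that by blast
    qed
  qed (simp add: r)
  also have "\<dots> = (LINT \<omega>|N. (p i \<omega> * pattern_prob s B \<omega>) * (h * exp (- h) ^ Suc j))"
  proof (rule Bochner_Integration.integral_cong[OF refl])
    fix \<omega> assume \<omega>: "\<omega> \<in> space N"
    have pl: "0 \<le> p l \<omega> * s" if "l \<in> {1..n}" for l using p_nonneg[OF that \<omega>] s by simp
    have "(\<Prod>k<3. poisson_prob (p l \<omega> * (r (Suc k) - r k)) (K l k)) =
       (if l \<in> B then 1 - unreq s l \<omega> else unreq s l \<omega>) *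
       (exp (- (p l \<omega> * (real (Suc j) * h))) * (if l = i then p l \<omega> * h else 1))" if l: "l \<in> {1..n}" for l
    proof -
      have "poisson_prob (p l \<omega> * h) (if l = i then {1} else {0}) =
          exp (- (p l \<omega> * h)) * (if l = i then p l \<omega> * h else 1)"
        by (simp only: poisson_prob_1 poisson_prob_0 split: if_split) simp
      moreover have "exp (- (p l \<omega> * (real j * h))) * exp (- (p l \<omega> * h)) = exp (- (p l \<omega> * (real (Suc j) * h)))"
        by (simp add: exp_add[symmetric] algebra_simps)
      moreover have "poisson_prob (p l \<omega> * (s - 0)) (if l \<in> B then - {0} else {0}) =
          (if l \<in> B then 1 - unreq s l \<omega> else unreq s l \<omega>)"
        using poisson_prob_pos[OF pl[OF l]] by (simp add: poisson_prob_0)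
      moreover have "poisson_prob (p l \<omega> * (s + real j * h - s)) {0} = exp (- (p l \<omega> * (real j * h)))"
        by (simp add: poisson_prob_0)
      moreover have "s + real (Suc j) * h - (s + real j * h) = h" by (simp add: algebra_simps)
      ultimately show ?thesis
        unfolding prod3 r K by (simp only: mult.assoc[symmetric])
    qed
    hence "(\<Prod>l=1..n. \<Prod>k<3. poisson_prob (p l \<omega> * (r (Suc k) - r k)) (K l k)) =
      (\<Prod>l=1..n. (if l \<in> B then 1 - unreq s l \<omega> else unreq s l \<omega>) *
       (exp (- (p l \<omega> * (real (Suc j) * h))) * (if l = i then p l \<omega> * h else 1)))"
      by (intro prod.cong) auto
    also have "\<dots> = pattern_prob s B \<omega> * ((\<Prod>l=1..n. exp (- (p l \<omega> * (real (Suc j) * h)))) * (p i \<omega> * h))"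
      unfolding prod.distrib pattern_prob_alt[OF B] using i by simp
    also have "(\<Prod>l=1..n. exp (- (p l \<omega> * (real (Suc j) * h)))) = exp (- ((\<Sum>l=1..n. p l \<omega>) * (real (Suc j) * h)))"
      by (simp add: exp_sum[symmetric] sum_negf sum_distrib_right)
    also have "\<dots> * (p i \<omega> * h) = exp (- h) ^ Suc j * (p i \<omega> * h)"
    proof (cases "(\<Sum>l=1..n. v l \<omega>) = 0")
      case True
      thus ?thesis using popularity_eq_0[OF True] by simp
    next
      case False
      hence "(\<Sum>l=1..n. p l \<omega>) = 1" unfolding sum_popularity by simp
      moreover have "exp (- (real (Suc j) * h)) = exp (- h) ^ Suc j"
        by (simp add: exp_of_nat_mult[symmetric] del: of_nat_Suc power_Suc)
      ultimately show ?thesis by simp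
    qed
    finally show "(\<Prod>l=1..n. \<Prod>k<3. poisson_prob (p l \<omega> * (r (Suc k) - r k)) (K l k)) =
      (p i \<omega> * pattern_prob s B \<omega>) * (h * exp (- h) ^ Suc j)" by (simp add: mult_ac)
  qed
  finally show "prob (E j) = (LINT \<omega>|N. p i \<omega> * pattern_prob s B \<omega>) * (h * exp (- h) ^ Suc j)" by simp
  have cE: "Measurable.pred N (\<lambda>\<omega>. cnt l a b \<omega> \<in> A)" if "l \<in> {1..n}" "0 \<le> a" for l a b A
  proof -
    have [measurable]: "cnt l a b \<in> measurable N (count_space UNIV)" using that by (intro c_measurable)
    show ?thesis by measurable
  qed
  have "Measurable.pred N (\<lambda>\<omega>. \<forall>l\<in>{1..n}.
      cnt l 0 s \<omega> \<in> (if l \<in> B then - {0} else {0}) \<and> cnt l s (s + real j * h) \<omega> \<in> {0} \<and>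
      cnt l (s + real j * h) (s + real (Suc j) * h) \<omega> \<in> (if l = i then {1} else {0}))"
    by (intro pred_intros_finite pred_intros_logic cE) (use s h in auto)
  thus "E j \<in> sets N" unfolding E_eq by measurable
  show "E j \<subseteq> next_pattern s i B"
  proof
    fix \<omega> assume E: "\<omega> \<in> E j"
    hence \<omega>: "\<omega> \<in> space N" by (simp add: E_eq)
    note lf = locally_finite[OF \<omega>]
    let ?a = "s + real j * h" and ?b = "s + real (Suc j) * h"
    have sa: "0 \<le> ?a" "s \<le> ?a" using s h by auto
    have E1: "l \<in> {1..n} \<Longrightarrow> cnt l 0 s \<omega> \<noteq> 0 \<longleftrightarrow> l \<in> B" for l using E by (auto simp: E_eq split: if_splits)
    have E2: "T l \<omega> \<inter> {s..<?a} = {}" if "l \<in> {1..n}" for l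
      using E that count_in_eq_0_iff[OF lf that s, of ?a] by (auto simp: E_eq)
    have E3: "T l \<omega> \<inter> {?a..<?b} = {}" if "l \<in> {1..n}" "l \<noteq> i" for l
    proof -
      have "cnt l ?a ?b \<omega> \<in> {0}" using E that unfolding E_eq by (auto split: if_splits)
      thus ?thesis using count_in_eq_0_iff[OF lf that(1) sa(1), of ?b] by simp
    qed
    have "cnt i ?a ?b \<omega> = 1" using E i unfolding E_eq by (auto split: if_splits)
    then obtain u where u: "T i \<omega> \<inter> {?a..<?b} = {u}"
      unfolding count_in_def by (auto simp: card_1_singleton_iff)
    have "next_label n (reqs \<omega>) s = Some i"
      unfolding next_label_eq_Some_iff[OF lf s]
    proof (intro bexI[of _ u] conjI ballI)
      have "u \<in> T i \<omega> \<inter> {?a..<?b}" using u by blast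
      thus "u \<in> T i \<omega>" "s \<le> u" using sa by auto
      show "T l \<omega> \<inter> {s..<u} = {}" if l: "l \<in> {1..n}" for l
      proof (rule ccontr)
        assume "T l \<omega> \<inter> {s..<u} \<noteq> {}"
        then obtain x where x: "x \<in> T l \<omega>" "s \<le> x" "x < u" by auto
        have "\<not> x < ?a" using E2[OF l] x by (meson disjoint_iff atLeastLessThan_iff)
        moreover have "u < ?b" using u by auto
        ultimately have "x \<in> T l \<omega> \<inter> {?a..<?b}" using x by auto
        thus False using u E3[OF l] x by (cases "l = i") auto
      qed
      show "u \<notin> T l \<omega>" if "l \<in> {1..<i}" for l
        using E3[of l] that i u by (metis (no_types, lifting) Int_iff atLeastAtMost_iff atLeastLessThan_iff empty_iff insertI1 less_le_trans less_imp_le_nat less_not_refl)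
    qed (use i in simp)
    moreover have "requested_before n (reqs \<omega>) s = B"
      unfolding requested_before_eq[OF lf] using E1 B by auto
    ultimately show "\<omega> \<in> next_pattern s i B" using \<omega> by (simp add: next_pattern_def)
  qed
  show "disjoint_family E"
    unfolding disjoint_family_on_def
  proof (intro ballI impI)
    have *: "E a \<inter> E b = {}" if "a < b" for a b
    proof (rule ccontr)
      assume "E a \<inter> E b \<noteq> {}"
      then obtain \<omega> where Ea: "\<omega> \<in> E a" and Eb: "\<omega> \<in> E b" by auto
      hence \<omega>: "\<omega> \<in> space N" by (simp add: E_eq)
      note lf = locally_finite[OF \<omega>]
      have "cnt i (s + real a * h) (s + real (Suc a) * h) \<omega> = 1" using Ea i unfolding E_eq by (auto split: if_splits)
      hence "T i \<omega> \<inter> {s + real a * h..<s + real (Suc a) * h} \<noteq> {}"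
        unfolding count_in_def by (metis One_nat_def card.empty zero_neq_one)
      moreover have "cnt i s (s + real b * h) \<omega> = 0" using Eb i by (simp add: E_eq)
      hence "T i \<omega> \<inter> {s..<s + real b * h} = {}" using count_in_eq_0_iff[OF lf i s] by simp
      moreover have "real (Suc a) * h \<le> real b * h" using that h by (intro mult_right_mono) auto
      moreover have "0 \<le> real a * h" using h by simp
      ultimately show False by (force simp del: of_nat_Suc)
    qed
    fix a b :: nat assume "a \<noteq> b"
    thus "E a \<inter> E b = {}" using *[of a b] *[of b a] by (cases "a < b") auto
  qed
qed

text \<open>Summing over all cells gives \<open>h * exp (- h) / (1 - exp (- h)) \<ge> exp (- h)\<close> times the
expectation; then \<open>h\<close> tends to 0.\<close>

lemma next_pattern_prob_ge:
  assumes s: "0 \<le> s" and i: "i \<in> {1..n}" and B: "B \<subseteq> {1..n}"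
  shows "(LINT \<omega>|N. p i \<omega> * pattern_prob s B \<omega>) \<le> prob (next_pattern s i B)" (is "?x \<le> ?y")
proof -
  have x0: "0 \<le> ?x"
    by (intro integral_nonneg_AE AE_I2 mult_nonneg_nonneg p_nonneg pattern_prob_bounds i B s)
  let ?E = "\<lambda>h j. {\<omega>\<in>space N. \<forall>l\<in>{1..n}.
      cnt l 0 s \<omega> \<in> (if l \<in> B then - {0} else {0}) \<and> cnt l s (s + real j * h) \<omega> \<in> {0} \<and>
      cnt l (s + real j * h) (s + real (Suc j) * h) \<omega> \<in> (if l = i then {1} else {0})}"
  have le: "?x * exp (- h) \<le> ?y" if h: "h > 0" for h
  proof -
    note E = first_request_cell_prob[OF s i B less_imp_le[OF h]]
    have q: "0 < exp (- h)" "exp (- h) < 1" using h by auto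
    have "(\<lambda>j. ?x * (h * exp (- h) ^ Suc j)) sums (?x * (h * (exp (- h) * (1 / (1 - exp (- h))))))"
      unfolding power_Suc by (intro sums_mult geometric_sums) (use q in auto)
    moreover have "(\<Sum>j<J. ?x * (h * exp (- h) ^ Suc j)) \<le> ?y" for J
    proof -
      have "(\<Sum>j<J. ?x * (h * exp (- h) ^ Suc j)) = prob (\<Union>j\<in>{..<J}. ?E h j)"
        unfolding E(1)[symmetric]
      proof (rule finite_measure_finite_Union[symmetric])
        show "?E h ` {..<J} \<subseteq> sets N" by (intro image_subsetI E(2))
        show "disjoint_family_on (?E h) {..<J}" by (rule disjoint_family_on_mono[OF subset_UNIV E(4)])
      qed simp
      also have "\<dots> \<le> ?y"
        by (intro finite_measure_mono UN_least E(3) next_pattern_measurable s B)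
      finally show ?thesis .
    qed
    ultimately have "?x * (h * (exp (- h) * (1 / (1 - exp (- h))))) \<le> ?y"
      unfolding sums_def by (intro LIMSEQ_le_const2) auto
    moreover have "exp (- h) \<le> h * (exp (- h) * (1 / (1 - exp (- h))))"
    proof -
      have "1 \<le> h * (1 / (1 - exp (- h)))"
        using q exp_ge_add_one_self[of "- h"] by (simp add: field_simps)
      hence "exp (- h) * 1 \<le> exp (- h) * (h * (1 / (1 - exp (- h))))"
        by (intro mult_left_mono) auto
      thus ?thesis by (simp add: mult_ac)
    qed
    ultimately show ?thesis using x0 by (meson mult_left_mono order_trans)
  qed
  have "(\<lambda>m. ?x * exp (- inverse (real (Suc m)))) \<longlonglongrightarrow> ?x * exp (- 0)"
    by (intro tendsto_intros LIMSEQ_inverse_real_of_nat)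
  hence "?x * exp (- 0) \<le> ?y"
    by (rule LIMSEQ_le_const2) (use le in auto)
  thus ?thesis by simp
qed

lemma sum_pattern_prob: "(\<Sum>B\<in>Pow {1..n}. pattern_prob s B \<omega>) = 1"
  unfolding pattern_prob_def by (subst prod_add[symmetric]) auto

text \<open>The popularities add up to 0 or to 1, and in the first case there are almost surely no requests.\<close>

lemma next_prob_le:
  assumes s: "0 \<le> s"
  shows "prob {\<omega>\<in>space N. \<exists>i. next_label n (reqs \<omega>) s = Some i} \<le> (LINT \<omega>|N. (\<Sum>i=1..n. p i \<omega>))"
proof -
  define C where "C = (\<lambda>m::nat. {\<omega>\<in>space N. \<exists>i\<in>{1..n}. cnt i 0 (real m) \<omega> \<noteq> 0})"
  have cm [measurable]: "cnt i 0 (real m) \<in> measurable N (count_space UNIV)" if "i \<in> {1..n}" for i m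
    using that by (intro c_measurable) auto
  have Cm: "C m \<in> sets N" for m unfolding C_def by measurable
  have int: "integrable N (\<lambda>\<omega>. \<Sum>i=1..n. p i \<omega>)"
    by (intro Bochner_Integration.integrable_sum integrable_const_bound[where B=1])
       (auto simp: p_nonneg p_le_1)
  have Cp: "prob (C m) \<le> (LINT \<omega>|N. (\<Sum>i=1..n. p i \<omega>))" for m
  proof -
    define r where "r = (\<lambda>k::nat. if k = 0 then 0 else real m)"
    have r: "r 0 = 0" "r (Suc 0) = real m" by (simp_all add: r_def)
    have l1: "{..<1} = {0::nat}" by auto
    have "C m = space N - {\<omega>\<in>space N. \<forall>l\<in>{1..n}. \<forall>k<1. cnt l (r k) (r (Suc k)) \<omega> \<in> {0}}"
      by (auto simp: C_def r)
    moreover have "{\<omega>\<in>space N. \<forall>l\<in>{1..n}. \<forall>k<1. cnt l (r k) (r (Suc k)) \<omega> \<in> {0}} = space N - C m"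
      by (auto simp: C_def r)
    ultimately have 1: "prob (C m) = 1 - prob {\<omega>\<in>space N. \<forall>l\<in>{1..n}. \<forall>k<1. cnt l (r k) (r (Suc k)) \<omega> \<in> {0}}"
      using Cm[of m] by (metis prob_compl sets.compl_sets double_diff prob_space_axioms)
    have 2: "prob {\<omega>\<in>space N. \<forall>l\<in>{1..n}. \<forall>k<1. cnt l (r k) (r (Suc k)) \<omega> \<in> {0}} =
       (LINT \<omega>|N. (\<Prod>l=1..n. \<Prod>k<1. poisson_prob (p l \<omega> * (r (Suc k) - r k)) {0}))"
      by (rule counts_law[of r 1 "\<lambda>_ _. {0}"]) (auto simp: r_def)
    have 3: "(LINT \<omega>|N. 1 - (\<Sum>i=1..n. p i \<omega>)) \<le>
       (LINT \<omega>|N. (\<Prod>l=1..n. \<Prod>k<1. poisson_prob (p l \<omega> * (r (Suc k) - r k)) {0}))"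
    proof (intro integral_mono)
      show "integrable N (\<lambda>\<omega>. 1 - (\<Sum>i=1..n. p i \<omega>))" using int by simp
      have eq: "(\<Prod>l=1..n. \<Prod>k<1. poisson_prob (p l \<omega> * (r (Suc k) - r k)) {0}) =
          exp (- ((\<Sum>l=1..n. p l \<omega>) * real m))" for \<omega>
        unfolding l1 by (simp add: r poisson_prob_0 exp_sum[symmetric] sum_negf sum_distrib_right)
      show "integrable N (\<lambda>\<omega>. \<Prod>l=1..n. \<Prod>k<1. poisson_prob (p l \<omega> * (r (Suc k) - r k)) {0})"
        unfolding eq
        by (intro integrable_const_bound[where B=1])
           (auto intro!: mult_nonneg_nonneg sum_nonneg p_nonneg)
      show "1 - (\<Sum>i=1..n. p i \<omega>) \<le> (\<Prod>l=1..n. \<Prod>k<1. poisson_prob (p l \<omega> * (r (Suc k) - r k)) {0})" for \<omega>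
        unfolding eq unfolding sum_popularity by simp
    qed
    have "(LINT \<omega>|N. 1 - (\<Sum>i=1..n. p i \<omega>)) = 1 - (LINT \<omega>|N. (\<Sum>i=1..n. p i \<omega>))"
      using int by (subst Bochner_Integration.integral_diff) (simp_all add: prob_space)
    thus ?thesis using 1 2 3 by linarith
  qed
  have inc: "incseq C"
  proof (intro incseq_SucI subsetI)
    fix m \<omega> assume "\<omega> \<in> C m"
    then obtain i where \<omega>: "\<omega> \<in> space N" and i: "i \<in> {1..n}" "cnt i 0 (real m) \<omega> \<noteq> 0" by (auto simp: C_def)
    note lf = locally_finite[OF \<omega>]
    have "T i \<omega> \<inter> {0..<real m} \<noteq> {}" using i(2) count_in_eq_0_iff[OF lf i(1), of 0 "real m"] by simp
    hence "T i \<omega> \<inter> {0..<real (Suc m)} \<noteq> {}" by auto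
    hence "cnt i 0 (real (Suc m)) \<omega> \<noteq> 0" using count_in_eq_0_iff[OF lf i(1), of 0 "real (Suc m)"] by auto
    thus "\<omega> \<in> C (Suc m)" using \<omega> i unfolding C_def by blast
  qed
  have "{\<omega>\<in>space N. \<exists>i. next_label n (reqs \<omega>) s = Some i} \<subseteq> (\<Union>m. C m)"
  proof
    fix \<omega> assume "\<omega> \<in> {\<omega>\<in>space N. \<exists>i. next_label n (reqs \<omega>) s = Some i}"
    then obtain i where \<omega>: "\<omega> \<in> space N" and i: "next_label n (reqs \<omega>) s = Some i" by auto
    note lf = locally_finite[OF \<omega>]
    obtain u where u: "u \<in> T i \<omega>" "s \<le> u" "i \<in> {1..n}" using i next_label_eq_Some_iff[OF lf s] by auto
    obtain m :: nat where "u < real m" using reals_Archimedean2 by blast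
    hence "T i \<omega> \<inter> {0..<real m} \<noteq> {}" using u s by auto
    hence "cnt i 0 (real m) \<omega> \<noteq> 0" using count_in_eq_0_iff[OF lf u(3), of 0 "real m"] by auto
    thus "\<omega> \<in> (\<Union>m. C m)" using \<omega> u unfolding C_def by blast
  qed
  hence "prob {\<omega>\<in>space N. \<exists>i. next_label n (reqs \<omega>) s = Some i} \<le> prob (\<Union>m. C m)"
    using Cm by (intro finite_measure_mono) auto
  also have "\<dots> \<le> (LINT \<omega>|N. (\<Sum>i=1..n. p i \<omega>))"
    by (rule LIMSEQ_le_const2[OF finite_Lim_measure_incseq]) (use Cm Cp inc in auto)
  finally show ?thesis .
qed

lemma pattern_integrable:
  assumes s: "0 \<le> s" and x: "x \<in> {1..n} \<times> Pow {1..n}"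
  shows "integrable N (\<lambda>\<omega>. p (fst x) \<omega> * pattern_prob s (snd x) \<omega>)"
  proof (rule integrable_const_bound[where B=1])
    show "AE \<omega> in N. norm (p (fst x) \<omega> * pattern_prob s (snd x) \<omega>) \<le> 1"
    proof (rule AE_I2)
      fix \<omega> assume \<omega>: "\<omega> \<in> space N"
      have "fst x \<in> {1..n}" "snd x \<subseteq> {1..n}" using x by auto
      thus "norm (p (fst x) \<omega> * pattern_prob s (snd x) \<omega>) \<le> 1"
        using p_nonneg[OF _ \<omega>] p_le_1[OF _ \<omega>] pattern_prob_bounds[OF _ s \<omega>]
        by (auto simp: abs_mult intro!: mult_le_one)
    qed
  qed (use x in \<open>auto intro!: borel_measurable_times p_measurable pattern_prob_measurable\<close>)

text \<open>The lower bounds of \<open>next_pattern_prob_ge\<close> have the same total mass as the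
probabilities that they bound, hence all of them are equalities.\<close>

lemma next_pattern_prob:
  assumes s: "0 \<le> s" and i: "i \<in> {1..n}" and B: "B \<subseteq> {1..n}"
  shows "prob (next_pattern s i B) = (LINT \<omega>|N. p i \<omega> * pattern_prob s B \<omega>)"
proof -
  let ?X = "{1..n} \<times> Pow {1..n}"
  let ?f = "\<lambda>x. LINT \<omega>|N. p (fst x) \<omega> * pattern_prob s (snd x) \<omega>"
  let ?g = "\<lambda>x. prob (next_pattern s (fst x) (snd x))"
  have le: "?f x \<le> ?g x" if "x \<in> ?X" for x
    using that by (intro next_pattern_prob_ge s) auto
  have "(\<Sum>x\<in>?X. ?g x) = prob (\<Union>x\<in>?X. next_pattern s (fst x) (snd x))"
    by (subst finite_measure_finite_Union)
       (auto simp: disjoint_family_on_def next_pattern_def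
         intro!: next_pattern_measurable[OF s, unfolded next_pattern_def])
  also have "\<dots> \<le> prob {\<omega>\<in>space N. \<exists>i. next_label n (reqs \<omega>) s = Some i}"
  proof (intro finite_measure_mono)
    have "{\<omega>\<in>space N. \<exists>i. next_label n (reqs \<omega>) s = Some i} =
       {\<omega>\<in>space N. \<exists>i\<in>{1..n}. next_label n (reqs \<omega>) s = Some i}"
      using next_label_range[OF locally_finite s] by blast
    moreover have "Measurable.pred N (\<lambda>\<omega>. \<exists>i\<in>{1..n}. next_label n (reqs \<omega>) s = Some i)"
      by (intro pred_intros_finite measurable_next s) auto
    ultimately show "{\<omega>\<in>space N. \<exists>i. next_label n (reqs \<omega>) s = Some i} \<in> sets N" by simp
  qed (auto simp: next_pattern_def)
  also have "\<dots> \<le> (LINT \<omega>|N. (\<Sum>i=1..n. p i \<omega>))" by (rule next_prob_le[OF s])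
  also have "\<dots> = (LINT \<omega>|N. (\<Sum>x\<in>?X. p (fst x) \<omega> * pattern_prob s (snd x) \<omega>))"
  proof (intro Bochner_Integration.integral_cong refl)
    fix \<omega>
    have "(\<Sum>x\<in>?X. p (fst x) \<omega> * pattern_prob s (snd x) \<omega>) = (\<Sum>i=1..n. \<Sum>B\<in>Pow {1..n}. p i \<omega> * pattern_prob s B \<omega>)"
      by (subst sum.cartesian_product) (simp add: case_prod_beta)
    also have "\<dots> = (\<Sum>i=1..n. p i \<omega>)"
      unfolding sum_distrib_left[symmetric] sum_pattern_prob by simp
    finally show "(\<Sum>i=1..n. p i \<omega>) = (\<Sum>x\<in>?X. p (fst x) \<omega> * pattern_prob s (snd x) \<omega>)" by simp
  qed
  also have "\<dots> = (\<Sum>x\<in>?X. ?f x)" by (intro Bochner_Integration.integral_sum pattern_integrable s)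
  finally have "(\<Sum>x\<in>?X. ?g x) \<le> (\<Sum>x\<in>?X. ?f x)" .
  moreover have "(\<Sum>x\<in>?X. ?f x) \<le> (\<Sum>x\<in>?X. ?g x)" by (intro sum_mono le)
  ultimately have "(\<Sum>x\<in>?X. ?f x) = (\<Sum>x\<in>?X. ?g x)" by simp
  from sum_mono_inv[OF this le, of "(i, B)"] show ?thesis using i B by auto
qed

section \<open>The transform for finitely many objects\<close>

text \<open>Each object behind \<open>i\<close> contributes to the cost independently of the others; those
in front of \<open>i\<close> are counted whether or not they were requested.\<close>

lemma sum_pattern_transform:
  assumes i: "i \<in> {1..n}"
  shows "(\<Sum>B\<in>Pow {1..n}. if i \<in> B then 0 else pattern_prob s B \<omega> * exp (- a * real (card (B \<union> {1..i})))) =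
    unreq s i \<omega> * exp (- a * real i) * (\<Prod>j\<in>{i<..n}. 1 - (1 - unreq s j \<omega>) * (1 - exp (- a)))"
proof -
  let ?h = "\<lambda>l. unreq s l \<omega>"
  \<comment> \<open>The factor that a requested object contributes; the value 0 at \<open>i\<close> removes the sets \<open>B\<close> that contain \<open>i\<close>.\<close>
  define g where "g = (\<lambda>l. if l = i then 0 else if l < i then 1 else exp (- a))"
  have split: "{1..n} = {1..<i} \<union> ({i} \<union> {i<..n})" using i by auto
  have summand: "(if i \<in> B then 0 else pattern_prob s B \<omega> * exp (- a * real (card (B \<union> {1..i})))) =
     exp (- a * real i) * ((\<Prod>l\<in>B. (1 - ?h l) * g l) * (\<Prod>l\<in>{1..n} - B. ?h l))" if B: "B \<in> Pow {1..n}" for B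
  proof (cases "i \<in> B")
    case True
    have "finite B" using B by (auto intro: finite_subset)
    hence "(\<Prod>l\<in>B. (1 - ?h l) * g l) = 0" using True by (intro prod_zero) (auto simp: g_def)
    thus ?thesis using True by simp
  next
    case False
    have fB: "finite B" using B by (auto intro: finite_subset)
    have "(\<Prod>l\<in>B. g l) = (\<Prod>l\<in>B. if l \<in> {i<..n} then exp (- a) else 1)"
      using B False by (intro prod.cong) (auto simp: g_def)
    also have "\<dots> = exp (- a) ^ card (B \<inter> {i<..n})"
      using fB by (simp add: prod.If_cases Int_def)
    also have "\<dots> = exp (- a * real (card (B \<inter> {i<..n})))"
      by (simp add: exp_of_nat_mult[symmetric] mult.commute)
    finally have G: "(\<Prod>l\<in>B. g l) = exp (- a * real (card (B \<inter> {i<..n})))" .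
    have "B \<union> {1..i} = {1..i} \<union> (B \<inter> {i<..n})" using B by auto
    hence "card (B \<union> {1..i}) = i + card (B \<inter> {i<..n})"
      using fB by (simp add: card_Un_disjoint disjoint_iff)
    hence "exp (- a * real (card (B \<union> {1..i}))) = exp (- a * real i) * (\<Prod>l\<in>B. g l)"
      unfolding G by (simp add: exp_add[symmetric] algebra_simps)
    thus ?thesis using False by (simp add: pattern_prob_def prod.distrib)
  qed
  have "(\<Sum>B\<in>Pow {1..n}. if i \<in> B then 0 else pattern_prob s B \<omega> * exp (- a * real (card (B \<union> {1..i})))) =
    exp (- a * real i) * (\<Sum>B\<in>Pow {1..n}. (\<Prod>l\<in>B. (1 - ?h l) * g l) * (\<Prod>l\<in>{1..n} - B. ?h l))"
    unfolding sum_distrib_left by (intro sum.cong refl summand)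
  also have "\<dots> = exp (- a * real i) * (\<Prod>l=1..n. (1 - ?h l) * g l + ?h l)"
    by (subst prod_add) auto
  also have "(\<Prod>l=1..n. (1 - ?h l) * g l + ?h l) =
    (\<Prod>l\<in>{1..<i}. (1 - ?h l) * g l + ?h l) * (((1 - ?h i) * g i + ?h i) * (\<Prod>l\<in>{i<..n}. (1 - ?h l) * g l + ?h l))"
    unfolding split by (subst prod.union_disjoint; force)+
  also have "(\<Prod>l\<in>{1..<i}. (1 - ?h l) * g l + ?h l) = 1"
    by (intro prod.neutral) (auto simp: g_def)
  also have "(1 - ?h i) * g i + ?h i = ?h i" by (simp add: g_def)
  also have "(\<Prod>l\<in>{i<..n}. (1 - ?h l) * g l + ?h l) = (\<Prod>j\<in>{i<..n}. 1 - (1 - ?h j) * (1 - exp (- a)))"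
    by (intro prod.cong) (auto simp: g_def algebra_simps)
  finally show ?thesis by (simp add: mult_ac)
qed

lemma out_transform_eq:
  assumes s: "0 \<le> s"
  shows "out_transform N n id T s a = (LINT \<omega>|N. (\<Sum>i=1..n. p i \<omega> *
    (unreq s i \<omega> * exp (- a * real i) * (\<Prod>j\<in>{i<..n}. 1 - (1 - unreq s j \<omega>) * (1 - exp (- a))))))"
proof -
  let ?out = "\<lambda>\<omega>. out_search_cost n id (reqs \<omega>) s"
  let ?F = "\<lambda>\<omega>. exp (- a * real (?out \<omega>)) * of_bool (?out \<omega> > 0)"
  let ?next = "\<lambda>\<omega> i. next_label n (reqs \<omega>) s = Some i \<and> i \<notin> requested_before n (reqs \<omega>) s"
  let ?X = "{1..n} \<times> Pow {1..n}"
  define w :: "nat \<times> nat set \<Rightarrow> real"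
    where "w = (\<lambda>x. if fst x \<in> snd x then 0 else exp (- a * real (card (snd x \<union> {1..fst x}))))"
  have out: "?F \<omega> = (\<Sum>i=1..n. of_bool (?next \<omega> i) *
      exp (- a * (1 + (\<Sum>l=1..n. of_bool (l \<in> moved_before n (reqs \<omega>) s \<or> l < i)))))"
    if \<omega>: "\<omega> \<in> space N" for \<omega>
  proof (cases "\<exists>i. ?next \<omega> i")
    case False
    hence iff: "?next \<omega> i \<longleftrightarrow> False" for i by blast
    show ?thesis unfolding out_search_cost_eq[OF locally_finite[OF \<omega>] s] iff by simp
  next
    case True
    then obtain i where i: "?next \<omega> i" by blast
    have iff: "?next \<omega> j \<longleftrightarrow> j = i" for j using i by auto
    have i1: "i \<in> {1..n}" using next_label_range[OF locally_finite[OF \<omega>] s] i by blast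
    have sub: "moved_before n (reqs \<omega>) s \<union> {1..<i} = {l\<in>{1..n}. l \<in> moved_before n (reqs \<omega>) s \<or> l < i}"
      using moved_before_subset[of n "reqs \<omega>" s] i1 by (auto simp: requested_before_def)
    have "real (card (moved_before n (reqs \<omega>) s \<union> {1..<i})) = (\<Sum>l=1..n. of_bool (l \<in> moved_before n (reqs \<omega>) s \<or> l < i))"
      unfolding sub by (subst sum_of_bool_eq) (auto simp: Int_def)
    moreover have "?out \<omega> = Suc (card (moved_before n (reqs \<omega>) s \<union> {1..<i}))"
      unfolding out_search_cost_eq[OF locally_finite[OF \<omega>] s] iff using i1 by (subst sum_of_bool_delta) auto
    ultimately show ?thesis unfolding iff using i1 by (subst sum_of_bool_delta) auto
  qed
  \<comment> \<open>Measurability is checked for the cost itself, with the moved objects; only the almost sure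
identity below passes to the requested ones.\<close>
  have Fm: "?F \<in> borel_measurable N"
  proof (subst measurable_cong[OF out], assumption)
    have [measurable]: "Measurable.pred N (\<lambda>\<omega>. next_label n (reqs \<omega>) s = Some i)"
       "Measurable.pred N (\<lambda>\<omega>. i \<in> moved_before n (reqs \<omega>) s)" for i
      by (rule measurable_next[OF s], rule measurable_moved[OF s])
    show "(\<lambda>\<omega>. \<Sum>i=1..n. of_bool (?next \<omega> i) *
      exp (- a * (1 + (\<Sum>l=1..n. of_bool (l \<in> moved_before n (reqs \<omega>) s \<or> l < i))))) \<in> borel_measurable N"
      by measurable
  qed
  have npm: "next_pattern s (fst x) (snd x) \<in> sets N" if "x \<in> ?X" for x
    using that by (intro next_pattern_measurable s) auto
  have AE: "AE \<omega> in N. ?F \<omega> = (\<Sum>x\<in>?X. w x * indicator (next_pattern s (fst x) (snd x)) \<omega>)"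
    using AE_moved_eq_requested[OF s] AE_space
  proof eventually_elim
    case (elim \<omega>)
    note \<omega> = elim(2) and A = elim(1)
    let ?R = "requested_before n (reqs \<omega>) s"
    have R: "?R \<subseteq> {1..n}" by (auto simp: requested_before_def)
    have S: "(\<Sum>x\<in>?X. w x * indicator (next_pattern s (fst x) (snd x)) \<omega>) =
      (\<Sum>x\<in>?X. if next_label n (reqs \<omega>) s = Some (fst x) \<and> snd x = ?R then w x else 0)"
      using \<omega> by (intro sum.cong) (auto simp: next_pattern_def indicator_def)
    show ?case
    proof (cases "next_label n (reqs \<omega>) s")
      case None
      thus ?thesis unfolding S by (simp add: out_search_cost_eq[OF locally_finite[OF \<omega>] s])
    next
      case (Some i)
      have i: "i \<in> {1..n}" by (rule next_label_range[OF locally_finite[OF \<omega>] s Some])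
      have "(\<Sum>x\<in>?X. if next_label n (reqs \<omega>) s = Some (fst x) \<and> snd x = ?R then w x else 0) =
         (\<Sum>x\<in>?X. if x = (i, ?R) then w x else 0)"
        using Some by (intro sum.cong) auto
      also have "\<dots> = w (i, ?R)" using i R by (subst sum.delta) auto
      finally have W: "(\<Sum>x\<in>?X. w x * indicator (next_pattern s (fst x) (snd x)) \<omega>) = w (i, ?R)" using S by simp
      show ?thesis
      proof (cases "i \<in> ?R")
        case True
        thus ?thesis unfolding W by (simp add: w_def Some out_search_cost_eq[OF locally_finite[OF \<omega>] s] of_bool_def)
      next
        case False
        have iff: "?next \<omega> j \<longleftrightarrow> j = i" for j using Some False by auto
        have fR: "finite ?R" using R by (auto intro: finite_subset)
        have "{1..i} = insert i {1..<i}" using i by auto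
        hence "card (?R \<union> {1..i}) = Suc (card (?R \<union> {1..<i}))" using False fR by simp
        moreover have "?out \<omega> = Suc (card (?R \<union> {1..<i}))"
          unfolding out_search_cost_eq[OF locally_finite[OF \<omega>] s] iff using i A by (subst sum_of_bool_delta) auto
        ultimately show ?thesis unfolding W using False by (simp add: w_def)
      qed
    qed
  qed
  have "out_transform N n id T s a = (LINT \<omega>|N. ?F \<omega>)" unfolding out_transform_def ..
  also have "\<dots> = (LINT \<omega>|N. (\<Sum>x\<in>?X. w x * indicator (next_pattern s (fst x) (snd x)) \<omega>))"
    by (rule integral_cong_AE[OF Fm _ AE]) (use npm in measurable)
  also have "\<dots> = (\<Sum>x\<in>?X. w x * prob (next_pattern s (fst x) (snd x)))"
    by (subst Bochner_Integration.integral_sum)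
       (use npm in \<open>auto intro!: integrable_mult_right integrable_real_indicator simp: less_top[symmetric]\<close>)
  also have "\<dots> = (\<Sum>x\<in>?X. LINT \<omega>|N. w x * (p (fst x) \<omega> * pattern_prob s (snd x) \<omega>))"
    by (intro sum.cong refl, subst next_pattern_prob) (use s in auto)
  also have "\<dots> = (LINT \<omega>|N. (\<Sum>x\<in>?X. w x * (p (fst x) \<omega> * pattern_prob s (snd x) \<omega>)))"
    by (intro Bochner_Integration.integral_sum[symmetric] integrable_mult_right pattern_integrable s)
  also have "\<dots> = (LINT \<omega>|N. (\<Sum>i=1..n. p i \<omega> *
    (unreq s i \<omega> * exp (- a * real i) * (\<Prod>j\<in>{i<..n}. 1 - (1 - unreq s j \<omega>) * (1 - exp (- a))))))"
  proof (intro Bochner_Integration.integral_cong refl)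
    fix \<omega>
    have "(\<Sum>x\<in>?X. w x * (p (fst x) \<omega> * pattern_prob s (snd x) \<omega>)) =
      (\<Sum>i=1..n. \<Sum>B\<in>Pow {1..n}. w (i, B) * (p i \<omega> * pattern_prob s B \<omega>))"
      by (subst sum.cartesian_product) (simp add: case_prod_beta)
    also have "\<dots> = (\<Sum>i=1..n. p i \<omega> * (\<Sum>B\<in>Pow {1..n}. if i \<in> B then 0
        else pattern_prob s B \<omega> * exp (- a * real (card (B \<union> {1..i})))))"
      unfolding sum_distrib_left by (intro sum.cong refl) (auto simp: w_def)
    also have "\<dots> = (\<Sum>i=1..n. p i \<omega> * (unreq s i \<omega> * exp (- a * real i) *
        (\<Prod>j\<in>{i<..n}. 1 - (1 - unreq s j \<omega>) * (1 - exp (- a)))))"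
      by (intro sum.cong refl arg_cong2[where f="(*)"] sum_pattern_transform)
    finally show "(\<Sum>x\<in>?X. w x * (p (fst x) \<omega> * pattern_prob s (snd x) \<omega>)) = \<dots>" .
  qed
  finally show ?thesis .
qed

end

section \<open>Transfer of limits from deterministic to random weights\<close>

definition emp_mean :: "nat \<Rightarrow> (real \<Rightarrow> real) \<Rightarrow> (nat \<Rightarrow> real) \<Rightarrow> real" where
  "emp_mean n f x = (\<Sum>i=1..n. f (x i)) / real n"

definition emp_law :: "nat \<Rightarrow> (nat \<Rightarrow> real) \<Rightarrow> real measure" where
  "emp_law n x = distr (uniform_count_measure {1..n}) borel x"

text \<open>The theorems on weak convergence concern measures on the whole line.\<close>

definition law_on_line :: "real measure \<Rightarrow> real measure" where
  "law_on_line P = distr P borel (\<lambda>x. x)"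

lemma integral_emp_law:
  assumes "f \<in> borel_measurable borel"
  shows "(LINT y|emp_law n x. f y) = emp_mean n f x"
proof -
  have "x \<in> measurable (uniform_count_measure {1..n}) borel"
    by (simp add: uniform_count_measure_def point_measure_def)
  thus ?thesis unfolding emp_law_def emp_mean_def
    by (subst integral_distr[OF _ assms]) (simp_all add: integral_uniform_count_measure)
qed

lemma real_distribution_emp_law:
  assumes "n \<ge> 1" shows "real_distribution (emp_law n x)"
proof -
  interpret prob_space "uniform_count_measure {1..n}"
    using assms by (intro prob_space_uniform_count_measure) auto
  show ?thesis unfolding emp_law_def
    by (intro real_distribution_distr) (simp add: uniform_count_measure_def point_measure_def)
qed

context
  fixes P :: "real measure"
  assumes P: "P \<in> space (prob_algebra Rplus)"
begin

lemma Rplus_prob_facts: "prob_space P" "sets P = sets Rplus" "space P = {0..}"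
  using P sets_eq_imp_space_eq[of P Rplus] by (auto simp: space_prob_algebra Rplus_def space_restrict_space)

lemma measurable_id_P [measurable]: "(\<lambda>x. x) \<in> measurable P borel"
  using Rplus_prob_facts(2) by (simp add: Rplus_def measurable_cong_sets[OF Rplus_prob_facts(2) refl] measurable_restrict_space1)

lemma measurable_P: "f \<in> borel_measurable borel \<Longrightarrow> f \<in> borel_measurable P"
  using measurable_compose[OF measurable_id_P] by simp

lemma real_distribution_P: "real_distribution (law_on_line P)"
  unfolding law_on_line_def by (intro prob_space.real_distribution_distr Rplus_prob_facts) measurable

lemma integral_law_on_line:
  fixes f :: "real \<Rightarrow> real"
  assumes "f \<in> borel_measurable borel"
  shows "(LINT x|law_on_line P. f x) = (LINT x|P. f x)"
  unfolding law_on_line_def by (subst integral_distr[OF measurable_id_P assms]) simp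

lemma integrable_law_on_line:
  fixes f :: "real \<Rightarrow> real"
  assumes "f \<in> borel_measurable borel"
  shows "integrable (law_on_line P) f \<longleftrightarrow> integrable P f"
  unfolding law_on_line_def by (subst integrable_distr_eq[OF measurable_id_P assms]) simp

lemma AE_law_on_line_nonneg: "AE x in law_on_line P. 0 \<le> x"
  unfolding law_on_line_def
  by (subst AE_distr_iff[OF measurable_id_P]) (use Rplus_prob_facts(3) in auto)

end

text \<open>A distribution function at a continuity point is squeezed between integrals of continuous
approximations of step functions with rational corners. Hence countably many test functions decide weak convergence.\<close>

lemma weak_conv_m_rational_steps:
  assumes \<mu>: "\<And>n. real_distribution (\<mu> n)" and M: "real_distribution M"
    and conv: "\<And>a b. a \<in> \<rat> \<Longrightarrow> b \<in> \<rat> \<Longrightarrow> a < b \<Longrightarrow>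
      (\<lambda>n. LINT x|\<mu> n. cts_step a b x) \<longlonglongrightarrow> (LINT x|M. cts_step a b x)"
  shows "weak_conv_m \<mu> M"
  unfolding weak_conv_m_def weak_conv_def
proof (intro allI impI)
  interpret M: real_distribution M by fact
  interpret \<mu>: real_distribution "\<mu> n" for n by fact
  fix x assume cont: "isCont (cdf M) x"
  have shrink: "\<exists>d>0. \<forall>y. \<bar>y - x\<bar> < d \<longrightarrow> \<bar>cdf M y - cdf M x\<bar> < e" if "e > 0" for e
    using cont that unfolding isCont_def LIM_eq by (metis abs_zero diff_self real_norm_def)
  show "(\<lambda>n. cdf (\<mu> n) x) \<longlonglongrightarrow> cdf M x"
  proof (rule order_tendstoI)
    fix u assume "u < cdf M x"
    then obtain d where d: "d > 0" "\<And>y. \<bar>y - x\<bar> < d \<Longrightarrow> \<bar>cdf M y - cdf M x\<bar> < cdf M x - u"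
      using shrink[of "cdf M x - u"] by auto
    obtain a where a: "a \<in> \<rat>" "x - d < a" "a < x" using Rats_dense_in_real[of "x - d" x] d by auto
    obtain b where b: "b \<in> \<rat>" "a < b" "b < x" using Rats_dense_in_real[of a x] a by auto
    have "u < cdf M a" using d(2)[of a] a by auto
    also have "\<dots> \<le> (LINT y|M. cts_step a b y)" by (rule M.cdf_cts_step(1)[OF b(2)])
    finally have "eventually (\<lambda>n. u < (LINT y|\<mu> n. cts_step a b y)) sequentially"
      by (intro order_tendstoD(1)[OF conv[OF a(1) b(1,2)]])
    thus "eventually (\<lambda>n. u < cdf (\<mu> n) x) sequentially"
    proof eventually_elim
      case (elim n)
      also note \<mu>.cdf_cts_step(2)[OF b(2)]
      also have "cdf (\<mu> n) b \<le> cdf (\<mu> n) x" using b by (intro \<mu>.cdf_nondecreasing) auto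
      finally show ?case .
    qed
  next
    fix u assume "cdf M x < u"
    then obtain d where d: "d > 0" "\<And>y. \<bar>y - x\<bar> < d \<Longrightarrow> \<bar>cdf M y - cdf M x\<bar> < u - cdf M x"
      using shrink[of "u - cdf M x"] by auto
    obtain b where b: "b \<in> \<rat>" "x < b" "b < x + d" using Rats_dense_in_real[of x "x + d"] d by auto
    obtain a where a: "a \<in> \<rat>" "x < a" "a < b" using Rats_dense_in_real[of x b] b by auto
    have "(LINT y|M. cts_step a b y) \<le> cdf M b" by (rule M.cdf_cts_step(2)[OF a(3)])
    also have "cdf M b < u" using d(2)[of b] b by auto
    finally have "eventually (\<lambda>n. (LINT y|\<mu> n. cts_step a b y) < u) sequentially"
      by (intro order_tendstoD(2)[OF conv[OF a(1) b(1) a(3)]])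
    thus "eventually (\<lambda>n. cdf (\<mu> n) x < u) sequentially"
    proof eventually_elim
      case (elim n)
      have "cdf (\<mu> n) x \<le> cdf (\<mu> n) a" using a by (intro \<mu>.cdf_nondecreasing) auto
      also note \<mu>.cdf_cts_step(1)[OF a(3)]
      also note elim
      finally show ?case .
    qed
  qed
qed

lemma integral_bounded_by:
  fixes f :: "'a \<Rightarrow> real"
  assumes "prob_space M" "\<And>x. x \<in> space M \<Longrightarrow> \<bar>f x\<bar> \<le> B" "0 \<le> B"
  shows "\<bar>LINT x|M. f x\<bar> \<le> B"
proof (cases "integrable M f")
  case True
  interpret prob_space M by fact
  have "\<bar>LINT x|M. f x\<bar> \<le> (LINT x|M. \<bar>f x\<bar>)" by (rule integral_abs_bound)
  also have "\<dots> \<le> (LINT x|M. B)" by (intro integral_mono) (use True assms in auto)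
  finally show ?thesis by (simp add: prob_space)
qed (use assms in \<open>simp add: not_integrable_integral_eq\<close>)

text \<open>The absolute deviation of the integral of \<open>f\<close> is a bounded continuous function of the
measure that vanishes at the limit.\<close>

lemma converges_in_law_integral:
  fixes f :: "real \<Rightarrow> real"
  assumes P: "P \<in> space (prob_algebra Rplus)"
    and f: "continuous_on {0..} f" "\<And>x. 0 \<le> x \<Longrightarrow> \<bar>f x\<bar> \<le> B"
    and law: "converges_in_law_to_const weak_topology_Rplus M X P"
  shows "(\<lambda>n. LINT \<omega>|M n. \<bar>(LINT x|X n \<omega>. f x) - (LINT x|P. f x)\<bar>) \<longlonglongrightarrow> 0"
proof -
  have "0 \<le> \<bar>f 0\<bar>" by (rule abs_ge_zero)
  also have "\<dots> \<le> B" by (rule f(2)) simp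
  finally have B: "0 \<le> B" .
  have fb: "f \<in> bounded_continuous_Rplus"
    using f by (auto simp: bounded_continuous_Rplus_def bounded_iff)
  let ?F = "\<lambda>Q. \<bar>(LINT x|Q. f x) - (LINT x|P. f x)\<bar>"
  let ?r = "\<lambda>Q. \<lambda>g\<in>bounded_continuous_Rplus. LINT x|Q. g x"
  let ?T = "product_topology (\<lambda>_. euclideanreal) bounded_continuous_Rplus"
  have "continuous_map ?T euclideanreal (\<lambda>h. h f)"
    using fb by (rule continuous_map_product_projection)
  hence "continuous_map weak_topology_Rplus euclideanreal ((\<lambda>h. h f) \<circ> ?r)"
    unfolding weak_topology_Rplus_def by (rule continuous_map_pullback)
  hence "continuous_map weak_topology_Rplus euclideanreal (\<lambda>Q. LINT x|Q. f x)"
    using fb by (simp add: o_def)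
  hence 1: "continuous_map weak_topology_Rplus euclideanreal ?F"
    by (intro continuous_intros)
  have int: "\<bar>LINT x|Q. f x\<bar> \<le> B" if Q: "Q \<in> space (prob_algebra Rplus)" for Q
    by (intro integral_bounded_by) (use Rplus_prob_facts[OF Q] f B in auto)
  have "topspace weak_topology_Rplus \<subseteq> space (prob_algebra Rplus)"
    unfolding weak_topology_Rplus_def topspace_pullback_topology by auto
  hence "\<bar>?F Q\<bar> \<le> B + B" if "Q \<in> topspace weak_topology_Rplus" for Q
    using int[of Q] int[OF P] that by auto
  hence "bounded (?F ` topspace weak_topology_Rplus)"
    by (auto simp: bounded_iff)
  with 1 law have "(\<lambda>n. LINT \<omega>|M n. ?F (X n \<omega>)) \<longlonglongrightarrow> ?F P"
    unfolding converges_in_law_to_const_def by blast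
  thus ?thesis by simp
qed

lemma integral_empirical_measure:
  assumes "continuous_on {0..} f" "\<And>i. i \<in> {1..n} \<Longrightarrow> 0 \<le> x i"
  shows "(LINT y|empirical_measure n x. f y) = emp_mean n f x"
proof -
  have m: "x \<in> measurable (uniform_count_measure {1..n}) Rplus"
    using assms(2) unfolding uniform_count_measure_def point_measure_def Rplus_def
    by (auto simp: measurable_restrict_space2_iff)
  have "f \<in> borel_measurable Rplus"
    unfolding Rplus_def by (rule borel_measurable_continuous_on_restrict[OF assms(1)])
  thus ?thesis unfolding empirical_measure_def emp_mean_def
    by (subst integral_distr[OF m]) (simp_all add: integral_uniform_count_measure)
qed

lemma weak_conv_to_return:
  assumes M: "\<And>n. n \<ge> 1 \<Longrightarrow> prob_space (M n)"
    and X: "\<And>n. n \<ge> 1 \<Longrightarrow> X n \<in> borel_measurable (M n)"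
    and conv: "weak_conv_m (\<lambda>n. distr (M n) borel (X n)) (return borel (c::real))"
  shows "(\<lambda>n. LINT \<omega>|M n. min 1 \<bar>X n \<omega> - c\<bar>) \<longlonglongrightarrow> 0"
proof (rule LIMSEQ_imp_Suc)
  let ?g = "\<lambda>x. min 1 \<bar>x - c\<bar>"
  have gm: "?g \<in> borel_measurable borel" by measurable
  have "real_distribution (return borel c)"
    by (simp add: real_distribution_def real_distribution_axioms_def prob_space_return)
  moreover have "real_distribution (distr (M (Suc n)) borel (X (Suc n)))" for n
    by (intro prob_space.real_distribution_distr M X) auto
  moreover have "weak_conv_m (\<lambda>n. distr (M (Suc n)) borel (X (Suc n))) (return borel c)"
    using conv unfolding weak_conv_m_def weak_conv_def by (auto intro: LIMSEQ_Suc)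
  ultimately have "(\<lambda>n. LINT x|distr (M (Suc n)) borel (X (Suc n)). ?g x) \<longlonglongrightarrow> (LINT x|return borel c. ?g x)"
    by (intro weak_conv_imp_integral_bdd_continuous_conv[where B=1]) (auto intro!: continuous_intros)
  also have "(LINT x|return borel c. ?g x) = 0"
    by (subst integral_return[OF _ gm]) auto
  also have "(\<lambda>n. LINT x|distr (M (Suc n)) borel (X (Suc n)). ?g x) = (\<lambda>n. LINT \<omega>|M (Suc n). ?g (X (Suc n) \<omega>))"
    by (intro ext integral_distr X gm) auto
  finally show "(\<lambda>n. LINT \<omega>|M (Suc n). ?g (X (Suc n) \<omega>)) \<longlonglongrightarrow> 0" .
qed

definition rat_step :: "nat \<Rightarrow> real \<Rightarrow> real" where
  "rat_step a = (let (q, r) = from_nat a :: rat \<times> rat in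
     if q < r then cts_step (of_rat q) (of_rat r) else (\<lambda>_. 0))"

lemma rat_step_surj:
  assumes "a \<in> \<rat>" "b \<in> \<rat>" "a < b"
  shows "\<exists>k. rat_step k = cts_step a b"
proof -
  obtain q r where "a = of_rat q" "b = of_rat r" using assms by (auto elim!: Rats_cases)
  thus ?thesis using assms(3)
    by (intro exI[of _ "to_nat (q, r)"]) (auto simp: rat_step_def of_rat_less)
qed

lemma rat_step_bound: "\<bar>rat_step a x\<bar> \<le> 1"
  by (auto simp: rat_step_def cts_step_def Let_def split: prod.split)

lemma rat_step_continuous: "continuous_on A (rat_step a)"
proof (cases "from_nat a :: rat \<times> rat")
  case (Pair q r)
  show ?thesis
  proof (cases "q < r")
    case True
    hence "uniformly_continuous_on UNIV (cts_step (real_of_rat q) (of_rat r))"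
      by (intro cts_step_uniformly_continuous) (simp add: of_rat_less)
    hence "continuous_on UNIV (cts_step (real_of_rat q) (of_rat r))"
      by (rule uniformly_continuous_imp_continuous)
    thus ?thesis using Pair True by (auto simp: rat_step_def intro: continuous_on_subset)
  qed (simp add: rat_step_def Pair)
qed

lemma rat_step_measurable [measurable]: "rat_step a \<in> borel_measurable borel"
  by (rule borel_measurable_continuous_onI[OF rat_step_continuous])

lemma emp_mean_rat_step_bound:
  assumes "n \<ge> 1" shows "\<bar>emp_mean n (rat_step a) x\<bar> \<le> 1"
proof -
  have "\<bar>\<Sum>i=1..n. rat_step a (x i)\<bar> \<le> (\<Sum>i=1..n. \<bar>rat_step a (x i)\<bar>)" by (rule sum_abs)
  also have "\<dots> \<le> (\<Sum>i=1..n. 1)" by (intro sum_mono rat_step_bound)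
  finally show ?thesis using assms by (simp add: emp_mean_def)
qed

text \<open>If, for some \<open>\<epsilon>\<close>, closeness of finitely many empirical averages to their limits did not force
\<open>K\<close> to be \<open>\<epsilon>\<close>-close to \<open>L\<close>, a choice of counterexamples with more and more averages and smaller and smaller
deviations would be a deterministic sequence to which the hypothesis on deterministic vectors applies.
As the deviations tend to 0 in mean, so does the distance of \<open>K\<close> to \<open>L\<close>.

The predicate \<open>good\<close> carries the monotonicity of the weights. Invariance under positive factors allows to
pass from the weights to the normalized weights and back.\<close>

lemma LLN_transfer:
  fixes P :: "real measure" and M :: "nat \<Rightarrow> 'a measure" and w :: "nat \<Rightarrow> nat \<Rightarrow> 'a \<Rightarrow> real"
    and K :: "nat \<Rightarrow> (nat \<Rightarrow> real) \<Rightarrow> real" and good :: "nat \<Rightarrow> (nat \<Rightarrow> real) \<Rightarrow> bool"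
  assumes P: "P \<in> space (prob_algebra Rplus)"
    and M: "\<And>n. n \<ge> 1 \<Longrightarrow> prob_space (M n)"
    and w_meas: "\<And>n i. n \<ge> 1 \<Longrightarrow> i \<in> {1..n} \<Longrightarrow> w n i \<in> borel_measurable (M n)"
    and w_nonneg: "\<And>n i \<omega>. n \<ge> 1 \<Longrightarrow> i \<in> {1..n} \<Longrightarrow> \<omega> \<in> space (M n) \<Longrightarrow> 0 \<le> w n i \<omega>"
    and LLN: "LLN P M w"
    and good: "\<And>n. n \<ge> 1 \<Longrightarrow> AE \<omega> in M n. good n (\<lambda>i. w n i \<omega>)"
    and K_bound: "\<And>n x. n \<ge> 1 \<Longrightarrow> (\<And>i. i \<in> {1..n} \<Longrightarrow> 0 \<le> x i) \<Longrightarrow> 0 \<le> K n x \<and> K n x \<le> 1"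
    and K_meas: "\<And>n. n \<ge> 1 \<Longrightarrow> (\<lambda>\<omega>. K n (\<lambda>i. w n i \<omega>)) \<in> borel_measurable (M n)"
    and K_scale: "\<And>n x z. 0 < z \<Longrightarrow> K n (\<lambda>i. z * x i) = K n x"
    and good_scale: "\<And>n x z. 0 < z \<Longrightarrow> good n x \<Longrightarrow> good n (\<lambda>i. z * x i)"
    and det: "\<And>N x. (\<And>k. N k \<ge> 1) \<Longrightarrow> filterlim N at_top sequentially \<Longrightarrow>
      (\<And>k i. i \<in> {1..N k} \<Longrightarrow> 0 \<le> x k i) \<Longrightarrow> (\<And>k. good (N k) (x k)) \<Longrightarrow>
      weak_conv_m (\<lambda>k. emp_law (N k) (x k)) (law_on_line P) \<Longrightarrow>
      (\<lambda>k. emp_mean (N k) (\<lambda>y. y) (x k)) \<longlonglongrightarrow> (LINT x|P. x) \<Longrightarrow>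
      (\<lambda>k. K (N k) (x k)) \<longlonglongrightarrow> L"
  shows "(\<lambda>n. LINT \<omega>|M n. K n (\<lambda>i. w n i \<omega>)) \<longlonglongrightarrow> L"
proof -
  let ?\<mu> = "LINT x|P. x"
  obtain Z where Zm: "\<And>n. n \<ge> 1 \<Longrightarrow> Z n \<in> borel_measurable (M n)"
    and Zpos: "\<And>n \<omega>. n \<ge> 1 \<Longrightarrow> \<omega> \<in> space (M n) \<Longrightarrow> 0 < Z n \<omega>"
    and law: "converges_in_law_to_const weak_topology_Rplus M
            (\<lambda>n \<omega>. empirical_measure n (\<lambda>i. Z n \<omega> * w n i \<omega>)) P"
    and mean: "weak_conv_m
            (\<lambda>n. distr (M n) borel (\<lambda>\<omega>. (\<Sum>i=1..n. Z n \<omega> * w n i \<omega>) / real n))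
            (return borel ?\<mu>)"
    using LLN unfolding LLN_def by auto
  define X where "X = (\<lambda>n \<omega> i. Z n \<omega> * w n i \<omega>)"
  \<comment> \<open>The deviations of single averages and, truncated at 1 because only its law is known to converge, of the mean.\<close>
  define e where "e = (\<lambda>a n x. \<bar>emp_mean n (rat_step a) x - (LINT y|P. rat_step a y)\<bar>)"
  define D where "D = (\<lambda>k n x. min 1 \<bar>emp_mean n (\<lambda>y. y) x - ?\<mu>\<bar> + (\<Sum>a<k. e a n x))"
  have e0: "0 \<le> e a n x" for a n x by (simp add: e_def)
  have D0: "0 \<le> D k n x" for k n x by (simp add: D_def e0 sum_nonneg)

  have Xm: "(\<lambda>\<omega>. X n \<omega> i) \<in> borel_measurable (M n)" if "n \<ge> 1" "i \<in> {1..n}" for n i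
    unfolding X_def using Zm[OF that(1)] w_meas[OF that] by measurable
  have X0: "0 \<le> X n \<omega> i" if "n \<ge> 1" "i \<in> {1..n}" "\<omega> \<in> space (M n)" for n i \<omega>
    unfolding X_def using Zpos[OF that(1,3)] w_nonneg[OF that] by simp
  have empm: "(\<lambda>\<omega>. emp_mean n f (X n \<omega>)) \<in> borel_measurable (M n)"
    if "n \<ge> 1" "f \<in> borel_measurable borel" for n f
    unfolding emp_mean_def
    by (intro borel_measurable_divide borel_measurable_sum measurable_compose[OF Xm that(2)] that) auto

  have claim: "\<exists>k. \<forall>n x. n \<ge> k \<longrightarrow> n \<ge> 1 \<longrightarrow> (\<forall>i\<in>{1..n}. 0 \<le> x i) \<longrightarrow> good n x \<longrightarrow>
      D k n x < 1 / real (Suc k) \<longrightarrow> \<bar>K n x - L\<bar> < \<epsilon>" if "\<epsilon> > 0" for \<epsilon>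
  proof (rule ccontr)
    assume "\<not> ?thesis"
    then obtain N x where N: "\<And>k. N k \<ge> k" "\<And>k. N k \<ge> 1"
      and x: "\<And>k i. i \<in> {1..N k} \<Longrightarrow> 0 \<le> x k i" and g: "\<And>k. good (N k) (x k)"
      and Dk: "\<And>k. D k (N k) (x k) < 1 / real (Suc k)" and far: "\<And>k. \<not> \<bar>K (N k) (x k) - L\<bar> < \<epsilon>"
      by metis
    have lim: "filterlim N at_top sequentially"
      by (rule filterlim_at_top_mono[OF filterlim_ident]) (use N in auto)
    have inv: "(\<lambda>k. 1 / real (Suc k)) \<longlonglongrightarrow> 0"
      using LIMSEQ_inverse_real_of_nat by (simp add: inverse_eq_divide)
    have "(\<lambda>k. emp_mean (N k) (\<lambda>y. y) (x k) - ?\<mu>) \<longlonglongrightarrow> 0"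
    proof (rule Lim_null_comparison[OF _ inv])
      have "norm (emp_mean (N k) (\<lambda>y. y) (x k) - ?\<mu>) \<le> 1 / real (Suc k)" for k
      proof -
        have "min 1 \<bar>emp_mean (N k) (\<lambda>y. y) (x k) - ?\<mu>\<bar> < 1 / real (Suc k)"
          using Dk[of k] sum_nonneg[of "{..<k}" "\<lambda>a. e a (N k) (x k)"] e0 unfolding D_def by auto
        moreover have "1 / real (Suc k) \<le> 1" by simp
        ultimately show ?thesis unfolding real_norm_def by linarith
      qed
      thus "\<forall>\<^sub>F k in sequentially. norm (emp_mean (N k) (\<lambda>y. y) (x k) - ?\<mu>) \<le> 1 / real (Suc k)" by simp
    qed
    hence m: "(\<lambda>k. emp_mean (N k) (\<lambda>y. y) (x k)) \<longlonglongrightarrow> ?\<mu>" by (simp add: LIM_zero_iff)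
    have ea: "(\<lambda>k. emp_mean (N k) (rat_step a) (x k)) \<longlonglongrightarrow> (LINT y|P. rat_step a y)" for a
    proof -
      have "(\<lambda>k. emp_mean (N k) (rat_step a) (x k) - (LINT y|P. rat_step a y)) \<longlonglongrightarrow> 0"
      proof (rule Lim_null_comparison[OF _ inv])
        have "e a (N k) (x k) \<le> 1 / real (Suc k)" if "k \<ge> Suc a" for k
        proof -
          have "e a (N k) (x k) \<le> (\<Sum>a<k. e a (N k) (x k))"
            using that by (intro member_le_sum) (auto simp: e0)
          also have "\<dots> \<le> D k (N k) (x k)" by (simp add: D_def)
          finally show ?thesis using Dk[of k] by linarith
        qed
        thus "\<forall>\<^sub>F k in sequentially. norm (emp_mean (N k) (rat_step a) (x k) - (LINT y|P. rat_step a y)) \<le> 1 / real (Suc k)"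
          unfolding e_def real_norm_def by (intro eventually_sequentiallyI[of "Suc a"])
      qed
      thus ?thesis by (simp add: LIM_zero_iff)
    qed
    have "weak_conv_m (\<lambda>k. emp_law (N k) (x k)) (law_on_line P)"
    proof (rule weak_conv_m_rational_steps)
      fix a b :: real assume "a \<in> \<rat>" "b \<in> \<rat>" "a < b"
      then obtain j where j: "rat_step j = cts_step a b" using rat_step_surj by blast
      have "cts_step a b \<in> borel_measurable borel" using rat_step_measurable[of j] j by simp
      thus "(\<lambda>n. LINT y|emp_law (N n) (x n). cts_step a b y) \<longlonglongrightarrow> (LINT y|law_on_line P. cts_step a b y)"
        using ea[of j] unfolding j by (simp add: integral_emp_law integral_law_on_line[OF P])
    qed (auto intro: real_distribution_emp_law real_distribution_P P N)
    hence "(\<lambda>k. K (N k) (x k)) \<longlonglongrightarrow> L" by (intro det N lim x g m)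
    hence "\<forall>\<^sub>F k in sequentially. \<bar>K (N k) (x k) - L\<bar> < \<epsilon>"
      using that by (auto dest!: tendstoD simp: dist_real_def)
    thus False using far by (auto simp: eventually_sequentially)
  qed

  have ED: "(\<lambda>n. LINT \<omega>|M n. D k n (X n \<omega>)) \<longlonglongrightarrow> 0" for k
  proof -
    have 1: "(\<lambda>n. LINT \<omega>|M n. min 1 \<bar>emp_mean n (\<lambda>y. y) (X n \<omega>) - ?\<mu>\<bar>) \<longlonglongrightarrow> 0"
    proof (rule weak_conv_to_return)
      show "weak_conv_m (\<lambda>n. distr (M n) borel (\<lambda>\<omega>. emp_mean n (\<lambda>y. y) (X n \<omega>))) (return borel ?\<mu>)"
        using mean unfolding emp_mean_def X_def .
    qed (auto intro: M empm)
    have 2: "(\<lambda>n. LINT \<omega>|M n. e a n (X n \<omega>)) \<longlonglongrightarrow> 0" for a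
    proof -
      have "(\<lambda>n. LINT \<omega>|M n. \<bar>(LINT y|empirical_measure n (X n \<omega>). rat_step a y) - (LINT y|P. rat_step a y)\<bar>) \<longlonglongrightarrow> 0"
        using law unfolding X_def
        by (intro converges_in_law_integral[OF P, where B=1] rat_step_continuous rat_step_bound)
      moreover have "\<forall>\<^sub>F n in sequentially. (LINT \<omega>|M n. \<bar>(LINT y|empirical_measure n (X n \<omega>). rat_step a y) - (LINT y|P. rat_step a y)\<bar>)
          = (LINT \<omega>|M n. e a n (X n \<omega>))"
        unfolding e_def
        by (intro eventually_sequentiallyI[of 1] Bochner_Integration.integral_cong refl, subst integral_empirical_measure)
           (auto intro: rat_step_continuous X0)
      ultimately show ?thesis by (simp add: filterlim_cong[OF refl refl])
    qed
    have "(\<lambda>n. (LINT \<omega>|M n. min 1 \<bar>emp_mean n (\<lambda>y. y) (X n \<omega>) - ?\<mu>\<bar>) + (\<Sum>a<k. LINT \<omega>|M n. e a n (X n \<omega>))) \<longlonglongrightarrow> 0 + (\<Sum>a<k. 0)"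
      by (intro tendsto_add tendsto_sum 1 2)
    moreover have "\<forall>\<^sub>F n in sequentially. (LINT \<omega>|M n. min 1 \<bar>emp_mean n (\<lambda>y. y) (X n \<omega>) - ?\<mu>\<bar>) + (\<Sum>a<k. LINT \<omega>|M n. e a n (X n \<omega>))
       = (LINT \<omega>|M n. D k n (X n \<omega>))"
    proof (rule eventually_sequentiallyI[of 1])
      fix n :: nat assume n: "1 \<le> n"
      interpret prob_space "M n" by (rule M[OF n])
      have [measurable]: "(\<lambda>\<omega>. emp_mean n (\<lambda>y. y) (X n \<omega>)) \<in> borel_measurable (M n)"
        "(\<lambda>\<omega>. emp_mean n (rat_step a) (X n \<omega>)) \<in> borel_measurable (M n)" for a
        by (auto intro: empm n)
      have "integrable (M n) (\<lambda>\<omega>. e a n (X n \<omega>))" for a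
      proof (rule integrable_const_bound[where B="1 + \<bar>LINT y|P. rat_step a y\<bar>"])
        show "AE \<omega> in M n. norm (e a n (X n \<omega>)) \<le> 1 + \<bar>LINT y|P. rat_step a y\<bar>"
          using emp_mean_rat_step_bound[OF n] by (intro AE_I2) (auto simp: e_def intro: order_trans[OF abs_triangle_ineq4] add_right_mono)
      qed (simp add: e_def)
      moreover have "integrable (M n) (\<lambda>\<omega>. min 1 \<bar>emp_mean n (\<lambda>y. y) (X n \<omega>) - ?\<mu>\<bar>)"
        by (rule integrable_const_bound[where B=1]) auto
      ultimately show "(LINT \<omega>|M n. min 1 \<bar>emp_mean n (\<lambda>y. y) (X n \<omega>) - ?\<mu>\<bar>) + (\<Sum>a<k. LINT \<omega>|M n. e a n (X n \<omega>))
         = (LINT \<omega>|M n. D k n (X n \<omega>))"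
        unfolding D_def by simp
    qed
    ultimately show ?thesis by (simp add: filterlim_cong[OF refl refl])
  qed

  show ?thesis
  proof (rule LIMSEQ_I)
    fix r :: real assume r: "0 < r"
    obtain k where k: "\<And>n x. n \<ge> k \<Longrightarrow> n \<ge> 1 \<Longrightarrow> (\<forall>i\<in>{1..n}. 0 \<le> x i) \<Longrightarrow> good n x \<Longrightarrow>
      D k n x < 1 / real (Suc k) \<Longrightarrow> \<bar>K n x - L\<bar> < r / 2"
      using claim[of "r / 2"] r by auto
    \<comment> \<open>Where the deviation exceeds its bound, the trivial estimate \<open>1 + \<bar>L\<bar>\<close> is at most \<open>C\<close> times the deviation.\<close>
    define C where "C = (1 + \<bar>L\<bar>) * real (Suc k)"
    have C: "C > 0" by (simp add: C_def)
    obtain n0 where n0: "\<And>n. n \<ge> n0 \<Longrightarrow> \<bar>LINT \<omega>|M n. D k n (X n \<omega>)\<bar> < r / (2 * C)"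
      using LIMSEQ_D[OF ED[of k], of "r / (2 * C)"] r C by auto
    have "norm ((LINT \<omega>|M n. K n (\<lambda>i. w n i \<omega>)) - L) < r" if n: "n \<ge> max n0 (max k 1)" for n
    proof -
      have n1: "n \<ge> 1" "n \<ge> k" "n \<ge> n0" using n by auto
      interpret prob_space "M n" by (rule M[OF n1(1)])
      have [measurable]: "(\<lambda>\<omega>. emp_mean n (\<lambda>y. y) (X n \<omega>)) \<in> borel_measurable (M n)"
        "(\<lambda>\<omega>. emp_mean n (rat_step a) (X n \<omega>)) \<in> borel_measurable (M n)" for a
        by (auto intro: empm n1)
      have Km: "(\<lambda>\<omega>. K n (\<lambda>i. w n i \<omega>)) \<in> borel_measurable (M n)" by (rule K_meas[OF n1(1)])
      have Kb: "0 \<le> K n (\<lambda>i. w n i \<omega>) \<and> K n (\<lambda>i. w n i \<omega>) \<le> 1" if "\<omega> \<in> space (M n)" for \<omega>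
        using w_nonneg[OF n1(1) _ that] by (intro K_bound n1) auto
      have Kint: "integrable (M n) (\<lambda>\<omega>. K n (\<lambda>i. w n i \<omega>))"
        by (rule integrable_const_bound[where B=1]) (use Km Kb in auto)
      have Db: "D k n x \<le> 1 + (\<Sum>a<k. 1 + \<bar>LINT y|P. rat_step a y\<bar>)" for x
      proof -
        have "e a n x \<le> 1 + \<bar>LINT y|P. rat_step a y\<bar>" for a
          using emp_mean_rat_step_bound[OF n1(1), of a x] unfolding e_def by linarith
        thus ?thesis unfolding D_def by (intro add_mono sum_mono) auto
      qed
      have Dint: "integrable (M n) (\<lambda>\<omega>. D k n (X n \<omega>))"
        by (rule integrable_const_bound[where B="1 + (\<Sum>a<k. 1 + \<bar>LINT y|P. rat_step a y\<bar>)"])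
           (use Db D0 in \<open>auto simp: D_def e_def\<close>)
      have AE: "AE \<omega> in M n. \<bar>K n (\<lambda>i. w n i \<omega>) - L\<bar> \<le> r / 2 + C * D k n (X n \<omega>)"
        using good[OF n1(1)] AE_space
      proof eventually_elim
        case (elim \<omega>)
        have KX: "K n (X n \<omega>) = K n (\<lambda>i. w n i \<omega>)"
          unfolding X_def by (rule K_scale[OF Zpos[OF n1(1) elim(2)]])
        have gX: "good n (X n \<omega>)"
          unfolding X_def by (rule good_scale[OF Zpos[OF n1(1) elim(2)] elim(1)])
        show ?case
        proof (cases "D k n (X n \<omega>) < 1 / real (Suc k)")
          case True
          have "\<bar>K n (X n \<omega>) - L\<bar> < r / 2"
            by (intro k n1 gX True) (use X0[OF n1(1) _ elim(2)] in auto)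
          thus ?thesis using mult_nonneg_nonneg[OF less_imp_le[OF C] D0[of k n "X n \<omega>"]] unfolding KX by linarith
        next
          case False
          hence "1 \<le> real (Suc k) * D k n (X n \<omega>)" by (simp add: field_simps)
          hence "(1 + \<bar>L\<bar>) * 1 \<le> (1 + \<bar>L\<bar>) * (real (Suc k) * D k n (X n \<omega>))"
            by (intro mult_left_mono) auto
          hence "1 + \<bar>L\<bar> \<le> C * D k n (X n \<omega>)" by (simp add: C_def mult.assoc)
          thus ?thesis using Kb[OF elim(2)] r by linarith
        qed
      qed
      have "\<bar>(LINT \<omega>|M n. K n (\<lambda>i. w n i \<omega>)) - L\<bar> = \<bar>LINT \<omega>|M n. K n (\<lambda>i. w n i \<omega>) - L\<bar>"
        using Kint by (simp add: prob_space)
      also have "\<dots> \<le> (LINT \<omega>|M n. \<bar>K n (\<lambda>i. w n i \<omega>) - L\<bar>)" by (rule integral_abs_bound)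
      also have "\<dots> \<le> (LINT \<omega>|M n. r / 2 + C * D k n (X n \<omega>))"
        by (rule integral_mono_AE[OF _ _ AE]) (use Kint Dint in auto)
      also have "\<dots> = r / 2 + C * (LINT \<omega>|M n. D k n (X n \<omega>))"
        using Dint by (simp add: prob_space)
      also have "\<dots> < r / 2 + C * (r / (2 * C))"
        using n0[OF n1(3)] C by (intro add_strict_left_mono mult_strict_left_mono) auto
      finally show ?thesis using C by simp
    qed
    thus "\<exists>n0. \<forall>n\<ge>n0. norm ((LINT \<omega>|M n. K n (\<lambda>i. w n i \<omega>)) - L) < r" by blast
  qed
qed

section \<open>Costs in terms of the empirical measure\<close>

text \<open>Here and below \<open>c\<close> stands for \<open>\<mu> * t\<close>, so that \<open>n * c\<close> is the time at which the cost is observed and \<open>unrequested n c x i\<close> is the conditional probability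
that \<open>i\<close> has not been requested by then.\<close>

definition unrequested :: "nat \<Rightarrow> real \<Rightarrow> (nat \<Rightarrow> real) \<Rightarrow> nat \<Rightarrow> real" where
  "unrequested n c x i = exp (- (popularity n x i * (real n * c)))"

definition mean_unrequested :: "nat \<Rightarrow> real \<Rightarrow> (nat \<Rightarrow> real) \<Rightarrow> real" where
  "mean_unrequested n c x = (\<Sum>j=1..n. unrequested n c x j) / real n"

text \<open>The conditional transform given the weights \<open>x\<close>, up to an error of order \<open>1 / n\<close>.\<close>

definition exponential_cost :: "nat \<Rightarrow> real \<Rightarrow> real \<Rightarrow> (nat \<Rightarrow> real) \<Rightarrow> real" where
  "exponential_cost n c l x = (\<Sum>i=1..n. popularity n x i * (unrequested n c x i *
     exp (- l * (1 - mean_unrequested n c x + (\<Sum>j=1..i. unrequested n c x j) / real n))))"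

text \<open>As \<open>exponential_cost\<close>, but with the objects in front of \<open>i\<close> determined by comparing weights rather than labels,
which makes it a functional of the empirical measure.\<close>

definition comparison_cost ::
    "(real \<Rightarrow> real \<Rightarrow> bool) \<Rightarrow> nat \<Rightarrow> real \<Rightarrow> real \<Rightarrow> (nat \<Rightarrow> real) \<Rightarrow> real" where
  "comparison_cost r n c l x = (\<Sum>i=1..n. popularity n x i * (unrequested n c x i *
     exp (- l * (1 - mean_unrequested n c x +
       (\<Sum>j=1..n. of_bool (r (x j) (x i)) * unrequested n c x j) / real n))))"

text \<open>The symmetric function that arises from \<open>exponential_cost\<close> when the partial sums are replaced by their
means under a random permutation, and the factor that belongs to the object in position \<open>i\<close> is
replaced by its mean as well.\<close>

definition averaged_cost :: "nat \<Rightarrow> real \<Rightarrow> real \<Rightarrow> (nat \<Rightarrow> real) \<Rightarrow> real" where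
  "averaged_cost n c l x = (\<Sum>i=1..n. popularity n x i * unrequested n c x i) *
     exp (- l * (1 - mean_unrequested n c x)) *
     ((\<Sum>i=1..n. exp (- l * mean_unrequested n c x * (real i / real n))) / real n)"

lemma popularity_time:
  assumes "n \<ge> 1"
  shows "popularity n x i * (real n * c) = x i * (c / emp_mean n (\<lambda>y. y) x)"
  using assms by (simp add: popularity_def emp_mean_def)

lemma popularity_emp_mean:
  assumes "n \<ge> 1"
  shows "popularity n x i = x i / emp_mean n (\<lambda>y. y) x / real n"
  using assms by (simp add: popularity_def emp_mean_def)

lemma unrequested_emp:
  assumes "n \<ge> 1"
  shows "unrequested n c x i = exp (- (x i * (c / emp_mean n (\<lambda>y. y) x)))"
  unfolding unrequested_def popularity_time[OF assms] ..

text \<open>The sum is a Riemann sum, and a geometric one, which gives its limit in closed form.\<close>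

lemma tendsto_exp_average:
  assumes a: "a \<longlonglongrightarrow> \<alpha>" "\<alpha> > 0" and N: "filterlim N at_top sequentially" "\<And>k. N k \<ge> (1::nat)"
  shows "(\<lambda>k. (\<Sum>i=1..N k. exp (- a k * (real i / real (N k)))) / real (N k)) \<longlonglongrightarrow> (1 - exp (- \<alpha>)) / \<alpha>"
proof -
  define b where "b = (\<lambda>k. a k / real (N k))"
  have inv: "(\<lambda>k. inverse (real (N k))) \<longlonglongrightarrow> 0"
    by (rule tendsto_inverse_0_at_top, rule filterlim_compose[OF filterlim_real_sequentially N(1)])
  have b0: "b \<longlonglongrightarrow> 0"
    using tendsto_mult[OF a(1) inv] by (simp add: b_def divide_inverse)
  have apos: "\<forall>\<^sub>F k in sequentially. a k > 0" by (rule order_tendstoD(1)[OF a])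
  have "((\<lambda>h. (exp h - exp 0) / h) \<longlongrightarrow> exp (0::real)) (at 0)"
    using DERIV_exp[of "0::real"] by (simp add: DERIV_def)
  hence "((\<lambda>h::real. (exp h - 1) / h) \<longlongrightarrow> 1) (at 0)" by simp
  hence "(\<lambda>k. (exp (b k) - 1) / b k) \<longlonglongrightarrow> 1"
  proof (rule filterlim_compose)
    show "filterlim b (at 0) sequentially"
      unfolding filterlim_at
    proof (intro conjI b0)
      show "\<forall>\<^sub>F k in sequentially. b k \<in> UNIV \<and> b k \<noteq> 0"
        using apos
      proof eventually_elim
        case (elim k)
        thus ?case using N(2)[of k] by (simp add: b_def)
      qed
    qed
  qed
  hence "(\<lambda>k. (1 - exp (- a k)) / a k * inverse ((exp (b k) - 1) / b k)) \<longlonglongrightarrow> (1 - exp (- \<alpha>)) / \<alpha> * inverse 1"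
    using a by (intro tendsto_intros) auto
  moreover have "\<forall>\<^sub>F k in sequentially. (1 - exp (- a k)) / a k * inverse ((exp (b k) - 1) / b k) =
     (\<Sum>i=1..N k. exp (- a k * (real i / real (N k)))) / real (N k)"
    using apos
  proof eventually_elim
    case (elim k)
    have bp: "b k > 0" using elim N(2)[of k] by (simp add: b_def)
    define q where "q = exp (- b k)"
    have q: "q \<noteq> 1" "q > 0" "exp (b k) = 1 / q" using bp by (auto simp: q_def exp_minus field_simps)
    have qn: "q ^ N k = exp (- a k)"
      using N(2)[of k] by (simp add: q_def exp_of_nat_mult[symmetric] b_def)
    have "(\<Sum>i=1..N k. exp (- a k * (real i / real (N k)))) = (\<Sum>i=1..N k. q ^ i)"
      by (intro sum.cong) (auto simp: q_def exp_of_nat_mult[symmetric] b_def)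
    also have "\<dots> = q * (\<Sum>i<N k. q ^ i)"
      unfolding sum_distrib_left by (rule sum.reindex_bij_witness[of _ Suc "\<lambda>i. i - 1"]) (auto simp flip: power_Suc)
    also have "(\<Sum>i<N k. q ^ i) = (1 - exp (- a k)) / (1 - q)"
      using q(1) by (simp add: geometric_sum qn divide_simps) (simp add: algebra_simps)
    finally have S: "(\<Sum>i=1..N k. exp (- a k * (real i / real (N k)))) = q * ((1 - exp (- a k)) / (1 - q))" .
    have "inverse ((exp (b k) - 1) / b k) = b k * (q / (1 - q))"
    proof -
      have "exp (b k) - 1 = (1 - q) / q" unfolding q(3) using q(2) by (simp add: diff_divide_distrib)
      thus ?thesis by simp
    qed
    hence "(1 - exp (- a k)) / a k * inverse ((exp (b k) - 1) / b k) = (1 - exp (- a k)) / a k * (b k * (q / (1 - q)))"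
      by (rule arg_cong)
    also have "\<dots> = q * ((1 - exp (- a k)) / (1 - q)) / real (N k)"
      using elim by (simp add: b_def mult_ac)
    finally show ?case unfolding S .
  qed
  ultimately show ?thesis by (simp add: filterlim_cong[OF refl refl])
qed

lemma integrable_exp_P:
  assumes P: "P \<in> space (prob_algebra Rplus)" and t: "0 \<le> t"
  shows "integrable P (\<lambda>x. exp (- t * x))"
proof -
  interpret prob_space P by (rule Rplus_prob_facts(1)[OF P])
  show ?thesis
  proof (rule integrable_const_bound[where B=1])
    show "AE x in P. norm (exp (- t * x)) \<le> 1"
      using Rplus_prob_facts(3)[OF P] t by (intro AE_I2) auto
    show "(\<lambda>x. exp (- t * x)) \<in> borel_measurable P" by (rule measurable_P[OF P]) measurable
  qed
qed

lemma laplace_pos: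
  assumes P: "P \<in> space (prob_algebra Rplus)" and t: "0 \<le> t"
  shows "0 < laplace P t"
proof -
  interpret prob_space P by (rule Rplus_prob_facts(1)[OF P])
  note int = integrable_exp_P[OF P t]
  have "laplace P t \<noteq> 0"
  proof
    assume "laplace P t = 0"
    hence "AE x in P. exp (- t * x) = 0"
      using integral_nonneg_eq_0_iff_AE[OF int] by (simp add: laplace_def)
    thus False using AE_False by simp
  qed
  moreover have "0 \<le> laplace P t" unfolding laplace_def by (simp add: integral_nonneg_AE)
  ultimately show ?thesis by simp
qed

text \<open>A Skorohod representation of the empirical measures of a deterministic sequence of vectors \<open>x k\<close> of
lengths \<open>N k\<close>, together with convergence of their means. Expectations of functions of \<open>Y k\<close> are
empirical averages over \<open>x k\<close>.\<close>

locale coupling = prob_space \<Omega> for \<Omega> :: "real measure" +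
  fixes P :: "real measure" and N :: "nat \<Rightarrow> nat" and x :: "nat \<Rightarrow> nat \<Rightarrow> real"
    and Y :: "nat \<Rightarrow> real \<Rightarrow> real" and Yl :: "real \<Rightarrow> real" and \<mu> t l :: real
  assumes P: "P \<in> space (prob_algebra Rplus)"
    and P_int: "integrable P (\<lambda>x. x)" and \<mu>: "\<mu> = (LINT x|P. x)" "\<mu> \<noteq> 0"
    and N: "\<And>k. N k \<ge> 1" "filterlim N at_top sequentially"
    and x_nonneg: "\<And>k i. i \<in> {1..N k} \<Longrightarrow> 0 \<le> x k i"
    and Y_meas [measurable]: "\<And>k. Y k \<in> borel_measurable \<Omega>" "Yl \<in> borel_measurable \<Omega>"
    and Y_law: "\<And>k. distr \<Omega> borel (Y k) = emp_law (N k) (x k)" "distr \<Omega> borel Yl = law_on_line P"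
    and Y_lim: "\<And>\<omega>. \<omega> \<in> space \<Omega> \<Longrightarrow> (\<lambda>k. Y k \<omega>) \<longlonglongrightarrow> Yl \<omega>"
    and mean_lim: "(\<lambda>k. emp_mean (N k) (\<lambda>y. y) (x k)) \<longlonglongrightarrow> \<mu>"
    and t: "0 \<le> t" and l: "0 \<le> l"
begin

text \<open>The mean and the time scale after normalization: the popularity multiplied by the time is \<open>x k i * \<tau> k\<close>.\<close>

abbreviation m :: "nat \<Rightarrow> real" where "m k \<equiv> emp_mean (N k) (\<lambda>y. y) (x k)"
abbreviation \<tau> :: "nat \<Rightarrow> real" where "\<tau> k \<equiv> \<mu> * t / m k"

lemma expectation_Y:
  assumes "f \<in> borel_measurable borel"
  shows "(LINT \<omega>|\<Omega>. f (Y k \<omega>)) = emp_mean (N k) f (x k)"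
  using integral_distr[OF Y_meas(1) assms, of k] unfolding Y_law(1) integral_emp_law[OF assms] by (rule sym)

lemma expectation_Yl:
  fixes f :: "real \<Rightarrow> real"
  assumes "f \<in> borel_measurable borel"
  shows "(LINT \<omega>|\<Omega>. f (Yl \<omega>)) = (LINT x|P. f x)"
  using integral_distr[OF Y_meas(2) assms] unfolding Y_law(2) integral_law_on_line[OF P assms] by (rule sym)

lemma integrable_Y: "integrable \<Omega> (Y k)"
proof -
  have "integrable (emp_law (N k) (x k)) (\<lambda>y. y)"
    unfolding emp_law_def
    by (subst integrable_distr_eq)
       (simp_all add: uniform_count_measure_def point_measure_def integrable_density integrable_count_space)
  thus ?thesis using integrable_distr_eq[OF Y_meas(1), of "\<lambda>y. y" k] unfolding Y_law(1) by simp
qed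

lemma integrable_Yl: "integrable \<Omega> Yl"
proof -
  have "integrable (law_on_line P) (\<lambda>y. y) \<longleftrightarrow> integrable P (\<lambda>y. y)"
    by (rule integrable_law_on_line[OF P]) simp
  moreover have "integrable (law_on_line P) (\<lambda>y. y) \<longleftrightarrow> integrable \<Omega> (\<lambda>\<omega>. Yl \<omega>)"
    unfolding Y_law(2)[symmetric] by (rule integrable_distr_eq[OF Y_meas(2)]) simp
  ultimately show ?thesis using P_int by simp
qed

lemma Y_nonneg: "AE \<omega> in \<Omega>. 0 \<le> Y k \<omega>"
proof -
  have "AE y in emp_law (N k) (x k). 0 \<le> y" unfolding emp_law_def
    by (subst AE_distr_iff)
       (use x_nonneg in \<open>auto simp: uniform_count_measure_def point_measure_def AE_density AE_count_space\<close>)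
  thus ?thesis using AE_distr_iff[OF Y_meas(1), of "\<lambda>y. 0 \<le> y" k] unfolding Y_law(1) by simp
qed

lemma Yl_nonneg: "AE \<omega> in \<Omega>. 0 \<le> Yl \<omega>"
  using AE_law_on_line_nonneg[OF P] AE_distr_iff[OF Y_meas(2), of "\<lambda>y. 0 \<le> y"] unfolding Y_law(2) by simp

lemma \<mu>_pos: "0 < \<mu>"
proof -
  have "0 \<le> (LINT \<omega>|\<Omega>. Yl \<omega>)" using Yl_nonneg by (rule integral_nonneg_AE)
  thus ?thesis using expectation_Yl[of "\<lambda>y. y"] \<mu> by simp
qed

lemma m_nonneg: "0 \<le> m k"
  unfolding emp_mean_def by (intro divide_nonneg_nonneg sum_nonneg x_nonneg) auto

lemma \<tau>_nonneg: "0 \<le> \<tau> k"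
  using m_nonneg \<mu>_pos t by simp

lemma exp_\<tau>_le_1: "0 \<le> y \<Longrightarrow> exp (- (y * \<tau> k)) \<le> 1"
proof -
  assume "0 \<le> y"
  hence "0 \<le> y * \<tau> k" by (intro mult_nonneg_nonneg \<tau>_nonneg)
  thus ?thesis by (simp only: exp_le_one_iff neg_le_0_iff_le)
qed

lemma \<tau>_lim: "\<tau> \<longlonglongrightarrow> t"
  using tendsto_divide[OF tendsto_const mean_lim \<mu>(2), of "\<mu> * t"] \<mu>(2) by simp

text \<open>Scheffe's argument: the positive part of \<open>Yl - Y k\<close> is dominated by \<open>Yl\<close>, and the negative part has asymptotically
the same expectation since the means converge.\<close>

lemma L1_conv: "(\<lambda>k. LINT \<omega>|\<Omega>. \<bar>Y k \<omega> - Yl \<omega>\<bar>) \<longlonglongrightarrow> 0"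
proof -
  have "(\<lambda>k. LINT \<omega>|\<Omega>. max 0 (Yl \<omega> - Y k \<omega>)) \<longlonglongrightarrow> (LINT \<omega>|\<Omega>. 0)"
  proof (rule integral_dominated_convergence[where w=Yl])
    show "AE \<omega> in \<Omega>. (\<lambda>k. max 0 (Yl \<omega> - Y k \<omega>)) \<longlonglongrightarrow> 0"
    proof (rule AE_I2)
      fix \<omega> assume "\<omega> \<in> space \<Omega>"
      hence "(\<lambda>k. max 0 (Yl \<omega> - Y k \<omega>)) \<longlonglongrightarrow> max 0 (Yl \<omega> - Yl \<omega>)"
        by (intro tendsto_intros Y_lim)
      thus "(\<lambda>k. max 0 (Yl \<omega> - Y k \<omega>)) \<longlonglongrightarrow> 0" by simp
    qed
    show "AE \<omega> in \<Omega>. norm (max 0 (Yl \<omega> - Y k \<omega>)) \<le> Yl \<omega>" for k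
      using Y_nonneg[of k] Yl_nonneg by eventually_elim auto
  qed (auto intro: integrable_Yl)
  hence "(\<lambda>k. 2 * (LINT \<omega>|\<Omega>. max 0 (Yl \<omega> - Y k \<omega>)) - (\<mu> - m k)) \<longlonglongrightarrow> 2 * 0 - (\<mu> - \<mu>)"
    by (intro tendsto_intros mean_lim) simp
  moreover have "2 * (LINT \<omega>|\<Omega>. max 0 (Yl \<omega> - Y k \<omega>)) - (\<mu> - m k) = (LINT \<omega>|\<Omega>. \<bar>Y k \<omega> - Yl \<omega>\<bar>)" for k
  proof -
    have "\<mu> - m k = (LINT \<omega>|\<Omega>. Yl \<omega> - Y k \<omega>)"
      using expectation_Y[of "\<lambda>y. y" k] expectation_Yl[of "\<lambda>y. y"] \<mu>
      by (simp add: integrable_Y integrable_Yl)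
    moreover have "integrable \<Omega> (\<lambda>\<omega>. max 0 (Yl \<omega> - Y k \<omega>))"
      by (intro integrable_max) (auto intro: integrable_Y integrable_Yl)
    ultimately have "2 * (LINT \<omega>|\<Omega>. max 0 (Yl \<omega> - Y k \<omega>)) - (\<mu> - m k) =
       (LINT \<omega>|\<Omega>. 2 * max 0 (Yl \<omega> - Y k \<omega>) - (Yl \<omega> - Y k \<omega>))"
      by (simp add: integrable_Y integrable_Yl)
    also have "\<dots> = (LINT \<omega>|\<Omega>. \<bar>Y k \<omega> - Yl \<omega>\<bar>)"
      by (intro Bochner_Integration.integral_cong) (auto simp: max_def abs_if)
    finally show ?thesis .
  qed
  ultimately show ?thesis by simp
qed

text \<open>The weights \<open>Y k\<close> have no common integrable bound in general (none is provided by an exponential factor when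
\<open>t = 0\<close>), so the dominated convergence theorem applies only after \<open>Y k\<close> has been replaced by \<open>Yl\<close>. Where \<open>Yl\<close> vanishes the factors \<open>\<psi> k\<close> need not
converge; for the indicators below this permits an atom of \<open>P\<close> at 0.\<close>

lemma weighted_mean_lim:
  assumes \<psi> [measurable]: "\<And>k. \<psi> k \<in> borel_measurable \<Omega>" "\<psi>l \<in> borel_measurable \<Omega>"
    and bnd: "\<And>k. AE \<omega> in \<Omega>. \<bar>\<psi> k \<omega>\<bar> \<le> 1"
    and lim: "AE \<omega> in \<Omega>. 0 < Yl \<omega> \<longrightarrow> (\<lambda>k. \<psi> k \<omega>) \<longlonglongrightarrow> \<psi>l \<omega>"
  shows "(\<lambda>k. LINT \<omega>|\<Omega>. Y k \<omega> * \<psi> k \<omega>) \<longlonglongrightarrow> (LINT \<omega>|\<Omega>. Yl \<omega> * \<psi>l \<omega>)"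
proof -
  have int1: "integrable \<Omega> (\<lambda>\<omega>. Y k \<omega> * \<psi> k \<omega>)" for k
  proof (rule Bochner_Integration.integrable_bound[OF integrable_Y[of k]])
    show "AE \<omega> in \<Omega>. norm (Y k \<omega> * \<psi> k \<omega>) \<le> norm (Y k \<omega>)"
      using bnd[of k] by eventually_elim (simp add: abs_mult mult_left_le)
  qed measurable
  have int2: "integrable \<Omega> (\<lambda>\<omega>. Yl \<omega> * \<psi> k \<omega>)" for k
  proof (rule Bochner_Integration.integrable_bound[OF integrable_Yl])
    show "AE \<omega> in \<Omega>. norm (Yl \<omega> * \<psi> k \<omega>) \<le> norm (Yl \<omega>)"
      using bnd[of k] by eventually_elim (simp add: abs_mult mult_left_le)
  qed measurable
  have A: "(\<lambda>k. LINT \<omega>|\<Omega>. Yl \<omega> * \<psi> k \<omega>) \<longlonglongrightarrow> (LINT \<omega>|\<Omega>. Yl \<omega> * \<psi>l \<omega>)"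
  proof (rule integral_dominated_convergence[where w=Yl])
    show "AE \<omega> in \<Omega>. (\<lambda>k. Yl \<omega> * \<psi> k \<omega>) \<longlonglongrightarrow> Yl \<omega> * \<psi>l \<omega>"
      using lim Yl_nonneg
    proof eventually_elim
      case (elim \<omega>)
      thus ?case by (cases "Yl \<omega> = 0") (auto intro!: tendsto_intros)
    qed
    show "AE \<omega> in \<Omega>. norm (Yl \<omega> * \<psi> k \<omega>) \<le> Yl \<omega>" for k
      using bnd[of k] Yl_nonneg by eventually_elim (simp add: abs_mult mult_left_le)
  qed (auto intro: integrable_Yl)
  have "(\<lambda>k. (LINT \<omega>|\<Omega>. Y k \<omega> * \<psi> k \<omega>) - (LINT \<omega>|\<Omega>. Yl \<omega> * \<psi> k \<omega>)) \<longlonglongrightarrow> 0"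
  proof (rule Lim_null_comparison[OF _ L1_conv], intro always_eventually allI)
    fix k
    have "\<bar>(LINT \<omega>|\<Omega>. Y k \<omega> * \<psi> k \<omega>) - (LINT \<omega>|\<Omega>. Yl \<omega> * \<psi> k \<omega>)\<bar> = \<bar>LINT \<omega>|\<Omega>. Y k \<omega> * \<psi> k \<omega> - Yl \<omega> * \<psi> k \<omega>\<bar>"
      by (simp add: int1 int2)
    also have "\<dots> \<le> (LINT \<omega>|\<Omega>. \<bar>Y k \<omega> * \<psi> k \<omega> - Yl \<omega> * \<psi> k \<omega>\<bar>)" by (rule integral_abs_bound)
    also have "\<dots> \<le> (LINT \<omega>|\<Omega>. \<bar>Y k \<omega> - Yl \<omega>\<bar>)"
    proof (rule integral_mono_AE)
      show "AE \<omega> in \<Omega>. \<bar>Y k \<omega> * \<psi> k \<omega> - Yl \<omega> * \<psi> k \<omega>\<bar> \<le> \<bar>Y k \<omega> - Yl \<omega>\<bar>"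
        using bnd[of k] by eventually_elim (simp add: left_diff_distrib[symmetric] abs_mult mult_left_le)
    qed (auto intro!: integrable_abs Bochner_Integration.integrable_diff int1 int2 integrable_Y integrable_Yl)
    finally show "norm ((LINT \<omega>|\<Omega>. Y k \<omega> * \<psi> k \<omega>) - (LINT \<omega>|\<Omega>. Yl \<omega> * \<psi> k \<omega>)) \<le> (LINT \<omega>|\<Omega>. \<bar>Y k \<omega> - Yl \<omega>\<bar>)"
      by simp
  qed
  from tendsto_add[OF this A] show ?thesis by simp
qed

abbreviation \<Phi> :: "nat \<Rightarrow> real" where "\<Phi> k \<equiv> mean_unrequested (N k) (\<mu> * t) (x k)"

lemma \<Phi>_eq: "\<Phi> k = (LINT \<omega>|\<Omega>. exp (- (Y k \<omega> * \<tau> k)))"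
  by (subst expectation_Y) (simp_all add: mean_unrequested_def emp_mean_def unrequested_emp[OF N(1)])

lemma \<Phi>_bounds: "0 \<le> \<Phi> k" "\<Phi> k \<le> 1"
proof -
  have u: "unrequested (N k) (\<mu> * t) (x k) i \<le> 1" if "i \<in> {1..N k}" for i
    unfolding unrequested_emp[OF N(1)] using exp_\<tau>_le_1[OF x_nonneg[OF that]] .
  show "0 \<le> \<Phi> k" unfolding mean_unrequested_def unrequested_def by (simp add: sum_nonneg)
  have "(\<Sum>j=1..N k. unrequested (N k) (\<mu> * t) (x k) j) \<le> (\<Sum>j=1..N k. 1)" by (intro sum_mono u)
  thus "\<Phi> k \<le> 1" unfolding mean_unrequested_def using N(1)[of k] by (simp add: field_simps)
qed

lemma \<Phi>_lim: "\<Phi> \<longlonglongrightarrow> laplace P t"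
proof -
  have "(\<lambda>k. LINT \<omega>|\<Omega>. exp (- (Y k \<omega> * \<tau> k))) \<longlonglongrightarrow> (LINT \<omega>|\<Omega>. exp (- (Yl \<omega> * t)))"
  proof (rule integral_dominated_convergence[where w="\<lambda>_. 1"])
    show "AE \<omega> in \<Omega>. (\<lambda>k. exp (- (Y k \<omega> * \<tau> k))) \<longlonglongrightarrow> exp (- (Yl \<omega> * t))"
      by (intro AE_I2 tendsto_intros Y_lim \<tau>_lim)
    show "AE \<omega> in \<Omega>. norm (exp (- (Y k \<omega> * \<tau> k))) \<le> 1" for k
      using Y_nonneg[of k] by eventually_elim (use exp_\<tau>_le_1[of _ k] in simp)
  qed auto
  also have "(LINT \<omega>|\<Omega>. exp (- (Yl \<omega> * t))) = laplace P t"
    unfolding laplace_def by (subst expectation_Yl) (simp_all add: mult.commute)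
  finally show ?thesis unfolding \<Phi>_eq .
qed

lemma sum_popularity_emp:
  assumes [measurable]: "f \<in> borel_measurable borel"
  shows "(\<Sum>i=1..N k. popularity (N k) (x k) i * f (x k i)) = (LINT \<omega>|\<Omega>. Y k \<omega> * f (Y k \<omega>)) / m k"
proof -
  have "(\<Sum>i=1..N k. popularity (N k) (x k) i * f (x k i)) = emp_mean (N k) (\<lambda>y. y * f y) (x k) / m k"
    unfolding popularity_emp_mean[OF N(1)] unfolding emp_mean_def[of _ "\<lambda>y. y * f y"]
    by (simp add: sum_divide_distrib field_simps)
  also have "emp_mean (N k) (\<lambda>y. y * f y) (x k) = (LINT \<omega>|\<Omega>. Y k \<omega> * f (Y k \<omega>))"
    by (rule expectation_Y[symmetric]) measurable
  finally show ?thesis .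
qed

lemma first_moment_lim:
  "(\<lambda>k. \<Sum>i=1..N k. popularity (N k) (x k) i * unrequested (N k) (\<mu> * t) (x k) i) \<longlonglongrightarrow>
     (LINT y|P. y * exp (- (y * t))) / \<mu>"
proof -
  have "(\<lambda>k. LINT \<omega>|\<Omega>. Y k \<omega> * exp (- (Y k \<omega> * \<tau> k))) \<longlonglongrightarrow> (LINT \<omega>|\<Omega>. Yl \<omega> * exp (- (Yl \<omega> * t)))"
  proof (rule weighted_mean_lim)
    show "AE \<omega> in \<Omega>. \<bar>exp (- (Y k \<omega> * \<tau> k))\<bar> \<le> 1" for k
      using Y_nonneg[of k] by eventually_elim (use exp_\<tau>_le_1[of _ k] in simp)
    show "AE \<omega> in \<Omega>. 0 < Yl \<omega> \<longrightarrow> (\<lambda>k. exp (- (Y k \<omega> * \<tau> k))) \<longlonglongrightarrow> exp (- (Yl \<omega> * t))"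
      by (intro AE_I2 impI tendsto_intros Y_lim \<tau>_lim)
  qed measurable
  also have "(LINT \<omega>|\<Omega>. Yl \<omega> * exp (- (Yl \<omega> * t))) = (LINT y|P. y * exp (- (y * t)))"
    by (subst expectation_Yl[of "\<lambda>y. y * exp (- (y * t))"]) simp_all
  finally have "(\<lambda>k. (LINT \<omega>|\<Omega>. Y k \<omega> * exp (- (Y k \<omega> * \<tau> k))) / m k) \<longlonglongrightarrow> (LINT y|P. y * exp (- (y * t))) / \<mu>"
    by (intro tendsto_divide mean_lim \<mu>)
  thus ?thesis unfolding unrequested_emp[OF N(1)]
    by (subst sum_popularity_emp[of "\<lambda>y. exp (- (y * \<tau> k))" for k]) simp_all
qed

text \<open>The relations \<open>r\<close> and \<open>r0\<close> are orders, strict or not, in either direction: they have to agree in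
the limit only off the diagonal, which is a null set at every positive threshold unless \<open>l = 0\<close>, when
the comparison has no effect.\<close>

lemma comparison_cost_lim:
  assumes r [measurable]: "Measurable.pred (borel \<Otimes>\<^sub>M borel) (\<lambda>q. r (fst q) (snd q))"
    and r0 [measurable]: "Measurable.pred (borel \<Otimes>\<^sub>M borel) (\<lambda>q. r0 (fst q) (snd q))"
    and r_lim: "\<And>a b \<alpha> \<beta>. a \<longlonglongrightarrow> \<alpha> \<Longrightarrow> b \<longlonglongrightarrow> \<beta> \<Longrightarrow> \<alpha> \<noteq> \<beta> \<Longrightarrow>
      \<forall>\<^sub>F k in sequentially. r (a k) (b k) \<longleftrightarrow> r0 \<alpha> \<beta>"
    and atoms: "\<And>y. l \<noteq> 0 \<Longrightarrow> y > 0 \<Longrightarrow> measure P {y} = 0"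
  shows "(\<lambda>k. comparison_cost r (N k) (\<mu> * t) l (x k)) \<longlonglongrightarrow>
    (LINT y|P. y * (exp (- (y * t)) * exp (- l * (1 - laplace P t + (LINT z|P. of_bool (r0 z y) * exp (- (z * t))))))) / \<mu>"
proof -
  define g where "g = (\<lambda>k y. emp_mean (N k) (\<lambda>z. of_bool (r z y) * exp (- (z * \<tau> k))) (x k))"
  define gl where "gl = (\<lambda>y. LINT z|P. of_bool (r0 z y) * exp (- (z * t)))"
  have rs1 [measurable]: "Measurable.pred borel (\<lambda>z. r z y)" for y
    using measurable_compose[OF measurable_Pair2'[of y borel borel] r] by simp
  have rs2 [measurable]: "Measurable.pred borel (\<lambda>y. r z y)" for z
    using measurable_compose[OF measurable_Pair1'[of z borel borel] r] by simp
  have r0s1 [measurable]: "Measurable.pred borel (\<lambda>z. r0 z y)" for y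
    using measurable_compose[OF measurable_Pair2'[of y borel borel] r0] by simp
  have gm [measurable]: "g k \<in> borel_measurable borel" for k
    unfolding g_def emp_mean_def by measurable
  have g_eq: "g k y = (LINT \<omega>|\<Omega>. of_bool (r (Y k \<omega>) y) * exp (- (Y k \<omega> * \<tau> k)))" for k y
    unfolding g_def by (subst expectation_Y[of "\<lambda>z. of_bool (r z y) * exp (- (z * \<tau> k))"]) simp_all
  have gl_eq: "gl y = (LINT \<omega>|\<Omega>. of_bool (r0 (Yl \<omega>) y) * exp (- (Yl \<omega> * t)))" for y
    unfolding gl_def by (subst expectation_Yl[of "\<lambda>z. of_bool (r0 z y) * exp (- (z * t))"]) simp_all
  interpret L: prob_space "law_on_line P" using real_distribution_P[OF P] by (simp add: real_distribution_def)
  have glm [measurable]: "gl \<in> borel_measurable borel"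
  proof -
    have "gl = (\<lambda>y. LINT z|law_on_line P. of_bool (r0 z y) * exp (- (z * t)))"
      unfolding gl_def by (intro ext integral_law_on_line[OF P, symmetric]) measurable
    moreover have "(\<lambda>y. LINT z|law_on_line P. of_bool (r0 z y) * exp (- (z * t))) \<in> borel_measurable borel"
    proof (rule L.borel_measurable_lebesgue_integral)
      have sw: "(\<lambda>q. (snd q, fst q)) \<in> measurable (borel \<Otimes>\<^sub>M law_on_line P) (borel \<Otimes>\<^sub>M (borel :: real measure))"
        unfolding law_on_line_def by measurable
      have "Measurable.pred (borel \<Otimes>\<^sub>M law_on_line P) (\<lambda>q. r0 (snd q) (fst q))"
        using measurable_compose[OF sw r0] by simp
      moreover have "(\<lambda>q. exp (- (snd q * t))) \<in> borel_measurable (borel \<Otimes>\<^sub>M law_on_line P)"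
        unfolding law_on_line_def by measurable
      ultimately show "(\<lambda>(y, z). of_bool (r0 z y) * exp (- (z * t))) \<in> borel_measurable (borel \<Otimes>\<^sub>M law_on_line P)"
        unfolding case_prod_beta by measurable
    qed
    ultimately show ?thesis by simp
  qed
  have g0: "0 \<le> g k y" for k y
    unfolding g_def emp_mean_def by (intro divide_nonneg_nonneg sum_nonneg) auto
  \<comment> \<open>The cost is the mean of \<open>Y k * \<psi> k (Y k)\<close>, divided by the mean of \<open>Y k\<close>.\<close>
  define \<psi> where "\<psi> = (\<lambda>k y. exp (- (y * \<tau> k)) * exp (- l * (1 - \<Phi> k + g k y)))"
  define \<psi>l where "\<psi>l = (\<lambda>y. exp (- (y * t)) * exp (- l * (1 - laplace P t + gl y)))"
  have \<psi>m [measurable]: "\<psi> k \<in> borel_measurable borel" "\<psi>l \<in> borel_measurable borel" for k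
    unfolding \<psi>_def \<psi>l_def by measurable
  have conv: "(\<lambda>k. \<psi> k (Y k \<omega>)) \<longlonglongrightarrow> \<psi>l (Yl \<omega>)" if \<omega>: "\<omega> \<in> space \<Omega>" and pos: "0 < Yl \<omega>" for \<omega>
  proof -
    have "(\<lambda>k. l * g k (Y k \<omega>)) \<longlonglongrightarrow> l * gl (Yl \<omega>)"
    proof (cases "l = 0")
      case False
      \<comment> \<open>No mass sits at the threshold, so the two sides agree off a null set.\<close>
      have "measure (law_on_line P) {Yl \<omega>} = 0"
      proof -
        have "measure (law_on_line P) {Yl \<omega>} = measure P ((\<lambda>x. x) -` {Yl \<omega>} \<inter> space P)"
          unfolding law_on_line_def by (rule measure_distr[OF measurable_id_P[OF P]]) simp
        also have "(\<lambda>x. x) -` {Yl \<omega>} \<inter> space P = {Yl \<omega>}" using pos Rplus_prob_facts(3)[OF P] by auto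
        finally show ?thesis using atoms[OF False pos] by simp
      qed
      hence "AE y in law_on_line P. y \<notin> {Yl \<omega>}"
        by (intro AE_not_in null_setsI) (simp_all add: L.emeasure_eq_measure, simp add: law_on_line_def)
      hence ne: "AE \<omega>' in \<Omega>. Yl \<omega>' \<noteq> Yl \<omega>"
        using AE_distr_iff[OF Y_meas(2), of "\<lambda>y. y \<noteq> Yl \<omega>"] unfolding Y_law(2) by simp
      have "(\<lambda>k. g k (Y k \<omega>)) \<longlonglongrightarrow> gl (Yl \<omega>)"
        unfolding g_eq gl_eq
      proof (rule integral_dominated_convergence[where w="\<lambda>_. 1"])
        show "AE \<omega>' in \<Omega>. (\<lambda>k. of_bool (r (Y k \<omega>') (Y k \<omega>)) * exp (- (Y k \<omega>' * \<tau> k)))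
            \<longlonglongrightarrow> of_bool (r0 (Yl \<omega>') (Yl \<omega>)) * exp (- (Yl \<omega>' * t))"
          using ne AE_space
        proof eventually_elim
          case (elim \<omega>')
          have "\<forall>\<^sub>F k in sequentially. of_bool (r0 (Yl \<omega>') (Yl \<omega>)) = (of_bool (r (Y k \<omega>') (Y k \<omega>)) :: real)"
            using r_lim[OF Y_lim[OF elim(2)] Y_lim[OF \<omega>] elim(1)] by eventually_elim simp
          hence "(\<lambda>k. of_bool (r (Y k \<omega>') (Y k \<omega>)) :: real) \<longlonglongrightarrow> of_bool (r0 (Yl \<omega>') (Yl \<omega>))"
            by (rule Lim_transform_eventually[OF tendsto_const])
          thus ?case by (intro tendsto_intros Y_lim elim \<tau>_lim)
        qed
        show "AE \<omega>' in \<Omega>. norm (of_bool (r (Y k \<omega>') (Y k \<omega>)) * exp (- (Y k \<omega>' * \<tau> k))) \<le> 1" for k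
          using Y_nonneg[of k] by eventually_elim (use exp_\<tau>_le_1[of _ k] in auto)
      qed measurable
      thus ?thesis by (rule tendsto_mult_left)
    qed simp
    moreover have "(\<lambda>k. l * (1 - \<Phi> k)) \<longlonglongrightarrow> l * (1 - laplace P t)"
      by (intro tendsto_intros \<Phi>_lim)
    ultimately have "(\<lambda>k. exp (- (l * (1 - \<Phi> k) + l * g k (Y k \<omega>)))) \<longlonglongrightarrow>
       exp (- (l * (1 - laplace P t) + l * gl (Yl \<omega>)))"
      by (intro tendsto_exp tendsto_minus tendsto_add)
    moreover have "(\<lambda>k. exp (- (Y k \<omega> * \<tau> k))) \<longlonglongrightarrow> exp (- (Yl \<omega> * t))"
      by (intro tendsto_intros Y_lim \<omega> \<tau>_lim)
    ultimately have "(\<lambda>k. exp (- (Y k \<omega> * \<tau> k)) * exp (- (l * (1 - \<Phi> k) + l * g k (Y k \<omega>)))) \<longlonglongrightarrow>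
       exp (- (Yl \<omega> * t)) * exp (- (l * (1 - laplace P t) + l * gl (Yl \<omega>)))"
      by (intro tendsto_mult)
    thus ?thesis unfolding \<psi>_def \<psi>l_def by (simp add: distrib_left)
  qed
  have g_x: "g k (x k i) =
      (\<Sum>j=1..N k. of_bool (r (x k j) (x k i)) * unrequested (N k) (\<mu> * t) (x k) j) / real (N k)" for k i
    unfolding g_def unrequested_emp[OF N(1)] emp_mean_def ..
  have "(\<lambda>k. LINT \<omega>|\<Omega>. Y k \<omega> * \<psi> k (Y k \<omega>)) \<longlonglongrightarrow> (LINT \<omega>|\<Omega>. Yl \<omega> * \<psi>l (Yl \<omega>))"
  proof (rule weighted_mean_lim)
    show "AE \<omega> in \<Omega>. \<bar>\<psi> k (Y k \<omega>)\<bar> \<le> 1" for k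
      using Y_nonneg[of k]
    proof eventually_elim
      case (elim \<omega>)
      have "exp (- (Y k \<omega> * \<tau> k)) \<le> 1" using elim by (rule exp_\<tau>_le_1)
      moreover have "0 \<le> l * (1 - \<Phi> k + g k (Y k \<omega>))"
        using l \<Phi>_bounds(2)[of k] g0[of k "Y k \<omega>"] by (intro mult_nonneg_nonneg) auto
      hence "exp (- l * (1 - \<Phi> k + g k (Y k \<omega>))) \<le> 1" by simp
      ultimately show ?case unfolding \<psi>_def abs_mult by (intro mult_le_one) auto
    qed
    show "AE \<omega> in \<Omega>. 0 < Yl \<omega> \<longrightarrow> (\<lambda>k. \<psi> k (Y k \<omega>)) \<longlonglongrightarrow> \<psi>l (Yl \<omega>)"
      using conv by (intro AE_I2) auto
  qed measurable
  also have "(LINT \<omega>|\<Omega>. Yl \<omega> * \<psi>l (Yl \<omega>)) = (LINT y|P. y * \<psi>l y)"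
    by (subst expectation_Yl[of "\<lambda>y. y * \<psi>l y"]) simp_all
  finally have "(\<lambda>k. (LINT \<omega>|\<Omega>. Y k \<omega> * \<psi> k (Y k \<omega>)) / m k) \<longlonglongrightarrow> (LINT y|P. y * \<psi>l y) / \<mu>"
    by (intro tendsto_divide mean_lim \<mu>)
  moreover have "(LINT \<omega>|\<Omega>. Y k \<omega> * \<psi> k (Y k \<omega>)) / m k = comparison_cost r (N k) (\<mu> * t) l (x k)" for k
    unfolding comparison_cost_def sum_popularity_emp[OF \<psi>m(1), symmetric]
    unfolding \<psi>_def g_x unrequested_emp[OF N(1), of k "\<mu> * t" "x k", symmetric] ..
  ultimately show ?thesis unfolding \<psi>l_def gl_def by simp
qed

lemma averaged_cost_lim:
  "(\<lambda>k. averaged_cost (N k) (\<mu> * t) l (x k)) \<longlonglongrightarrow>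
    (LINT y|P. y * exp (- (y * t))) / \<mu> * exp (- l * (1 - laplace P t)) *
    (if l = 0 then 1 else (1 - exp (- l * laplace P t)) / (l * laplace P t))"
proof -
  have "(\<lambda>k. (\<Sum>i=1..N k. exp (- l * \<Phi> k * (real i / real (N k)))) / real (N k)) \<longlonglongrightarrow>
    (if l = 0 then 1 else (1 - exp (- l * laplace P t)) / (l * laplace P t))"
  proof (cases "l = 0")
    case True
    have "(\<Sum>i=1..N k. exp (- l * \<Phi> k * (real i / real (N k)))) / real (N k) = 1" for k
      using N(1)[of k] True by simp
    thus ?thesis using True by simp
  next
    case False
    have pos: "0 < laplace P t" by (rule laplace_pos[OF P t])
    have "(\<lambda>k. (\<Sum>i=1..N k. exp (- (l * \<Phi> k) * (real i / real (N k)))) / real (N k)) \<longlonglongrightarrow>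
      (1 - exp (- (l * laplace P t))) / (l * laplace P t)"
      using pos False l by (intro tendsto_exp_average N tendsto_intros \<Phi>_lim) auto
    thus ?thesis using False by simp
  qed
  thus ?thesis unfolding averaged_cost_def
    by (intro tendsto_mult first_moment_lim tendsto_exp tendsto_intros \<Phi>_lim)
qed

end

lemma coupling_exists:
  assumes P: "P \<in> space (prob_algebra Rplus)"
    and P_int: "integrable P (\<lambda>x. x)" and \<mu>: "\<mu> = (LINT x|P. x)" "\<mu> \<noteq> 0"
    and N: "\<And>k. N k \<ge> 1" "filterlim N at_top sequentially"
    and x: "\<And>k i. i \<in> {1..N k} \<Longrightarrow> 0 \<le> x k i"
    and weak: "weak_conv_m (\<lambda>k. emp_law (N k) (x k)) (law_on_line P)"
    and mean: "(\<lambda>k. emp_mean (N k) (\<lambda>y. y) (x k)) \<longlonglongrightarrow> (LINT x|P. x)"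
    and tl: "0 \<le> t" "0 \<le> l"
  shows "\<exists>\<Omega> Y Yl. coupling \<Omega> P N x Y Yl \<mu> t l"
proof -
  obtain \<Omega> :: "real measure" and Y :: "nat \<Rightarrow> real \<Rightarrow> real" and Yl where Y:
    "prob_space \<Omega>" "\<And>n. Y n \<in> measurable \<Omega> borel" "\<And>n. distr \<Omega> borel (Y n) = emp_law (N n) (x n)"
    "Yl \<in> measurable \<Omega> lborel" "distr \<Omega> borel Yl = law_on_line P"
    "\<And>\<omega>. \<omega> \<in> space \<Omega> \<Longrightarrow> (\<lambda>n. Y n \<omega>) \<longlonglongrightarrow> Yl \<omega>"
    using Skorohod[OF real_distribution_emp_law[OF N(1)] real_distribution_P[OF P] weak] by blast
  have "coupling \<Omega> P N x Y Yl \<mu> t l"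
  proof (intro coupling.intro coupling_axioms.intro Y(1) Y(6))
    show "Yl \<in> borel_measurable \<Omega>" using Y(4) by simp
    show "(\<lambda>k. emp_mean (N k) (\<lambda>y. y) (x k)) \<longlonglongrightarrow> \<mu>" using mean \<mu>(1) by simp
    show "0 \<le> t" by (rule tl(1))
    show "0 \<le> l" by (rule tl(2))
  qed (fact P P_int \<mu> N x Y)+
  thus ?thesis by blast
qed

section \<open>The exponential form of the cost\<close>

lemma exp_neg_lipschitz:
  fixes a b :: real
  assumes "0 \<le> a" "0 \<le> b"
  shows "\<bar>exp (- a) - exp (- b)\<bar> \<le> \<bar>a - b\<bar>"
proof -
  have *: "exp (- a) - exp (- b) \<le> b - a" if "0 \<le> a" "a \<le> b" for a b :: real
  proof -
    have "1 - exp (- (b - a)) \<le> b - a"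
      using exp_ge_add_one_self[of "- (b - a)"] by linarith
    hence "exp (- a) * (1 - exp (- (b - a))) \<le> 1 * (b - a)"
      using that by (intro mult_mono) auto
    moreover have "exp (- a) - exp (- b) = exp (- a) * (1 - exp (- (b - a)))"
      by (simp add: algebra_simps exp_add[symmetric])
    ultimately show ?thesis by simp
  qed
  show ?thesis using *[of a b] *[of b a] assms by (cases "a \<le> b") auto
qed

lemma exp_neg_le_quadratic:
  fixes y :: real
  assumes "0 \<le> y" shows "exp (- y) \<le> 1 - y + y\<^sup>2 / 2"
proof -
  have 1: "1 + y + y\<^sup>2 / 2 \<le> exp y" by (rule exp_lower_Taylor_quadratic[OF assms])
  have "0 < 1 + y + y\<^sup>2 / 2" using assms by (simp add: add_pos_nonneg)
  have "exp (- y) * (1 + y + y\<^sup>2 / 2) \<le> exp (- y) * exp y" by (intro mult_left_mono 1) simp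
  also have "\<dots> = 1" by (simp add: exp_add[symmetric])
  also have "1 \<le> (1 - y + y\<^sup>2 / 2) * (1 + y + y\<^sup>2 / 2)"
  proof -
    have "(1 - y + y\<^sup>2 / 2) * (1 + y + y\<^sup>2 / 2) = 1 + (y\<^sup>2 / 2)\<^sup>2"
      by (simp add: power2_eq_square algebra_simps)
    thus ?thesis by simp
  qed
  finally show ?thesis using \<open>0 < 1 + y + y\<^sup>2 / 2\<close> by (rule mult_right_le_imp_le)
qed

text \<open>The transform of a Bernoulli variable with mean \<open>u\<close> agrees with that of the constant \<open>u\<close> to first order.\<close>

lemma bernoulli_exp_diff:
  fixes a u :: real
  assumes "0 \<le> a" "0 \<le> u" "u \<le> 1"
  shows "\<bar>(1 - u * (1 - exp (- a))) - exp (- (a * u))\<bar> \<le> a\<^sup>2"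
proof -
  have au: "0 \<le> a * u" "a * u \<le> a" using assms by (simp_all add: mult_left_le)
  have "(a * u)\<^sup>2 \<le> a\<^sup>2" using au by (intro power_mono) auto
  moreover have "u * exp (- a) \<le> u * (1 - a + a\<^sup>2 / 2)"
    using assms by (intro mult_left_mono exp_neg_le_quadratic) auto
  moreover have "u * (1 - a) \<le> u * exp (- a)"
    using assms exp_ge_add_one_self[of "- a"] by (intro mult_left_mono) auto
  moreover have "exp (- (a * u)) \<le> 1 - a * u + (a * u)\<^sup>2 / 2" by (rule exp_neg_le_quadratic[OF au(1)])
  moreover have "1 - a * u \<le> exp (- (a * u))" using exp_ge_add_one_self[of "- (a * u)"] by simp
  moreover have "u * (a\<^sup>2 / 2) \<le> a\<^sup>2 / 2" using assms by (intro mult_left_le_one_le) auto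
  ultimately show ?thesis by (simp add: algebra_simps abs_le_iff)
qed

lemma unrequested_bounds:
  assumes "\<And>i. i \<in> {1..n} \<Longrightarrow> 0 \<le> x i" "0 \<le> c" "i \<in> {1..n}"
  shows "0 \<le> unrequested n c x i" "unrequested n c x i \<le> 1"
  using assms popularity_nonneg[of n x i] by (auto simp: unrequested_def)

lemma mean_unrequested_bounds:
  assumes "\<And>i. i \<in> {1..n} \<Longrightarrow> 0 \<le> x i" "0 \<le> c"
  shows "0 \<le> mean_unrequested n c x" "mean_unrequested n c x \<le> 1"
proof -
  show "0 \<le> mean_unrequested n c x"
    unfolding mean_unrequested_def unrequested_def by (simp add: sum_nonneg)
  have "(\<Sum>j=1..n. unrequested n c x j) \<le> (\<Sum>j=1..n. 1)"
    by (intro sum_mono unrequested_bounds assms)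
  thus "mean_unrequested n c x \<le> 1"
    unfolding mean_unrequested_def by (cases "n = 0") (simp_all add: field_simps)
qed

lemma sum_popularity_le_1: "(\<Sum>i=1..n. popularity n x i) \<le> 1"
  unfolding sum_popularity by simp

lemma popularity_weighted_bound:
  assumes x: "\<And>i. i \<in> {1..n} \<Longrightarrow> 0 \<le> x i" and b: "\<And>i. i \<in> {1..n} \<Longrightarrow> \<bar>b i\<bar> \<le> B" and B: "0 \<le> B"
  shows "\<bar>\<Sum>i=1..n. popularity n x i * b i\<bar> \<le> B"
proof -
  have "\<bar>\<Sum>i=1..n. popularity n x i * b i\<bar> \<le> (\<Sum>i=1..n. \<bar>popularity n x i * b i\<bar>)" by (rule sum_abs)
  also have "\<dots> \<le> (\<Sum>i=1..n. popularity n x i * B)"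
    using popularity_nonneg[OF x] b by (intro sum_mono) (auto simp: abs_mult intro: mult_left_mono)
  also have "\<dots> = (\<Sum>i=1..n. popularity n x i) * B" by (simp add: sum_distrib_right)
  also have "\<dots> \<le> 1 * B" by (intro mult_right_mono sum_popularity_le_1 B)
  finally show ?thesis by simp
qed

lemma cost_sum_diff:
  assumes n: "n \<ge> 1" and x: "\<And>i. i \<in> {1..n} \<Longrightarrow> 0 \<le> x i" and c: "0 \<le> c" and l: "0 \<le> l"
  defines "h \<equiv> unrequested n c x" and "a \<equiv> l / real n"
  shows "\<bar>(\<Sum>i=1..n. popularity n x i * (h i * exp (- a * real i) * (\<Prod>j\<in>{i<..n}. 1 - (1 - h j) * (1 - exp (- a))))) -
    exponential_cost n c l x\<bar> \<le> l\<^sup>2 / real n"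
proof -
  have h: "0 \<le> h i" "h i \<le> 1" if "i \<in> {1..n}" for i
    unfolding h_def using unrequested_bounds[OF x c that] by auto
  have a: "0 \<le> a" using l by (simp add: a_def)
  let ?p1 = "\<lambda>i. \<Prod>j\<in>{i<..n}. 1 - (1 - h j) * (1 - exp (- a))"
  let ?p2 = "\<lambda>i. \<Prod>j\<in>{i<..n}. exp (- (a * (1 - h j)))"
  have exponent: "exp (- l * (1 - mean_unrequested n c x + (\<Sum>j=1..i. h j) / real n)) = exp (- a * real i) * ?p2 i"
    if i: "i \<in> {1..n}" for i
  proof -
    have un: "{1..n} = {1..i} \<union> {i<..n}" using i by auto
    have "(\<Sum>j=1..n. h j) = (\<Sum>j=1..i. h j) + (\<Sum>j\<in>{i<..n}. h j)"
      unfolding un by (rule sum.union_disjoint) auto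
    moreover have "(\<Sum>j\<in>{i<..n}. 1 - h j) = real n - real i - (\<Sum>j\<in>{i<..n}. h j)"
      using i by (simp add: sum_subtractf of_nat_diff)
    ultimately have "1 - mean_unrequested n c x + (\<Sum>j=1..i. h j) / real n = (real i + (\<Sum>j\<in>{i<..n}. 1 - h j)) / real n"
      using n unfolding mean_unrequested_def h_def[symmetric] by (simp add: field_simps)
    hence "l * (1 - mean_unrequested n c x + (\<Sum>j=1..i. h j) / real n) = a * real i + (\<Sum>j\<in>{i<..n}. a * (1 - h j))"
      unfolding sum_distrib_left[symmetric] a_def by (simp add: add_divide_distrib distrib_left)
    thus ?thesis by (simp add: exp_sum[symmetric] exp_add[symmetric] sum_negf)
  qed
  have diff: "\<bar>h i * exp (- a * real i) * ?p1 i - h i * (exp (- a * real i) * ?p2 i)\<bar> \<le> l\<^sup>2 / real n" if i: "i \<in> {1..n}" for i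
  proof -
    have ij: "j \<in> {1..n}" if "j \<in> {i<..n}" for j using that i by auto
    have "norm (?p1 i - ?p2 i) \<le> (\<Sum>j\<in>{i<..n}. norm ((1 - (1 - h j) * (1 - exp (- a))) - exp (- (a * (1 - h j)))))"
    proof (rule norm_prod_diff)
      fix j assume "j \<in> {i<..n}"
      note hj = h[OF ij[OF this]]
      have "0 \<le> (1 - h j) * (1 - exp (- a))" "(1 - h j) * (1 - exp (- a)) \<le> 1"
        using hj a by (auto intro!: mult_nonneg_nonneg mult_le_one)
      thus "norm (1 - (1 - h j) * (1 - exp (- a))) \<le> 1" by simp
      show "norm (exp (- (a * (1 - h j)))) \<le> 1" using hj a by (simp add: mult_nonneg_nonneg)
    qed
    also have "\<dots> \<le> (\<Sum>j\<in>{i<..n}. a\<^sup>2)"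
    proof (rule sum_mono)
      fix j assume "j \<in> {i<..n}"
      note hj = h[OF ij[OF this]]
      show "norm ((1 - (1 - h j) * (1 - exp (- a))) - exp (- (a * (1 - h j)))) \<le> a\<^sup>2"
        unfolding real_norm_def using hj a by (intro bernoulli_exp_diff) auto
    qed
    also have "\<dots> \<le> real n * a\<^sup>2" by (simp add: mult_right_mono)
    also have "\<dots> = l\<^sup>2 / real n" using n by (simp add: a_def power2_eq_square)
    finally have p: "\<bar>?p1 i - ?p2 i\<bar> \<le> l\<^sup>2 / real n" by simp
    have "h i * exp (- a * real i) \<le> 1" using h[OF i] a by (intro mult_le_one) auto
    moreover have "0 \<le> h i * exp (- a * real i)" using h[OF i] by simp
    ultimately have "(h i * exp (- a * real i)) * \<bar>?p1 i - ?p2 i\<bar> \<le> 1 * (l\<^sup>2 / real n)"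
      by (intro mult_mono p) auto
    moreover have "h i * exp (- a * real i) * ?p1 i - h i * (exp (- a * real i) * ?p2 i) = (h i * exp (- a * real i)) * (?p1 i - ?p2 i)"
      by (simp add: algebra_simps)
    ultimately show ?thesis using h[OF i] by (simp add: abs_mult)
  qed
  have "exponential_cost n c l x = (\<Sum>i=1..n. popularity n x i * (h i * (exp (- a * real i) * ?p2 i)))"
    unfolding exponential_cost_def h_def[symmetric] by (intro sum.cong refl arg_cong2[where f="(*)"] exponent)
  hence "(\<Sum>i=1..n. popularity n x i * (h i * exp (- a * real i) * ?p1 i)) - exponential_cost n c l x =
      (\<Sum>i=1..n. popularity n x i * (h i * exp (- a * real i) * ?p1 i - h i * (exp (- a * real i) * ?p2 i)))"
    by (simp add: sum_subtractf right_diff_distrib)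
  also have "\<bar>\<dots>\<bar> \<le> l\<^sup>2 / real n" by (rule popularity_weighted_bound[OF x diff]) auto
  finally show ?thesis .
qed

lemma exponent_factor_bounds:
  assumes x: "\<And>i. i \<in> {1..n} \<Longrightarrow> 0 \<le> x i" and c: "0 \<le> c" and l: "0 \<le> l" and i: "i \<in> {1..n}" and g: "0 \<le> g"
  shows "0 \<le> unrequested n c x i * exp (- l * (1 - mean_unrequested n c x + g))"
    "unrequested n c x i * exp (- l * (1 - mean_unrequested n c x + g)) \<le> 1"
proof -
  have u: "0 \<le> unrequested n c x i" "unrequested n c x i \<le> 1" using unrequested_bounds[OF x c i] by auto
  have "0 \<le> l * (1 - mean_unrequested n c x + g)"
    using mean_unrequested_bounds[OF x c] l g by (intro mult_nonneg_nonneg) auto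
  hence e: "exp (- l * (1 - mean_unrequested n c x + g)) \<le> 1" by simp
  show "0 \<le> unrequested n c x i * exp (- l * (1 - mean_unrequested n c x + g))" using u by simp
  show "unrequested n c x i * exp (- l * (1 - mean_unrequested n c x + g)) \<le> 1"
    using u e by (intro mult_le_one) auto
qed

lemma sum_unrequested_nonneg: "0 \<le> (\<Sum>j\<in>A. unrequested n c x j) / real m"
  by (intro divide_nonneg_nonneg sum_nonneg) (auto simp: unrequested_def)

lemma exponential_cost_bounds:
  assumes x: "\<And>i. i \<in> {1..n} \<Longrightarrow> 0 \<le> x i" and c: "0 \<le> c" and l: "0 \<le> l"
  shows "0 \<le> exponential_cost n c l x \<and> exponential_cost n c l x \<le> 1"
proof
  note b = exponent_factor_bounds[OF x c l _ sum_unrequested_nonneg]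
  show "0 \<le> exponential_cost n c l x" unfolding exponential_cost_def
    by (intro sum_nonneg mult_nonneg_nonneg[OF popularity_nonneg b(1)] x)
  have "\<bar>exponential_cost n c l x\<bar> \<le> 1" unfolding exponential_cost_def
    by (rule popularity_weighted_bound[OF x]) (use b in auto)
  thus "exponential_cost n c l x \<le> 1" by simp
qed

lemma averaged_cost_bounds:
  assumes x: "\<And>i. i \<in> {1..n} \<Longrightarrow> 0 \<le> x i" and c: "0 \<le> c" and l: "0 \<le> l" and n: "n \<ge> 1"
  shows "0 \<le> averaged_cost n c l x \<and> averaged_cost n c l x \<le> 1"
proof -
  let ?Q = "\<Sum>i=1..n. popularity n x i * unrequested n c x i"
  let ?R = "(\<Sum>i=1..n. exp (- l * mean_unrequested n c x * (real i / real n))) / real n"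
  note u = unrequested_bounds[OF x c] and \<Phi> = mean_unrequested_bounds[OF x c]
  have Q: "0 \<le> ?Q" by (intro sum_nonneg mult_nonneg_nonneg popularity_nonneg x u)
  moreover have "\<bar>?Q\<bar> \<le> 1" by (rule popularity_weighted_bound[OF x]) (use u in auto)
  moreover have "exp (- l * (1 - mean_unrequested n c x)) \<le> 1" using l \<Phi> by simp
  moreover have R: "0 \<le> ?R" by (simp add: sum_nonneg)
  moreover have "?R \<le> 1"
  proof -
    have "(\<Sum>i=1..n. exp (- l * mean_unrequested n c x * (real i / real n))) \<le> (\<Sum>i=1..n. 1)"
    proof (rule sum_mono)
      fix i
      have "0 \<le> l * mean_unrequested n c x * (real i / real n)" using l \<Phi> by (intro mult_nonneg_nonneg) auto
      thus "exp (- l * mean_unrequested n c x * (real i / real n)) \<le> 1" by simp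
    qed
    thus ?thesis using n by (simp add: field_simps)
  qed
  ultimately show ?thesis unfolding averaged_cost_def
    by (intro conjI mult_nonneg_nonneg mult_le_one) auto
qed

text \<open>More objects in front make the exponential smaller.\<close>

lemma comparison_cost_le:
  assumes x: "\<And>i. i \<in> {1..n} \<Longrightarrow> 0 \<le> x i" and l: "0 \<le> l"
    and r: "\<And>i j. i \<in> {1..n} \<Longrightarrow> j \<in> {1..n} \<Longrightarrow> j \<le> i \<Longrightarrow> r (x j) (x i)"
  shows "comparison_cost r n c l x \<le> exponential_cost n c l x"
  unfolding comparison_cost_def exponential_cost_def
proof (intro sum_mono mult_left_mono)
  fix i assume i: "i \<in> {1..n}"
  have "(\<Sum>j=1..i. unrequested n c x j) = (\<Sum>j=1..i. of_bool (r (x j) (x i)) * unrequested n c x j)"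
    using i r[OF i] by (intro sum.cong) auto
  also have "\<dots> \<le> (\<Sum>j=1..n. of_bool (r (x j) (x i)) * unrequested n c x j)"
    using i by (intro sum_mono2) (auto simp: unrequested_def)
  finally have "(\<Sum>j=1..i. unrequested n c x j) / real n \<le> (\<Sum>j=1..n. of_bool (r (x j) (x i)) * unrequested n c x j) / real n"
    by (rule divide_right_mono) simp
  hence "l * (1 - mean_unrequested n c x + (\<Sum>j=1..i. unrequested n c x j) / real n)
     \<le> l * (1 - mean_unrequested n c x + (\<Sum>j=1..n. of_bool (r (x j) (x i)) * unrequested n c x j) / real n)"
    using l by (intro mult_left_mono) auto
  thus "exp (- l * (1 - mean_unrequested n c x + (\<Sum>j=1..n. of_bool (r (x j) (x i)) * unrequested n c x j) / real n))
     \<le> exp (- l * (1 - mean_unrequested n c x + (\<Sum>j=1..i. unrequested n c x j) / real n))" by simp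
qed (auto simp: unrequested_def intro!: popularity_nonneg x)

lemma comparison_cost_ge:
  assumes x: "\<And>i. i \<in> {1..n} \<Longrightarrow> 0 \<le> x i" and l: "0 \<le> l"
    and r: "\<And>i j. i \<in> {1..n} \<Longrightarrow> j \<in> {1..n} \<Longrightarrow> r (x j) (x i) \<Longrightarrow> j \<le> i"
  shows "exponential_cost n c l x \<le> comparison_cost r n c l x"
  unfolding comparison_cost_def exponential_cost_def
proof (intro sum_mono mult_left_mono)
  fix i assume i: "i \<in> {1..n}"
  have "(\<Sum>j=1..n. of_bool (r (x j) (x i)) * unrequested n c x j) = (\<Sum>j=1..i. of_bool (r (x j) (x i)) * unrequested n c x j)"
    using i r[OF i] by (intro sum.mono_neutral_right) auto
  also have "\<dots> \<le> (\<Sum>j=1..i. unrequested n c x j)"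
    by (intro sum_mono) (auto simp: unrequested_def)
  finally have "(\<Sum>j=1..n. of_bool (r (x j) (x i)) * unrequested n c x j) / real n \<le> (\<Sum>j=1..i. unrequested n c x j) / real n"
    by (rule divide_right_mono) simp
  hence "l * (1 - mean_unrequested n c x + (\<Sum>j=1..n. of_bool (r (x j) (x i)) * unrequested n c x j) / real n)
     \<le> l * (1 - mean_unrequested n c x + (\<Sum>j=1..i. unrequested n c x j) / real n)"
    using l by (intro mult_left_mono) auto
  thus "exp (- l * (1 - mean_unrequested n c x + (\<Sum>j=1..i. unrequested n c x j) / real n))
     \<le> exp (- l * (1 - mean_unrequested n c x + (\<Sum>j=1..n. of_bool (r (x j) (x i)) * unrequested n c x j) / real n))" by simp
qed (auto simp: unrequested_def intro!: popularity_nonneg x)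

section \<open>Exchangeable weights\<close>

lemma sum_inverse_sqrt_le: "(\<Sum>i=1..n. 1 / sqrt (real i)) \<le> 2 * sqrt (real n)"
proof (induction n)
  case (Suc n)
  have "1 / sqrt (real (Suc n)) \<le> 2 * (sqrt (real (Suc n)) - sqrt (real n))"
  proof -
    let ?a = "sqrt (real (Suc n))" and ?b = "sqrt (real n)"
    have a: "?a > 0" "?b \<le> ?a" "0 \<le> ?b" by simp_all
    have "(?a - ?b) * (?a + ?b) = 1" by (simp add: algebra_simps)
    moreover have "(?a - ?b) * (?a + ?b) \<le> (?a - ?b) * (2 * ?a)"
      using a by (intro mult_left_mono) auto
    ultimately have "1 \<le> (2 * (?a - ?b)) * ?a" by linarith
    thus ?thesis using a(1) by (subst divide_le_eq) (simp only: if_True)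
  qed
  thus ?case using Suc.IH by simp
qed simp

lemma popularity_permute:
  assumes "\<sigma> permutes {1..n}"
  shows "popularity n (\<lambda>i. x (\<sigma> i)) i = popularity n x (\<sigma> i)"
  unfolding popularity_def using sum.permute[OF assms, of x] by (simp add: o_def)

lemma popularity_cong:
  assumes "\<And>i. i \<in> {1..n} \<Longrightarrow> x i = y i" "i \<in> {1..n}"
  shows "popularity n x i = popularity n y i"
proof -
  have "(\<Sum>j=1..n. x j) = (\<Sum>j=1..n. y j)" by (intro sum.cong assms) auto
  thus ?thesis using assms by (simp add: popularity_def)
qed

locale exchangeable_weights = prob_space N for N :: "'a measure" +
  fixes n :: nat and v :: "nat \<Rightarrow> 'a \<Rightarrow> real" and c l :: real
  assumes n: "n \<ge> 1"
    and v_meas: "\<And>i. i \<in> {1..n} \<Longrightarrow> v i \<in> borel_measurable N"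
    and v_nonneg: "\<And>i \<omega>. i \<in> {1..n} \<Longrightarrow> \<omega> \<in> space N \<Longrightarrow> 0 \<le> v i \<omega>"
    and exch: "exchangeable N n v"
    and c: "0 \<le> c" and l: "0 \<le> l"
begin

abbreviation p :: "nat \<Rightarrow> 'a \<Rightarrow> real" where "p i \<omega> \<equiv> popularity n (\<lambda>l. v l \<omega>) i"
abbreviation h :: "nat \<Rightarrow> 'a \<Rightarrow> real" where "h i \<omega> \<equiv> unrequested n c (\<lambda>l. v l \<omega>) i"
abbreviation \<Phi> :: "'a \<Rightarrow> real" where "\<Phi> \<omega> \<equiv> mean_unrequested n c (\<lambda>l. v l \<omega>)"

lemma p_measurable [measurable]: "i \<in> {1..n} \<Longrightarrow> p i \<in> borel_measurable N"
  unfolding popularity_def using v_meas by measurable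

lemma h_measurable [measurable]: "i \<in> {1..n} \<Longrightarrow> h i \<in> borel_measurable N"
  unfolding unrequested_def using p_measurable by measurable

lemma \<Phi>_measurable [measurable]: "\<Phi> \<in> borel_measurable N"
  unfolding mean_unrequested_def by measurable

lemma p_bounds: assumes "\<omega> \<in> space N" "i \<in> {1..n}" shows "0 \<le> p i \<omega>" "p i \<omega> \<le> 1"
proof -
  have p0: "0 \<le> p i \<omega>" if "i \<in> {1..n}" for i using v_nonneg[OF _ assms(1)] that by (intro popularity_nonneg) auto
  have "p i \<omega> \<le> (\<Sum>j=1..n. p j \<omega>)" using assms by (intro member_le_sum p0) auto
  also have "\<dots> \<le> 1" by (rule sum_popularity_le_1)
  finally show "p i \<omega> \<le> 1" .
  show "0 \<le> p i \<omega>" by (rule p0[OF assms(2)])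
qed

lemma h_bounds:
  assumes "\<omega> \<in> space N" "i \<in> {1..n}" shows "0 \<le> h i \<omega>" "h i \<omega> \<le> 1"
  using unrequested_bounds[of n "\<lambda>i. v i \<omega>", OF _ c assms(2)] v_nonneg[OF _ assms(1)] by blast+

lemma \<Phi>_bounds:
  assumes "\<omega> \<in> space N" shows "0 \<le> \<Phi> \<omega>" "\<Phi> \<omega> \<le> 1"
  using mean_unrequested_bounds[of n "\<lambda>i. v i \<omega>", OF _ c] v_nonneg[OF _ assms(1)] by blast+

text \<open>The popularities are exchangeable as well, since their common denominator is a symmetric function of the weights.\<close>

lemma expectation_permute:
  assumes \<sigma>: "\<sigma> permutes {1..n}" and F: "F \<in> borel_measurable (\<Pi>\<^sub>M i\<in>{1..n}. borel)"
  shows "(LINT \<omega>|N. F (\<lambda>i\<in>{1..n}. p (\<sigma> i) \<omega>)) = (LINT \<omega>|N. F (\<lambda>i\<in>{1..n}. p i \<omega> :: real) :: real)"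
proof -
  let ?PM = "\<Pi>\<^sub>M i\<in>{1..n}. (borel :: real measure)"
  define G where "G = (\<lambda>x. F (\<lambda>i\<in>{1..n}. popularity n x i))"
  have "(\<lambda>x. \<lambda>i\<in>{1..n}. popularity n x i) \<in> measurable ?PM ?PM"
    unfolding popularity_def by measurable
  hence G: "G \<in> borel_measurable ?PM" unfolding G_def using F by measurable
  have s: "\<sigma> i \<in> {1..n}" if "i \<in> {1..n}" for i using that permutes_in_image[OF \<sigma>] by blast
  have m1: "weight_vector n (\<lambda>i. v (\<sigma> i)) \<in> measurable N ?PM" "weight_vector n v \<in> measurable N ?PM"
    unfolding weight_vector_def using v_meas s by measurable
  have "(LINT \<omega>|N. G (weight_vector n (\<lambda>i. v (\<sigma> i)) \<omega>)) = (LINT x|distr N ?PM (weight_vector n (\<lambda>i. v (\<sigma> i))). G x)"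
    by (rule integral_distr[symmetric, OF m1(1) G])
  also have "\<dots> = (LINT x|distr N ?PM (weight_vector n v). G x)"
    using exch \<sigma> unfolding exchangeable_def by simp
  also have "\<dots> = (LINT \<omega>|N. G (weight_vector n v \<omega>))"
    by (rule integral_distr[OF m1(2) G])
  finally have eq: "(LINT \<omega>|N. G (weight_vector n (\<lambda>i. v (\<sigma> i)) \<omega>)) = (LINT \<omega>|N. G (weight_vector n v \<omega>))" .
  have "G (weight_vector n (\<lambda>i. v (\<sigma> i)) \<omega>) = F (\<lambda>i\<in>{1..n}. p (\<sigma> i) \<omega>)" for \<omega>
    unfolding G_def
  proof (intro arg_cong[where f=F] restrict_ext)
    fix i assume i: "i \<in> {1..n}"
    have "popularity n (weight_vector n (\<lambda>i. v (\<sigma> i)) \<omega>) i = popularity n (\<lambda>i. v (\<sigma> i) \<omega>) i"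
      by (rule popularity_cong[OF _ i]) (simp add: weight_vector_def)
    thus "popularity n (weight_vector n (\<lambda>i. v (\<sigma> i)) \<omega>) i = p (\<sigma> i) \<omega>"
      using popularity_permute[OF \<sigma>, of "\<lambda>i. v i \<omega>"] by simp
  qed
  moreover have "G (weight_vector n v \<omega>) = F (\<lambda>i\<in>{1..n}. p i \<omega>)" for \<omega>
    unfolding G_def by (intro arg_cong[where f=F] restrict_ext popularity_cong) (simp add: weight_vector_def)
  ultimately show ?thesis using eq by simp
qed

text \<open>The functions \<open>h\<close> and \<open>\<Phi>\<close> expressed through the vector \<open>q\<close> of popularities, on which permutations act.\<close>

definition hq :: "(nat \<Rightarrow> real) \<Rightarrow> nat \<Rightarrow> real" where
  "hq q j = exp (- (q j * (real n * c)))"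

definition \<Phi>q :: "(nat \<Rightarrow> real) \<Rightarrow> real" where
  "\<Phi>q q = (\<Sum>j=1..n. hq q j) / real n"

lemma hq_measurable [measurable]: "j \<in> {1..n} \<Longrightarrow> (\<lambda>q. hq q j) \<in> borel_measurable (\<Pi>\<^sub>M i\<in>{1..n}. borel)"
  unfolding hq_def by measurable

lemma \<Phi>q_measurable [measurable]: "\<Phi>q \<in> borel_measurable (\<Pi>\<^sub>M i\<in>{1..n}. borel)"
  unfolding \<Phi>q_def by measurable

lemma hq_eq: "j \<in> {1..n} \<Longrightarrow> hq (\<lambda>i\<in>{1..n}. p (\<sigma> i) \<omega>) j = h (\<sigma> j) \<omega>"
  by (simp add: hq_def unrequested_def)

lemma \<Phi>q_eq: assumes "\<sigma> permutes {1..n}" shows "\<Phi>q (\<lambda>i\<in>{1..n}. p (\<sigma> i) \<omega>) = \<Phi> \<omega>"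
proof -
  have "\<Phi>q (\<lambda>i\<in>{1..n}. p (\<sigma> i) \<omega>) = (\<Sum>j=1..n. h (\<sigma> j) \<omega>) / real n"
    unfolding \<Phi>q_def by (intro arg_cong2[where f="(/)"] sum.cong refl hq_eq)
  also have "(\<Sum>j=1..n. h (\<sigma> j) \<omega>) = (\<Sum>j=1..n. h j \<omega>)"
    using sum.permute[OF assms, of "\<lambda>j. h j \<omega>"] by (simp add: o_def)
  finally show ?thesis unfolding mean_unrequested_def .
qed

text \<open>The mean \<open>\<Phi>\<close> is symmetric, so it is left unchanged by the permutation.\<close>

lemma expectation_permute':
  assumes \<sigma>: "\<sigma> permutes {1..n}"
    and F: "(\<lambda>q. F q (hq q) (\<Phi>q q)) \<in> borel_measurable (\<Pi>\<^sub>M i\<in>{1..n}. borel)"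
    and loc: "\<And>q q' u u' z. (\<And>i. i \<in> {1..n} \<Longrightarrow> q i = q' i) \<Longrightarrow> (\<And>i. i \<in> {1..n} \<Longrightarrow> u i = u' i) \<Longrightarrow> F q u z = F q' u' z"
  shows "(LINT \<omega>|N. F (\<lambda>i. p (\<sigma> i) \<omega>) (\<lambda>i. h (\<sigma> i) \<omega>) (\<Phi> \<omega>)) =
    (LINT \<omega>|N. (F (\<lambda>i. p i \<omega>) (\<lambda>i. h i \<omega>) (\<Phi> \<omega>) :: real))"
proof -
  let ?G = "\<lambda>q. F q (hq q) (\<Phi>q q)"
  have "?G (\<lambda>i\<in>{1..n}. p (\<sigma> i) \<omega>) = F (\<lambda>i. p (\<sigma> i) \<omega>) (\<lambda>i. h (\<sigma> i) \<omega>) (\<Phi> \<omega>)" for \<omega>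
    unfolding \<Phi>q_eq[OF \<sigma>] by (rule loc) (simp, rule hq_eq)
  moreover have "?G (\<lambda>i\<in>{1..n}. p i \<omega>) = F (\<lambda>i. p i \<omega>) (\<lambda>i. h i \<omega>) (\<Phi> \<omega>)" for \<omega>
    proof -
    have "\<Phi>q (\<lambda>i\<in>{1..n}. p i \<omega>) = \<Phi> \<omega>" using \<Phi>q_eq[OF permutes_id, of \<omega>] by simp
    moreover have "F (\<lambda>i\<in>{1..n}. p i \<omega>) (hq (\<lambda>i\<in>{1..n}. p i \<omega>)) z = F (\<lambda>i. p i \<omega>) (\<lambda>i. h i \<omega>) z" for z
      by (rule loc) (simp, simp add: hq_def unrequested_def)
    ultimately show ?thesis by simp
  qed
  ultimately show ?thesis using expectation_permute[OF \<sigma> F] by simp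
qed

text \<open>Deviations from the empirical mean; over all objects they add up to 0.\<close>

abbreviation D :: "nat \<Rightarrow> 'a \<Rightarrow> real" where "D j \<omega> \<equiv> h j \<omega> - \<Phi> \<omega>"
abbreviation S :: "nat \<Rightarrow> 'a \<Rightarrow> real" where "S i \<omega> \<equiv> (\<Sum>j=1..i. D j \<omega>)"

lemma D_bound: "\<omega> \<in> space N \<Longrightarrow> i \<in> {1..n} \<Longrightarrow> \<bar>D i \<omega>\<bar> \<le> 1"
  using h_bounds[of \<omega> i] \<Phi>_bounds[of \<omega>] by auto

lemma S_measurable: "i \<le> n \<Longrightarrow> S i \<in> borel_measurable N"
  by (intro borel_measurable_sum borel_measurable_diff h_measurable \<Phi>_measurable) auto

lemma S_bound: assumes "\<omega> \<in> space N" "i \<le> n" shows "\<bar>S i \<omega>\<bar> \<le> real n"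
proof -
  have "\<bar>S i \<omega>\<bar> \<le> (\<Sum>j=1..i. \<bar>D j \<omega>\<bar>)" by (rule sum_abs)
  also have "\<dots> \<le> (\<Sum>j=1..i. 1)" using assms by (intro sum_mono D_bound) auto
  finally show ?thesis using assms by simp
qed

lemma integrable_bounded:
  fixes f :: "'a \<Rightarrow> real"
  assumes "f \<in> borel_measurable N" "\<And>\<omega>. \<omega> \<in> space N \<Longrightarrow> \<bar>f \<omega>\<bar> \<le> B"
  shows "integrable N f"
  by (rule integrable_const_bound[where B=B]) (use assms in auto)

lemma S_n: "S n \<omega> = 0"
  using n by (simp add: sum_subtractf mean_unrequested_def)

lemma integrable_SD:
  assumes "i \<le> n" "k \<in> {1..n}" shows "integrable N (\<lambda>\<omega>. S i \<omega> * D k \<omega>)"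
proof (rule integrable_bounded)
  show "(\<lambda>\<omega>. S i \<omega> * D k \<omega>) \<in> borel_measurable N"
    using assms by (intro borel_measurable_times S_measurable borel_measurable_diff h_measurable \<Phi>_measurable)
  show "\<bar>S i \<omega> * D k \<omega>\<bar> \<le> real n * 1" if "\<omega> \<in> space N" for \<omega>
    unfolding abs_mult using that assms by (intro mult_mono S_bound D_bound) auto
qed

lemma integrable_SS:
  assumes "i \<le> n" shows "integrable N (\<lambda>\<omega>. (S i \<omega>)\<^sup>2)"
proof (rule integrable_bounded)
  show "(\<lambda>\<omega>. (S i \<omega>)\<^sup>2) \<in> borel_measurable N"
    using assms by (intro borel_measurable_power S_measurable)
  show "\<bar>(S i \<omega>)\<^sup>2\<bar> \<le> (real n)\<^sup>2" if "\<omega> \<in> space N" for \<omega>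
    using S_bound[OF that assms] by (simp add: abs_le_square_iff[symmetric])
qed

text \<open>By exchangeability all deviations beyond \<open>i\<close> have the same covariance with \<open>S i\<close>, and these deviations add up to \<open>- S i\<close>.\<close>

lemma covariance_nonpos:
  assumes i: "i < n"
  shows "(LINT \<omega>|N. S i \<omega> * D (Suc i) \<omega>) \<le> 0"
proof -
  have same: "(LINT \<omega>|N. S i \<omega> * D k \<omega>) = (LINT \<omega>|N. S i \<omega> * D (Suc i) \<omega>)" if k: "k \<in> {Suc i..n}" for k
  proof -
    let ?\<sigma> = "Transposition.transpose (Suc i) k"
    have \<sigma>: "?\<sigma> permutes {1..n}" using i k by (intro permutes_swap_id) auto
    have "(LINT \<omega>|N. (\<Sum>j=1..i. h (?\<sigma> j) \<omega> - \<Phi> \<omega>) * (h (?\<sigma> (Suc i)) \<omega> - \<Phi> \<omega>)) =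
        (LINT \<omega>|N. S i \<omega> * D (Suc i) \<omega>)"
    proof (rule expectation_permute'[OF \<sigma>, of "\<lambda>q u z. (\<Sum>j=1..i. u j - z) * (u (Suc i) - z)"])
      show "(\<lambda>q. (\<Sum>j=1..i. hq q j - \<Phi>q q) * (hq q (Suc i) - \<Phi>q q)) \<in> borel_measurable (\<Pi>\<^sub>M i\<in>{1..n}. borel)"
        using i by (intro borel_measurable_times borel_measurable_sum borel_measurable_diff hq_measurable \<Phi>q_measurable) auto
    qed (use i in \<open>auto intro!: arg_cong2[where f="(*)"] sum.cong\<close>)
    moreover have "(\<Sum>j=1..i. h (?\<sigma> j) \<omega> - \<Phi> \<omega>) = S i \<omega>" for \<omega>
      using k by (intro sum.cong) (auto simp: Transposition.transpose_def)
    ultimately show ?thesis by simp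
  qed
  have split: "{1..n} = {1..i} \<union> {Suc i..n}" using i by auto
  have tot: "(\<Sum>k=Suc i..n. D k \<omega>) = - S i \<omega>" for \<omega>
  proof -
    have "S n \<omega> = S i \<omega> + (\<Sum>k=Suc i..n. D k \<omega>)"
      unfolding split by (rule sum.union_disjoint) auto
    thus ?thesis using S_n[of \<omega>] by simp
  qed
  have "real (n - i) * (LINT \<omega>|N. S i \<omega> * D (Suc i) \<omega>) = (\<Sum>k=Suc i..n. LINT \<omega>|N. S i \<omega> * D (Suc i) \<omega>)"
    by simp
  also have "\<dots> = (\<Sum>k=Suc i..n. LINT \<omega>|N. S i \<omega> * D k \<omega>)"
    by (intro sum.cong refl same[symmetric])
  also have "\<dots> = (LINT \<omega>|N. (\<Sum>k=Suc i..n. S i \<omega> * D k \<omega>))"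
    using i by (intro Bochner_Integration.integral_sum[symmetric] integrable_SD) auto
  also have "\<dots> = (LINT \<omega>|N. - ((S i \<omega>)\<^sup>2))"
    unfolding sum_distrib_left[symmetric] tot by (simp add: power2_eq_square)
  also have "\<dots> \<le> 0" by (simp add: integral_nonneg_AE)
  finally show ?thesis using i by (simp add: mult_le_0_iff)
qed

lemma second_moment_le: "i \<le> n \<Longrightarrow> (LINT \<omega>|N. (S i \<omega>)\<^sup>2) \<le> real i"
proof (induction i)
  case (Suc i)
  have int: "integrable N (\<lambda>\<omega>. (D (Suc i) \<omega>)\<^sup>2)"
  proof (rule integrable_bounded)
    show "(\<lambda>\<omega>. (D (Suc i) \<omega>)\<^sup>2) \<in> borel_measurable N"
      using Suc.prems by (intro borel_measurable_power borel_measurable_diff h_measurable \<Phi>_measurable) auto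
    show "\<bar>(D (Suc i) \<omega>)\<^sup>2\<bar> \<le> 1" if "\<omega> \<in> space N" for \<omega>
      using D_bound[OF that, of "Suc i"] Suc.prems by (simp add: abs_square_le_1)
  qed
  have "(LINT \<omega>|N. (D (Suc i) \<omega>)\<^sup>2) \<le> (LINT \<omega>|N. 1)"
    by (intro integral_mono int) (use D_bound[of _ "Suc i"] Suc.prems in \<open>auto simp: abs_square_le_1\<close>)
  hence d: "(LINT \<omega>|N. (D (Suc i) \<omega>)\<^sup>2) \<le> 1" by (simp add: prob_space)
  have "(LINT \<omega>|N. (S (Suc i) \<omega>)\<^sup>2) = (LINT \<omega>|N. (S i \<omega>)\<^sup>2 + (2 * (S i \<omega> * D (Suc i) \<omega>) + (D (Suc i) \<omega>)\<^sup>2))"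
    by (intro Bochner_Integration.integral_cong refl) (simp add: power2_eq_square algebra_simps)
  also have "\<dots> = (LINT \<omega>|N. (S i \<omega>)\<^sup>2) + (2 * (LINT \<omega>|N. S i \<omega> * D (Suc i) \<omega>) + (LINT \<omega>|N. (D (Suc i) \<omega>)\<^sup>2))"
    using Suc.prems int integrable_SS[of i] integrable_SD[of i "Suc i"]
    by (subst Bochner_Integration.integral_add; simp)+
  also have "\<dots> \<le> real i + (2 * 0 + 1)"
    using Suc covariance_nonpos[of i] d by (intro add_mono mult_left_mono) auto
  finally show ?case by simp
qed simp

text \<open>The weight \<open>p i\<close> is not independent of the deviation, but \<open>S i\<close> is symmetric in the objects up to \<open>i\<close>.
So \<open>p i\<close> can be replaced by the average of \<open>p 1, \<dots>, p i\<close>, which is at most \<open>1 / i\<close>. The bound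
\<open>\<bar>S i\<bar> \<le> (sqrt i + (S i)^2 / sqrt i) / 2\<close> then brings in the second moment.\<close>

lemma weighted_deviation_le:
  assumes i: "i \<in> {1..n}"
  shows "(LINT \<omega>|N. p i \<omega> * \<bar>S i \<omega>\<bar>) \<le> 1 / sqrt (real i)"
proof -
  have i': "i \<le> n" "0 < i" using i by auto
  have int: "integrable N (\<lambda>\<omega>. p j \<omega> * \<bar>S i \<omega>\<bar>)" if j: "j \<in> {1..n}" for j
  proof (rule integrable_bounded)
    show "(\<lambda>\<omega>. p j \<omega> * \<bar>S i \<omega>\<bar>) \<in> borel_measurable N"
      by (intro borel_measurable_times p_measurable borel_measurable_abs S_measurable j i')
    show "\<bar>p j \<omega> * \<bar>S i \<omega>\<bar>\<bar> \<le> 1 * real n" if "\<omega> \<in> space N" for \<omega>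
      unfolding abs_mult abs_abs using p_bounds[OF that j] S_bound[OF that i'(1)] by (intro mult_mono) auto
  qed
  have same: "(LINT \<omega>|N. p j \<omega> * \<bar>S i \<omega>\<bar>) = (LINT \<omega>|N. p i \<omega> * \<bar>S i \<omega>\<bar>)" if j: "j \<in> {1..i}" for j
  proof -
    \<comment> \<open>This transposition permutes the first \<open>i\<close> objects among themselves and so preserves \<open>S i\<close>.\<close>
    let ?\<sigma> = "Transposition.transpose i j"
    have \<sigma>: "?\<sigma> permutes {1..n}" using i j by (intro permutes_swap_id) auto
    have \<sigma>i: "?\<sigma> permutes {1..i}" using i j by (intro permutes_swap_id) auto
    have "(LINT \<omega>|N. p (?\<sigma> i) \<omega> * \<bar>\<Sum>j=1..i. h (?\<sigma> j) \<omega> - \<Phi> \<omega>\<bar>) = (LINT \<omega>|N. p i \<omega> * \<bar>S i \<omega>\<bar>)"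
    proof (rule expectation_permute'[OF \<sigma>, of "\<lambda>q u z. q i * \<bar>\<Sum>j=1..i. u j - z\<bar>"])
      have "(\<lambda>q. q i) \<in> borel_measurable (\<Pi>\<^sub>M i\<in>{1..n}. (borel :: real measure))"
        by (rule measurable_component_singleton[OF i])
      thus "(\<lambda>q. q i * \<bar>\<Sum>j=1..i. hq q j - \<Phi>q q\<bar>) \<in> borel_measurable (\<Pi>\<^sub>M i\<in>{1..n}. borel)"
        using i by (intro borel_measurable_times borel_measurable_abs borel_measurable_sum borel_measurable_diff hq_measurable \<Phi>q_measurable) auto
    next
      fix q q' u u' :: "nat \<Rightarrow> real" and z
      assume e: "\<And>i. i \<in> {1..n} \<Longrightarrow> q i = q' i" "\<And>i. i \<in> {1..n} \<Longrightarrow> u i = u' i"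
      have "(\<Sum>j=1..i. u j - z) = (\<Sum>j=1..i. u' j - z)" using e(2) i by (intro sum.cong) auto
      thus "q i * \<bar>\<Sum>j=1..i. u j - z\<bar> = q' i * \<bar>\<Sum>j=1..i. u' j - z\<bar>" using e(1)[OF i] by simp
    qed
    moreover have "(\<Sum>j=1..i. h (?\<sigma> j) \<omega> - \<Phi> \<omega>) = S i \<omega>" for \<omega>
      using sum.permute[OF \<sigma>i, of "\<lambda>j. D j \<omega>"] by (simp add: o_def)
    ultimately show ?thesis by simp
  qed
  have "real i * (LINT \<omega>|N. p i \<omega> * \<bar>S i \<omega>\<bar>) = (\<Sum>j=1..i. LINT \<omega>|N. p i \<omega> * \<bar>S i \<omega>\<bar>)"
    by simp
  also have "\<dots> = (\<Sum>j=1..i. LINT \<omega>|N. p j \<omega> * \<bar>S i \<omega>\<bar>)"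
    by (intro sum.cong refl same[symmetric])
  also have "\<dots> = (LINT \<omega>|N. (\<Sum>j=1..i. p j \<omega> * \<bar>S i \<omega>\<bar>))"
    using i' by (intro Bochner_Integration.integral_sum[symmetric] int) auto
  also have "\<dots> \<le> (LINT \<omega>|N. (sqrt (real i) + (S i \<omega>)\<^sup>2 / sqrt (real i)) / 2)"
  proof (rule integral_mono)
    show "integrable N (\<lambda>\<omega>. \<Sum>j=1..i. p j \<omega> * \<bar>S i \<omega>\<bar>)"
      using i' by (intro Bochner_Integration.integrable_sum int) auto
    show "integrable N (\<lambda>\<omega>. (sqrt (real i) + (S i \<omega>)\<^sup>2 / sqrt (real i)) / 2)"
      using integrable_SS[OF i'(1)] by simp
    fix \<omega> assume \<omega>: "\<omega> \<in> space N"
    have "(\<Sum>j=1..i. p j \<omega>) \<le> (\<Sum>j=1..n. p j \<omega>)"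
      using i' p_bounds[OF \<omega>] by (intro sum_mono2) auto
    also have "\<dots> \<le> 1" by (rule sum_popularity_le_1)
    finally have "(\<Sum>j=1..i. p j \<omega>) * \<bar>S i \<omega>\<bar> \<le> 1 * \<bar>S i \<omega>\<bar>" by (intro mult_right_mono) auto
    also have "1 * \<bar>S i \<omega>\<bar> \<le> (sqrt (real i) + (S i \<omega>)\<^sup>2 / sqrt (real i)) / 2"
    proof -
      have s: "sqrt (real i) > 0" using i' by simp
      have "0 \<le> (\<bar>S i \<omega>\<bar> - sqrt (real i))\<^sup>2" by simp
      hence "2 * \<bar>S i \<omega>\<bar> * sqrt (real i) \<le> (S i \<omega>)\<^sup>2 + sqrt (real i) * sqrt (real i)"
        unfolding power2_diff by (simp add: mult_ac)
      thus ?thesis using s by (simp add: field_simps)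
    qed
    finally show "(\<Sum>j=1..i. p j \<omega> * \<bar>S i \<omega>\<bar>) \<le> (sqrt (real i) + (S i \<omega>)\<^sup>2 / sqrt (real i)) / 2"
      by (simp add: sum_distrib_right)
  qed
  also have "\<dots> = (sqrt (real i) + (LINT \<omega>|N. (S i \<omega>)\<^sup>2) / sqrt (real i)) / 2"
    using integrable_SS[OF i'(1)] by (simp add: prob_space)
  also have "\<dots> \<le> (sqrt (real i) + real i / sqrt (real i)) / 2"
    using second_moment_le[OF i'(1)] by (intro divide_right_mono add_left_mono) auto
  also have "\<dots> = sqrt (real i)" using i' by (simp add: real_div_sqrt)
  finally have "(LINT \<omega>|N. p i \<omega> * \<bar>S i \<omega>\<bar>) \<le> sqrt (real i) / real i"
    using i' by (simp add: field_simps)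
  also have "\<dots> = 1 / sqrt (real i)" using i' by (simp add: field_simps)
  finally show ?thesis .
qed

text \<open>The bounds of \<open>weighted_deviation_le\<close> add up to at most \<open>2 * sqrt n\<close>, and the Lipschitz bound for the
exponential contributes the factor \<open>l / n\<close>.\<close>

lemma exponential_cost_averaged:
  "\<bar>(LINT \<omega>|N. exponential_cost n c l (\<lambda>i. v i \<omega>)) - (LINT \<omega>|N. averaged_cost n c l (\<lambda>i. v i \<omega>))\<bar> \<le> 2 * l / sqrt (real n)"
proof -
  define e where "e = (\<lambda>i \<omega>. exp (- l * (1 - \<Phi> \<omega> + (\<Sum>j=1..i. h j \<omega>) / real n)))"
  define f where "f = (\<lambda>i z. exp (- l * (1 - z)) * exp (- l * z * (real i / real n)))"
  have fm [measurable]: "f i \<in> borel_measurable borel" for i unfolding f_def by measurable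
  have em: "e i \<in> borel_measurable N" if "i \<in> {1..n}" for i
  proof -
    have "(\<lambda>\<omega>. \<Sum>j=1..i. h j \<omega>) \<in> borel_measurable N"
      using that by (intro borel_measurable_sum h_measurable) auto
    thus ?thesis unfolding e_def by measurable
  qed
  have e01: "0 \<le> e i \<omega>" "e i \<omega> \<le> 1" if "\<omega> \<in> space N" for i \<omega>
  proof -
    have "0 \<le> l * (1 - \<Phi> \<omega> + (\<Sum>j=1..i. h j \<omega>) / real n)"
      using \<Phi>_bounds[OF that] l sum_unrequested_nonneg by (intro mult_nonneg_nonneg add_nonneg_nonneg) auto
    thus "e i \<omega> \<le> 1" by (simp add: e_def)
  qed (simp add: e_def)
  have f01: "0 \<le> f i (\<Phi> \<omega>)" "f i (\<Phi> \<omega>) \<le> 1" if "\<omega> \<in> space N" for i \<omega>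
  proof -
    have "0 \<le> l * \<Phi> \<omega> * (real i / real n)" using \<Phi>_bounds[OF that] l by (intro mult_nonneg_nonneg) auto
    thus "f i (\<Phi> \<omega>) \<le> 1" unfolding f_def using \<Phi>_bounds[OF that] l by (intro mult_le_one) auto
  qed (simp add: f_def)
  have int: "integrable N (\<lambda>\<omega>. p i \<omega> * (h j \<omega> * g \<omega>))"
    if "i \<in> {1..n}" "j \<in> {1..n}" "g \<in> borel_measurable N" "\<And>\<omega>. \<omega> \<in> space N \<Longrightarrow> \<bar>g \<omega>\<bar> \<le> 1" for i j g
  proof (rule integrable_bounded)
    show "(\<lambda>\<omega>. p i \<omega> * (h j \<omega> * g \<omega>)) \<in> borel_measurable N"
      by (intro borel_measurable_times p_measurable h_measurable that)
    show "\<bar>p i \<omega> * (h j \<omega> * g \<omega>)\<bar> \<le> 1" if "\<omega> \<in> space N" for \<omega>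
      unfolding abs_mult using p_bounds[OF that \<open>i \<in> _\<close>] h_bounds[OF that \<open>j \<in> _\<close>] \<open>\<And>\<omega>. \<omega> \<in> space N \<Longrightarrow> \<bar>g \<omega>\<bar> \<le> 1\<close>[OF that]
      by (intro mult_le_one) auto
  qed
  have inte: "integrable N (\<lambda>\<omega>. p i \<omega> * (h i \<omega> * e i \<omega>))" if "i \<in> {1..n}" for i
    using e01 by (intro int em that) auto
  have intf: "integrable N (\<lambda>\<omega>. p i \<omega> * (h i \<omega> * f j (\<Phi> \<omega>)))" if "i \<in> {1..n}" for i j
    using f01 by (intro int that measurable_compose[OF \<Phi>_measurable fm]) auto

  have avg: "(LINT \<omega>|N. averaged_cost n c l (\<lambda>i. v i \<omega>)) = (\<Sum>i=1..n. LINT \<omega>|N. p i \<omega> * (h i \<omega> * f i (\<Phi> \<omega>)))"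
  proof -
    have same: "(LINT \<omega>|N. p j \<omega> * (h j \<omega> * f i (\<Phi> \<omega>))) = (LINT \<omega>|N. p i \<omega> * (h i \<omega> * f i (\<Phi> \<omega>)))"
      if ij: "i \<in> {1..n}" "j \<in> {1..n}" for i j
    proof -
      let ?\<sigma> = "Transposition.transpose i j"
      have \<sigma>: "?\<sigma> permutes {1..n}" using ij by (intro permutes_swap_id) auto
      have "(LINT \<omega>|N. p (?\<sigma> i) \<omega> * (h (?\<sigma> i) \<omega> * f i (\<Phi> \<omega>))) = (LINT \<omega>|N. p i \<omega> * (h i \<omega> * f i (\<Phi> \<omega>)))"
      proof (rule expectation_permute'[OF \<sigma>, of "\<lambda>q u z. q i * (u i * f i z)"])
        have "(\<lambda>q. q i) \<in> borel_measurable (\<Pi>\<^sub>M i\<in>{1..n}. (borel :: real measure))"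
          by (rule measurable_component_singleton[OF ij(1)])
        thus "(\<lambda>q. q i * (hq q i * f i (\<Phi>q q))) \<in> borel_measurable (\<Pi>\<^sub>M i\<in>{1..n}. borel)"
          by (intro borel_measurable_times hq_measurable ij measurable_compose[OF \<Phi>q_measurable fm])
      qed (use ij in simp)
      thus ?thesis by simp
    qed
    have "averaged_cost n c l (\<lambda>i. v i \<omega>) = (\<Sum>i=1..n. (\<Sum>j=1..n. p j \<omega> * (h j \<omega> * f i (\<Phi> \<omega>))) / real n)" for \<omega>
      unfolding averaged_cost_def f_def sum_divide_distrib[symmetric] times_divide_eq_right
      by (simp add: sum_product sum_distrib_right sum_distrib_left mult_ac) (rule disjI2, rule sum.swap)
    hence "(LINT \<omega>|N. averaged_cost n c l (\<lambda>i. v i \<omega>)) =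
       (LINT \<omega>|N. (\<Sum>i=1..n. (\<Sum>j=1..n. p j \<omega> * (h j \<omega> * f i (\<Phi> \<omega>))) / real n))"
      by (rule Bochner_Integration.integral_cong[OF refl])
    also have "\<dots> = (\<Sum>i=1..n. LINT \<omega>|N. (\<Sum>j=1..n. p j \<omega> * (h j \<omega> * f i (\<Phi> \<omega>))) / real n)"
      by (intro Bochner_Integration.integral_sum integrable_divide_zero Bochner_Integration.integrable_sum intf)
    also have "\<dots> = (\<Sum>i=1..n. (\<Sum>j=1..n. LINT \<omega>|N. p j \<omega> * (h j \<omega> * f i (\<Phi> \<omega>))) / real n)"
      unfolding integral_divide_zero
      by (intro sum.cong refl arg_cong2[where f="(/)"] Bochner_Integration.integral_sum intf)
    also have "\<dots> = (\<Sum>i=1..n. LINT \<omega>|N. p i \<omega> * (h i \<omega> * f i (\<Phi> \<omega>)))"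
    proof (rule sum.cong[OF refl])
      fix i assume i: "i \<in> {1..n}"
      have "(\<Sum>j=1..n. LINT \<omega>|N. p j \<omega> * (h j \<omega> * f i (\<Phi> \<omega>))) = (\<Sum>j=1..n. LINT \<omega>|N. p i \<omega> * (h i \<omega> * f i (\<Phi> \<omega>)))"
        by (intro sum.cong refl same i)
      thus "(\<Sum>j=1..n. LINT \<omega>|N. p j \<omega> * (h j \<omega> * f i (\<Phi> \<omega>))) / real n = (LINT \<omega>|N. p i \<omega> * (h i \<omega> * f i (\<Phi> \<omega>)))"
        using n by simp
    qed
    finally show ?thesis .
  qed
  have ex: "(LINT \<omega>|N. exponential_cost n c l (\<lambda>i. v i \<omega>)) = (\<Sum>i=1..n. LINT \<omega>|N. p i \<omega> * (h i \<omega> * e i \<omega>))"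
    unfolding exponential_cost_def
    using Bochner_Integration.integral_sum[of "{1..n}" N "\<lambda>i \<omega>. p i \<omega> * (h i \<omega> * e i \<omega>)", OF inte]
    unfolding e_def .
  have term_le: "\<bar>(LINT \<omega>|N. p i \<omega> * (h i \<omega> * e i \<omega>)) - (LINT \<omega>|N. p i \<omega> * (h i \<omega> * f i (\<Phi> \<omega>)))\<bar> \<le> l / real n * (1 / sqrt (real i))"
    if i: "i \<in> {1..n}" for i
  proof -
    have i': "i \<le> n" using i by simp
    have "\<bar>(LINT \<omega>|N. p i \<omega> * (h i \<omega> * e i \<omega>)) - (LINT \<omega>|N. p i \<omega> * (h i \<omega> * f i (\<Phi> \<omega>)))\<bar> =
       \<bar>LINT \<omega>|N. p i \<omega> * (h i \<omega> * e i \<omega>) - p i \<omega> * (h i \<omega> * f i (\<Phi> \<omega>))\<bar>"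
      by (simp add: inte[OF i] intf[OF i])
    also have "\<dots> \<le> (LINT \<omega>|N. \<bar>p i \<omega> * (h i \<omega> * e i \<omega>) - p i \<omega> * (h i \<omega> * f i (\<Phi> \<omega>))\<bar>)"
      by (rule integral_abs_bound)
    also have "\<dots> \<le> (LINT \<omega>|N. l / real n * (p i \<omega> * \<bar>S i \<omega>\<bar>))"
    proof (rule integral_mono)
      show "integrable N (\<lambda>\<omega>. \<bar>p i \<omega> * (h i \<omega> * e i \<omega>) - p i \<omega> * (h i \<omega> * f i (\<Phi> \<omega>))\<bar>)"
        by (intro integrable_abs Bochner_Integration.integrable_diff inte intf i)
      have "integrable N (\<lambda>\<omega>. p i \<omega> * \<bar>S i \<omega>\<bar>)"
      proof (rule integrable_bounded)
        show "(\<lambda>\<omega>. p i \<omega> * \<bar>S i \<omega>\<bar>) \<in> borel_measurable N"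
          by (intro borel_measurable_times p_measurable borel_measurable_abs S_measurable i i')
        show "\<bar>p i \<omega> * \<bar>S i \<omega>\<bar>\<bar> \<le> 1 * real n" if "\<omega> \<in> space N" for \<omega>
          unfolding abs_mult abs_abs using p_bounds[OF that i] S_bound[OF that i'] by (intro mult_mono) auto
      qed
      thus "integrable N (\<lambda>\<omega>. l / real n * (p i \<omega> * \<bar>S i \<omega>\<bar>))" by (rule integrable_mult_right)
      fix \<omega> assume \<omega>: "\<omega> \<in> space N"
      have "l * (1 - \<Phi> \<omega> + (\<Sum>j=1..i. h j \<omega>) / real n) - (l * (1 - \<Phi> \<omega>) + l * \<Phi> \<omega> * (real i / real n)) = l / real n * S i \<omega>"
        using n by (simp add: sum_subtractf field_simps)
      moreover have "\<bar>e i \<omega> - f i (\<Phi> \<omega>)\<bar> \<le> \<bar>l * (1 - \<Phi> \<omega> + (\<Sum>j=1..i. h j \<omega>) / real n) - (l * (1 - \<Phi> \<omega>) + l * \<Phi> \<omega> * (real i / real n))\<bar>"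
      proof -
        have "f i (\<Phi> \<omega>) = exp (- (l * (1 - \<Phi> \<omega>) + l * \<Phi> \<omega> * (real i / real n)))"
          unfolding f_def by (simp add: exp_add[symmetric])
        moreover have "e i \<omega> = exp (- (l * (1 - \<Phi> \<omega> + (\<Sum>j=1..i. h j \<omega>) / real n)))"
          unfolding e_def by simp
        ultimately show ?thesis using \<Phi>_bounds[OF \<omega>] l sum_unrequested_nonneg
          by (simp only:) (intro exp_neg_lipschitz mult_nonneg_nonneg add_nonneg_nonneg; simp)
      qed
      ultimately have ef: "\<bar>e i \<omega> - f i (\<Phi> \<omega>)\<bar> \<le> l / real n * \<bar>S i \<omega>\<bar>" using l by (simp add: abs_mult)
      have "\<bar>p i \<omega> * (h i \<omega> * e i \<omega>) - p i \<omega> * (h i \<omega> * f i (\<Phi> \<omega>))\<bar> = p i \<omega> * (h i \<omega> * \<bar>e i \<omega> - f i (\<Phi> \<omega>)\<bar>)"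
        using p_bounds[OF \<omega> i] h_bounds[OF \<omega> i] by (simp add: right_diff_distrib[symmetric] abs_mult)
      also have "\<dots> \<le> p i \<omega> * (1 * (l / real n * \<bar>S i \<omega>\<bar>))"
        using p_bounds[OF \<omega> i] h_bounds[OF \<omega> i] ef by (intro mult_left_mono mult_mono) auto
      finally show "\<bar>p i \<omega> * (h i \<omega> * e i \<omega>) - p i \<omega> * (h i \<omega> * f i (\<Phi> \<omega>))\<bar> \<le> l / real n * (p i \<omega> * \<bar>S i \<omega>\<bar>)"
        by (simp add: mult_ac)
    qed
    also have "\<dots> = l / real n * (LINT \<omega>|N. p i \<omega> * \<bar>S i \<omega>\<bar>)" by simp
    also have "\<dots> \<le> l / real n * (1 / sqrt (real i))"
      using l by (intro mult_left_mono weighted_deviation_le i) auto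
    finally show ?thesis .
  qed
  have "\<bar>(LINT \<omega>|N. exponential_cost n c l (\<lambda>i. v i \<omega>)) - (LINT \<omega>|N. averaged_cost n c l (\<lambda>i. v i \<omega>))\<bar> \<le>
    (\<Sum>i=1..n. \<bar>(LINT \<omega>|N. p i \<omega> * (h i \<omega> * e i \<omega>)) - (LINT \<omega>|N. p i \<omega> * (h i \<omega> * f i (\<Phi> \<omega>)))\<bar>)"
    unfolding ex avg sum_subtractf[symmetric] by (rule sum_abs)
  also have "\<dots> \<le> (\<Sum>i=1..n. l / real n * (1 / sqrt (real i)))" by (intro sum_mono term_le)
  also have "\<dots> = l / real n * (\<Sum>i=1..n. 1 / sqrt (real i))" by (simp add: sum_distrib_left)
  also have "\<dots> \<le> l / real n * (2 * sqrt (real n))"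
    using l by (intro mult_left_mono sum_inverse_sqrt_le) auto
  also have "\<dots> = 2 * l / sqrt (real n)" using n by (simp add: field_simps)
  finally show ?thesis .
qed

end

section \<open>The three limits\<close>

lemma popularity_scale: "0 < z \<Longrightarrow> popularity n (\<lambda>i. z * x i) = popularity n x"
  by (rule ext) (simp add: popularity_def sum_distrib_left[symmetric])

lemma cost_scale:
  assumes "0 < z"
  shows "exponential_cost n c l (\<lambda>i. z * x i) = exponential_cost n c l x"
    "averaged_cost n c l (\<lambda>i. z * x i) = averaged_cost n c l x"
  unfolding exponential_cost_def averaged_cost_def mean_unrequested_def unrequested_def popularity_scale[OF assms]
  by (rule refl)+

lemma cost_measurable:
  assumes "\<And>i. i \<in> {1..n} \<Longrightarrow> v i \<in> borel_measurable N"
  shows "(\<lambda>\<omega>. exponential_cost n c l (\<lambda>i. v i \<omega>)) \<in> borel_measurable N"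
    "(\<lambda>\<omega>. averaged_cost n c l (\<lambda>i. v i \<omega>)) \<in> borel_measurable N"
proof -
  have p [measurable]: "(\<lambda>\<omega>. popularity n (\<lambda>l. v l \<omega>) i) \<in> borel_measurable N" if "i \<in> {1..n}" for i
    unfolding popularity_def using assms that by measurable
  have h [measurable]: "(\<lambda>\<omega>. unrequested n c (\<lambda>l. v l \<omega>) i) \<in> borel_measurable N" if "i \<in> {1..n}" for i
    unfolding unrequested_def using p[OF that] by measurable
  have [measurable]: "(\<lambda>\<omega>. mean_unrequested n c (\<lambda>l. v l \<omega>)) \<in> borel_measurable N"
    unfolding mean_unrequested_def by measurable
  have [measurable]: "(\<lambda>\<omega>. \<Sum>j=1..i. unrequested n c (\<lambda>l. v l \<omega>) j) \<in> borel_measurable N" if "i \<in> {1..n}" for i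
    using that by (intro borel_measurable_sum h) auto
  show "(\<lambda>\<omega>. exponential_cost n c l (\<lambda>i. v i \<omega>)) \<in> borel_measurable N"
    unfolding exponential_cost_def by measurable
  show "(\<lambda>\<omega>. averaged_cost n c l (\<lambda>i. v i \<omega>)) \<in> borel_measurable N"
    unfolding averaged_cost_def by measurable
qed

lemma (in poisson_requests) out_transform_exponential_cost:
  assumes n: "n \<ge> 1" and c: "0 \<le> c" and l: "0 \<le> l"
  shows "\<bar>out_transform N n id T (real n * c) (l / real n) -
     (LINT \<omega>|N. exponential_cost n c l (\<lambda>i. v i \<omega>))\<bar> \<le> l\<^sup>2 / real n"
proof -
  let ?H = "\<lambda>\<omega>. (\<Sum>i=1..n. p i \<omega> * (unreq (real n * c) i \<omega> * exp (- (l / real n) * real i) *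
     (\<Prod>j\<in>{i<..n}. 1 - (1 - unreq (real n * c) j \<omega>) * (1 - exp (- (l / real n))))))"
  let ?E = "\<lambda>\<omega>. exponential_cost n c l (\<lambda>i. v i \<omega>)"
  have diff: "\<bar>?H \<omega> - ?E \<omega>\<bar> \<le> l\<^sup>2 / real n" if "\<omega> \<in> space N" for \<omega>
    using cost_sum_diff[OF n _ c l, of "\<lambda>i. v i \<omega>"] v_nonneg[OF _ that] unfolding unrequested_def by blast
  have E01: "0 \<le> ?E \<omega> \<and> ?E \<omega> \<le> 1" if "\<omega> \<in> space N" for \<omega>
    using v_nonneg[OF _ that] by (intro exponential_cost_bounds c l)
  have Em: "?E \<in> borel_measurable N" by (intro cost_measurable v_meas)
  have Eint: "integrable N ?E" by (rule integrable_const_bound[where B=1]) (use E01 Em in auto)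
  have Hm: "?H \<in> borel_measurable N"
  proof -
    have "(\<lambda>\<omega>. \<Prod>j\<in>{i<..n}. 1 - (1 - unreq (real n * c) j \<omega>) * (1 - exp (- (l / real n)))) \<in> borel_measurable N"
      if "i \<in> {1..n}" for i
    proof (rule borel_measurable_prod)
      fix j assume "j \<in> {i<..n}"
      hence [measurable]: "p j \<in> borel_measurable N" using that by (intro p_measurable) auto
      show "(\<lambda>\<omega>. 1 - (1 - unreq (real n * c) j \<omega>) * (1 - exp (- (l / real n)))) \<in> borel_measurable N" by measurable
    qed
    thus ?thesis by measurable
  qed
  have Hint: "integrable N ?H"
  proof (rule integrable_const_bound[where B="1 + l\<^sup>2 / real n"])
    show "AE \<omega> in N. norm (?H \<omega>) \<le> 1 + l\<^sup>2 / real n"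
    proof (rule AE_I2)
      fix \<omega> assume "\<omega> \<in> space N"
      thus "norm (?H \<omega>) \<le> 1 + l\<^sup>2 / real n" using diff[of \<omega>] E01[of \<omega>] unfolding real_norm_def by linarith
    qed
  qed (rule Hm)
  have "out_transform N n id T (real n * c) (l / real n) = (LINT \<omega>|N. ?H \<omega>)"
    by (rule out_transform_eq) (use c in simp)
  hence "\<bar>out_transform N n id T (real n * c) (l / real n) - (LINT \<omega>|N. ?E \<omega>)\<bar> = \<bar>LINT \<omega>|N. ?H \<omega> - ?E \<omega>\<bar>"
    using Hint Eint by simp
  also have "\<dots> \<le> l\<^sup>2 / real n"
    by (rule integral_bounded_by[OF prob_space_axioms diff]) auto
  finally show ?thesis .
qed

text \<open>Differentiation under the integral: the difference quotients are dominated by the integrable function \<open>x\<close>, also at \<open>t = 0\<close>.\<close>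

lemma laplace_deriv_eq:
  assumes P: "P \<in> space (prob_algebra Rplus)" and int: "integrable P (\<lambda>x. x)" and t: "0 \<le> t"
  shows "laplace_deriv P t = - (LINT x|P. x * exp (- (x * t)))"
proof -
  interpret prob_space P by (rule Rplus_prob_facts(1)[OF P])
  note Pm = measurable_P[OF P]
  note e_int = integrable_exp_P[OF P]
  have "((\<lambda>u. (laplace P u - laplace P t) / (u - t)) \<longlongrightarrow> (LINT x|P. - x * exp (- t * x))) (at t within {0..})"
    unfolding tendsto_at_iff_sequentially o_def
  proof (intro allI impI)
    fix X assume X: "\<forall>i. X i \<in> {0..} - {t}" and lim: "X \<longlonglongrightarrow> t"
    have "(\<lambda>i. LINT x|P. (exp (- X i * x) - exp (- t * x)) / (X i - t)) \<longlonglongrightarrow> (LINT x|P. - x * exp (- t * x))"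
    proof (rule integral_dominated_convergence[where w="\<lambda>x. x"])
      show "AE x in P. (\<lambda>i. (exp (- X i * x) - exp (- t * x)) / (X i - t)) \<longlonglongrightarrow> - x * exp (- t * x)"
      proof (rule AE_I2)
        fix x
        have "((\<lambda>u. exp (- u * x)) has_field_derivative (- x * exp (- t * x))) (at t)"
          by (auto intro!: derivative_eq_intros)
        hence "((\<lambda>u. (exp (- u * x) - exp (- t * x)) / (u - t)) \<longlongrightarrow> - x * exp (- t * x)) (at t)"
          by (simp add: has_field_derivative_iff)
        thus "(\<lambda>i. (exp (- X i * x) - exp (- t * x)) / (X i - t)) \<longlonglongrightarrow> - x * exp (- t * x)"
        proof (rule filterlim_compose)
          show "filterlim X (at t) sequentially" using lim X by (auto simp: filterlim_at)
        qed
      qed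
      show "AE x in P. norm ((exp (- X i * x) - exp (- t * x)) / (X i - t)) \<le> x" for i
      proof (rule AE_I2)
        fix x assume "x \<in> space P"
        hence x: "0 \<le> x" using Rplus_prob_facts(3)[OF P] by simp
        have Xi: "0 \<le> X i" "X i \<noteq> t" using X by auto
        have "\<bar>exp (- (X i * x)) - exp (- (t * x))\<bar> \<le> \<bar>X i * x - t * x\<bar>"
          using x Xi t by (intro exp_neg_lipschitz) auto
        also have "\<dots> = \<bar>X i - t\<bar> * x" using x by (simp add: left_diff_distrib[symmetric] abs_mult)
        finally show "norm ((exp (- X i * x) - exp (- t * x)) / (X i - t)) \<le> x"
          using Xi by (simp add: abs_divide divide_le_eq mult.commute)
      qed
    qed (auto intro!: Pm int)
    moreover have "(LINT x|P. (exp (- X i * x) - exp (- t * x)) / (X i - t)) = (laplace P (X i) - laplace P t) / (X i - t)" for i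
    proof -
      have "0 \<le> X i" using X by simp
      thus ?thesis unfolding laplace_def integral_divide_zero
        by (subst Bochner_Integration.integral_diff[OF e_int e_int]) (use t in simp_all)
    qed
    ultimately show "(\<lambda>i. (laplace P (X i) - laplace P t) / (X i - t)) \<longlonglongrightarrow> (LINT x|P. - x * exp (- t * x))"
      by (simp only:)
  qed
  hence "(laplace P has_field_derivative (LINT x|P. - x * exp (- t * x))) (at t within {0..})"
    by (simp add: has_field_derivative_iff)
  hence "(laplace P has_vector_derivative (LINT x|P. - x * exp (- t * x))) (at t within {0..})"
    by (simp add: has_real_derivative_iff_has_vector_derivative)
  moreover have "at t within {0..} \<noteq> bot"
  proof
    assume "at t within {0..} = bot"
    moreover have "at_right t \<le> at t within {0..}" using t by (intro at_le) auto
    ultimately have "at_right t = bot" by (simp only: le_bot)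
    thus False using trivial_limit_at_right_real[of t] by (simp only: simp_thms)
  qed
  ultimately have "laplace_deriv P t = (LINT x|P. - x * exp (- t * x))"
    unfolding laplace_deriv_def by (intro vector_derivative_within)
  also have "\<dots> = - (LINT x|P. x * exp (- (x * t)))"
    by (simp add: mult.commute)
  finally show ?thesis .
qed

lemma tendsto_exp_quotient: "((\<lambda>h::real. (1 - exp (- h)) / h) \<longlongrightarrow> 1) (at 0)"
proof -
  have "((\<lambda>h. 1 - exp (- h)) has_field_derivative 1) (at (0::real))"
    by (auto intro!: derivative_eq_intros)
  thus ?thesis by (simp add: has_field_derivative_iff)
qed

lemma exchangeable_limit_forms:
  fixes \<phi> l :: real
  assumes \<phi>: "0 < \<phi>"
  defines "L \<equiv> (\<lambda>u. (exp (- u * (1 - \<phi>)) - exp (- u)) / (u * \<phi>))"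
    and "R \<equiv> (if l = 0 then 1 else (1 - exp (- l * \<phi>)) / (l * \<phi>))"
  shows "(if l = 0 then Lim (at_right 0) L else L l) = exp (- l * (1 - \<phi>)) * R"
    and "integral {0..1} (\<lambda>x. exp (- l * \<phi> * x)) = R"
proof -
  have L: "L u = exp (- u * (1 - \<phi>)) * ((1 - exp (- (u * \<phi>))) / (u * \<phi>))" for u
    unfolding L_def by (simp add: right_diff_distrib exp_add[symmetric])
  show "(if l = 0 then Lim (at_right 0) L else L l) = exp (- l * (1 - \<phi>)) * R"
  proof (cases "l = 0")
    case True
    have "filterlim (\<lambda>u. u * \<phi>) (at 0) (at_right 0)"
      unfolding filterlim_at
    proof (intro conjI)
      show "((\<lambda>u. u * \<phi>) \<longlongrightarrow> 0) (at_right 0)" by (auto intro!: tendsto_eq_intros)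
      show "\<forall>\<^sub>F u in at_right 0. u * \<phi> \<in> UNIV \<and> u * \<phi> \<noteq> 0"
        using eventually_at_right_less[of "0::real"] by eventually_elim (use \<phi> in auto)
    qed
    hence "((\<lambda>u. (1 - exp (- (u * \<phi>))) / (u * \<phi>)) \<longlongrightarrow> 1) (at_right 0)"
      by (rule filterlim_compose[OF tendsto_exp_quotient])
    moreover have "((\<lambda>u. exp (- u * (1 - \<phi>))) \<longlongrightarrow> 1) (at_right 0)"
      by (auto intro!: tendsto_eq_intros)
    ultimately have "(L \<longlongrightarrow> 1 * 1) (at_right 0)" unfolding L by (rule tendsto_mult[rotated])
    hence "Lim (at_right 0) L = 1" by (intro tendsto_Lim) auto
    thus ?thesis using True by (simp add: R_def)
  qed (simp add: L R_def)
  show "integral {0..1} (\<lambda>x. exp (- l * \<phi> * x)) = R"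
  proof (cases "l = 0")
    case False
    have "((\<lambda>x. exp (- l * \<phi> * x)) has_integral
        (- exp (- l * \<phi> * 1) / (l * \<phi>) - (- exp (- l * \<phi> * 0) / (l * \<phi>)))) {0..1}"
    proof (rule fundamental_theorem_of_calculus)
      fix x :: real
      have "((\<lambda>x. - exp (- l * \<phi> * x) / (l * \<phi>)) has_field_derivative exp (- l * \<phi> * x)) (at x within {0..1})"
        using False \<phi> by (auto intro!: derivative_eq_intros simp: field_simps)
      thus "((\<lambda>x. - exp (- l * \<phi> * x) / (l * \<phi>)) has_vector_derivative exp (- l * \<phi> * x)) (at x within {0..1})"
        by (simp add: has_real_derivative_iff_has_vector_derivative)
    qed simp
    hence "integral {0..1} (\<lambda>x. exp (- l * \<phi> * x)) = - exp (- l * \<phi> * 1) / (l * \<phi>) - (- exp (- l * \<phi> * 0) / (l * \<phi>))"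
      by (rule integral_unique)
    also have "\<dots> = (1 - exp (- l * \<phi>)) / (l * \<phi>)" by (simp add: diff_divide_distrib)
    finally show ?thesis using False by (simp add: R_def)
  qed (simp add: R_def)
qed

lemma eventually_compare:
  fixes a b :: "nat \<Rightarrow> real"
  assumes "a \<longlonglongrightarrow> \<alpha>" "b \<longlonglongrightarrow> \<beta>" "\<alpha> \<noteq> \<beta>"
  shows "\<forall>\<^sub>F k in sequentially. (a k < b k \<longleftrightarrow> \<alpha> < \<beta>) \<and> (a k \<le> b k \<longleftrightarrow> \<alpha> < \<beta>)"
proof (cases "\<alpha> < \<beta>")
  case True
  have "(\<lambda>k. b k - a k) \<longlonglongrightarrow> \<beta> - \<alpha>" by (intro tendsto_diff assms)
  hence "\<forall>\<^sub>F k in sequentially. 0 < b k - a k" using True by (intro order_tendstoD(1)) auto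
  thus ?thesis by eventually_elim (use True in auto)
next
  case False
  have "(\<lambda>k. a k - b k) \<longlonglongrightarrow> \<alpha> - \<beta>" by (intro tendsto_diff assms)
  hence "\<forall>\<^sub>F k in sequentially. 0 < a k - b k" using False assms(3) by (intro order_tendstoD(1)) auto
  thus ?thesis by eventually_elim (use False in auto)
qed

context
  fixes P :: "real measure" and M :: "nat \<Rightarrow> 'a measure" and w :: "nat \<Rightarrow> nat \<Rightarrow> 'a \<Rightarrow> real"
    and T :: "nat \<Rightarrow> nat \<Rightarrow> 'a \<Rightarrow> real set" and \<mu> t l :: real
  assumes P: "P \<in> space (prob_algebra Rplus)"
    and P_mean: "integrable P (\<lambda>x. x)" "\<mu> = (LINT x|P. x)" "\<mu> \<noteq> 0"
    and M: "\<And>n. n \<ge> 1 \<Longrightarrow> prob_space (M n)"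
    and w_meas: "\<And>n i. n \<ge> 1 \<Longrightarrow> i \<in> {1..n} \<Longrightarrow> w n i \<in> borel_measurable (M n)"
    and w_nonneg: "\<And>n i \<omega>. n \<ge> 1 \<Longrightarrow> i \<in> {1..n} \<Longrightarrow> \<omega> \<in> space (M n) \<Longrightarrow> 0 \<le> w n i \<omega>"
    and LLN: "LLN P M w"
    and requests: "\<And>n. n \<ge> 1 \<Longrightarrow> cond_poisson_requests (M n) n (w n) (T n)"
    and t: "0 \<le> t" and l: "0 \<le> l"
begin

lemma \<mu>_pos: "0 < \<mu>"
proof -
  have "0 \<le> \<mu>" unfolding P_mean(2)
    by (intro integral_nonneg_AE AE_I2) (use Rplus_prob_facts(3)[OF P] in auto)
  thus ?thesis using P_mean(3) by simp
qed

lemma \<mu>t: "0 \<le> \<mu> * t" using \<mu>_pos t by simp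

lemma out_transform_limI:
  assumes "(\<lambda>n. LINT \<omega>|M n. exponential_cost n (\<mu> * t) l (\<lambda>i. w n i \<omega>)) \<longlonglongrightarrow> L"
  shows "(\<lambda>n. out_transform (M n) n id (T n) (real n * \<mu> * t) (l / real n)) \<longlonglongrightarrow> L"
proof -
  have "(\<lambda>n. out_transform (M n) n id (T n) (real n * \<mu> * t) (l / real n) -
     (LINT \<omega>|M n. exponential_cost n (\<mu> * t) l (\<lambda>i. w n i \<omega>))) \<longlonglongrightarrow> 0"
  proof (rule Lim_null_comparison)
    show "\<forall>\<^sub>F n in sequentially. norm (out_transform (M n) n id (T n) (real n * \<mu> * t) (l / real n) -
      (LINT \<omega>|M n. exponential_cost n (\<mu> * t) l (\<lambda>i. w n i \<omega>))) \<le> l\<^sup>2 / real n"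
    proof (rule eventually_sequentiallyI[of 1])
      fix n :: nat assume n: "1 \<le> n"
      interpret poisson_requests "M n" n "w n" "T n"
        by (intro poisson_requests.intro poisson_requests_axioms.intro M w_meas w_nonneg requests n)
      show "norm (out_transform (M n) n id (T n) (real n * \<mu> * t) (l / real n) -
        (LINT \<omega>|M n. exponential_cost n (\<mu> * t) l (\<lambda>i. w n i \<omega>))) \<le> l\<^sup>2 / real n"
        using out_transform_exponential_cost[OF n \<mu>t l] by (simp add: mult.assoc)
    qed
    show "(\<lambda>n. l\<^sup>2 / real n) \<longlonglongrightarrow> 0" by (rule lim_const_over_n)
  qed
  from tendsto_add[OF this assms] show ?thesis by simp
qed

lemma exchangeable_limit:
  assumes ex: "\<And>n. n \<ge> 1 \<Longrightarrow> exchangeable (M n) n (w n)"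
  shows "(\<lambda>n. out_transform (M n) n id (T n) (real n * \<mu> * t) (l / real n)) \<longlonglongrightarrow>
    (LINT y|P. y * exp (- (y * t))) / \<mu> * exp (- l * (1 - laplace P t)) *
    (if l = 0 then 1 else (1 - exp (- l * laplace P t)) / (l * laplace P t))" (is "_ \<longlonglongrightarrow> ?L")
proof (rule out_transform_limI)
  have "(\<lambda>n. LINT \<omega>|M n. averaged_cost n (\<mu> * t) l (\<lambda>i. w n i \<omega>)) \<longlonglongrightarrow> ?L"
  proof (rule LLN_transfer[OF P M w_meas w_nonneg LLN, where good = "\<lambda>_ _. True"])
    fix N :: "nat \<Rightarrow> nat" and x :: "nat \<Rightarrow> nat \<Rightarrow> real"
    assume N: "\<And>k. N k \<ge> 1" "filterlim N at_top sequentially" and x: "\<And>k i. i \<in> {1..N k} \<Longrightarrow> 0 \<le> x k i"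
      and conv: "weak_conv_m (\<lambda>k. emp_law (N k) (x k)) (law_on_line P)"
        "(\<lambda>k. emp_mean (N k) (\<lambda>y. y) (x k)) \<longlonglongrightarrow> (LINT x|P. x)"
    obtain \<Omega> Y Yl where "coupling \<Omega> P N x Y Yl \<mu> t l"
      using coupling_exists[OF P P_mean N x conv t l] by blast
    thus "(\<lambda>k. averaged_cost (N k) (\<mu> * t) l (x k)) \<longlonglongrightarrow> ?L" by (rule coupling.averaged_cost_lim)
  next
    show "0 \<le> averaged_cost n (\<mu> * t) l x \<and> averaged_cost n (\<mu> * t) l x \<le> 1"
      if "n \<ge> 1" "\<And>i. i \<in> {1..n} \<Longrightarrow> 0 \<le> x i" for n x
      by (rule averaged_cost_bounds[OF that(2) \<mu>t l that(1)])
  qed (auto intro!: cost_measurable w_meas simp: cost_scale)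
  moreover have "(\<lambda>n. (LINT \<omega>|M n. exponential_cost n (\<mu> * t) l (\<lambda>i. w n i \<omega>)) -
      (LINT \<omega>|M n. averaged_cost n (\<mu> * t) l (\<lambda>i. w n i \<omega>))) \<longlonglongrightarrow> 0"
  proof (rule Lim_null_comparison)
    show "\<forall>\<^sub>F n in sequentially. norm ((LINT \<omega>|M n. exponential_cost n (\<mu> * t) l (\<lambda>i. w n i \<omega>)) -
      (LINT \<omega>|M n. averaged_cost n (\<mu> * t) l (\<lambda>i. w n i \<omega>))) \<le> 2 * l / sqrt (real n)"
    proof (rule eventually_sequentiallyI[of 1])
      fix n :: nat assume n: "1 \<le> n"
      interpret exchangeable_weights "M n" n "w n" "\<mu> * t" l
        by (intro exchangeable_weights.intro exchangeable_weights_axioms.intro M w_meas w_nonneg ex n \<mu>t l)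
      show "norm ((LINT \<omega>|M n. exponential_cost n (\<mu> * t) l (\<lambda>i. w n i \<omega>)) -
        (LINT \<omega>|M n. averaged_cost n (\<mu> * t) l (\<lambda>i. w n i \<omega>))) \<le> 2 * l / sqrt (real n)"
        using exponential_cost_averaged by simp
    qed
    show "(\<lambda>n. 2 * l / sqrt (real n)) \<longlonglongrightarrow> 0"
      by (intro tendsto_divide_0[OF tendsto_const] filterlim_at_top_imp_at_infinity
          filterlim_compose[OF sqrt_at_top filterlim_real_sequentially])
  qed
  ultimately show "(\<lambda>n. LINT \<omega>|M n. exponential_cost n (\<mu> * t) l (\<lambda>i. w n i \<omega>)) \<longlonglongrightarrow> ?L"
    using tendsto_add by fastforce
qed

text \<open>Both monotone cases at once: \<open>le\<close> is the order in which the weights are arranged, \<open>r1\<close> and \<open>r2\<close> are its weak and strict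
versions, and \<open>r0\<close> is the version in terms of which the limit is written.\<close>

lemma ordered_limit:
  assumes good: "\<And>n. n \<ge> 1 \<Longrightarrow> AE \<omega> in M n. \<forall>i j. 1 \<le> i \<and> i \<le> j \<and> j \<le> n \<longrightarrow> le (w n i \<omega>) (w n j \<omega>)"
    and scale: "\<And>a b z. 0 < z \<Longrightarrow> le a b \<Longrightarrow> le (z * a) (z * b)"
    and weak: "\<And>a b. le a b \<Longrightarrow> r1 a b" and strict: "\<And>a b. r2 a b \<Longrightarrow> \<not> le b a"
    and meas: "Measurable.pred (borel \<Otimes>\<^sub>M borel) (\<lambda>q. r1 (fst q) (snd q))"
      "Measurable.pred (borel \<Otimes>\<^sub>M borel) (\<lambda>q. r2 (fst q) (snd q))"
      "Measurable.pred (borel \<Otimes>\<^sub>M borel) (\<lambda>q. r0 (fst q) (snd q))"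
    and lim1: "\<And>a b \<alpha> \<beta>. a \<longlonglongrightarrow> \<alpha> \<Longrightarrow> b \<longlonglongrightarrow> \<beta> \<Longrightarrow> \<alpha> \<noteq> \<beta> \<Longrightarrow>
      \<forall>\<^sub>F k in sequentially. r1 (a k) (b k) \<longleftrightarrow> r0 \<alpha> \<beta>"
    and lim2: "\<And>a b \<alpha> \<beta>. a \<longlonglongrightarrow> \<alpha> \<Longrightarrow> b \<longlonglongrightarrow> \<beta> \<Longrightarrow> \<alpha> \<noteq> \<beta> \<Longrightarrow>
      \<forall>\<^sub>F k in sequentially. r2 (a k) (b k) \<longleftrightarrow> r0 \<alpha> \<beta>"
    and atoms: "l \<noteq> 0 \<longrightarrow> (\<forall>x>0. measure P {x} = 0)"
    and G: "\<And>y. (LINT z|P. of_bool (r0 z y) * exp (- (z * t))) = G y"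
  shows "(\<lambda>n. out_transform (M n) n id (T n) (real n * \<mu> * t) (l / real n)) \<longlonglongrightarrow>
    1 / \<mu> * (LINT y|P. y * exp (- y * t) * exp (- l * G y)) * exp (- l * (1 - laplace P t))" (is "_ \<longlonglongrightarrow> ?L")
proof (rule out_transform_limI)
  let ?good = "\<lambda>n x. \<forall>i j. 1 \<le> i \<and> i \<le> j \<and> j \<le> n \<longrightarrow> le (x i) (x j)"
  have L: "(LINT y|P. y * (exp (- (y * t)) * exp (- l * (1 - laplace P t + (LINT z|P. of_bool (r0 z y) * exp (- (z * t))))))) / \<mu> = ?L"
  proof -
    have "(LINT y|P. y * (exp (- (y * t)) * exp (- l * (1 - laplace P t + G y)))) =
      (LINT y|P. (y * exp (- y * t) * exp (- l * G y)) * exp (- l * (1 - laplace P t)))"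
      by (intro Bochner_Integration.integral_cong refl) (simp add: distrib_left exp_add[symmetric] mult.assoc)
    thus ?thesis unfolding G by simp
  qed
  show "(\<lambda>n. LINT \<omega>|M n. exponential_cost n (\<mu> * t) l (\<lambda>i. w n i \<omega>)) \<longlonglongrightarrow> ?L"
  proof (rule LLN_transfer[OF P M w_meas w_nonneg LLN, where good = ?good])
    fix N :: "nat \<Rightarrow> nat" and x :: "nat \<Rightarrow> nat \<Rightarrow> real"
    assume N: "\<And>k. N k \<ge> 1" "filterlim N at_top sequentially" and x: "\<And>k i. i \<in> {1..N k} \<Longrightarrow> 0 \<le> x k i"
      and sorted: "\<And>k. ?good (N k) (x k)"
      and conv: "weak_conv_m (\<lambda>k. emp_law (N k) (x k)) (law_on_line P)"
        "(\<lambda>k. emp_mean (N k) (\<lambda>y. y) (x k)) \<longlonglongrightarrow> (LINT x|P. x)"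
    obtain \<Omega> Y Yl where "coupling \<Omega> P N x Y Yl \<mu> t l"
      using coupling_exists[OF P P_mean N x conv t l] by blast
    then interpret coupling \<Omega> P N x Y Yl \<mu> t l .
    have at: "\<And>y. l \<noteq> 0 \<Longrightarrow> y > 0 \<Longrightarrow> measure P {y} = 0" using atoms by blast
    show "(\<lambda>k. exponential_cost (N k) (\<mu> * t) l (x k)) \<longlonglongrightarrow> ?L"
    proof (rule tendsto_sandwich)
      show "(\<lambda>k. comparison_cost r1 (N k) (\<mu> * t) l (x k)) \<longlonglongrightarrow> ?L"
        using comparison_cost_lim[OF meas(1,3) lim1 at] unfolding L .
      show "(\<lambda>k. comparison_cost r2 (N k) (\<mu> * t) l (x k)) \<longlonglongrightarrow> ?L"
        using comparison_cost_lim[OF meas(2,3) lim2 at] unfolding L .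
      show "\<forall>\<^sub>F k in sequentially. comparison_cost r1 (N k) (\<mu> * t) l (x k) \<le> exponential_cost (N k) (\<mu> * t) l (x k)"
        using sorted weak by (intro always_eventually allI comparison_cost_le x l) auto
      show "\<forall>\<^sub>F k in sequentially. exponential_cost (N k) (\<mu> * t) l (x k) \<le> comparison_cost r2 (N k) (\<mu> * t) l (x k)"
      proof (intro always_eventually allI comparison_cost_ge x l)
        fix k i j assume ij: "i \<in> {1..N k}" "j \<in> {1..N k}" "r2 (x k j) (x k i)"
        show "j \<le> i"
        proof (rule ccontr)
          assume "\<not> j \<le> i"
          hence "le (x k i) (x k j)" using sorted[of k] ij by auto
          thus False using strict[OF ij(3)] by blast
        qed
      qed
    qed
  next
    show "?good n (\<lambda>i. z * x i)" if "0 < z" "?good n x" for n x z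
      using that scale by blast
  next
    show "AE \<omega> in M n. ?good n (\<lambda>i. w n i \<omega>)" if "n \<ge> 1" for n by (rule good[OF that])
    show "0 \<le> exponential_cost n (\<mu> * t) l x \<and> exponential_cost n (\<mu> * t) l x \<le> 1"
      if "\<And>i. i \<in> {1..n} \<Longrightarrow> 0 \<le> x i" for n x
      by (rule exponential_cost_bounds[OF that \<mu>t l])
  qed (auto intro!: cost_measurable w_meas simp: cost_scale)
qed

end

theorem theorem3p3:
  fixes P :: "real measure"
    and M :: "nat \<Rightarrow> 'a measure"
    and w :: "nat \<Rightarrow> nat \<Rightarrow> 'a \<Rightarrow> real"
    and \<pi> :: "nat \<Rightarrow> nat \<Rightarrow> nat"
    and T :: "nat \<Rightarrow> nat \<Rightarrow> 'a \<Rightarrow> real set"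
    and \<mu> t l :: real
  assumes P: "P \<in> space (prob_algebra Rplus)"
    and P_mean: "integrable P (\<lambda>x. x)" "\<mu> = (LINT x|P. x)" "\<mu> \<noteq> 0"
    and M: "\<And>n. n \<ge> 1 \<Longrightarrow> prob_space (M n)"
    and w_meas: "\<And>n i. n \<ge> 1 \<Longrightarrow> i \<in> {1..n} \<Longrightarrow> w n i \<in> borel_measurable (M n)"
    and w_nonneg: "\<And>n i \<omega>. n \<ge> 1 \<Longrightarrow> i \<in> {1..n} \<Longrightarrow> \<omega> \<in> space (M n) \<Longrightarrow> 0 \<le> w n i \<omega>"
    and initial: "\<And>n. n \<ge> 1 \<Longrightarrow> \<pi> n permutes {1..n}"
    and requests: "\<And>n. n \<ge> 1 \<Longrightarrow> cond_poisson_requests (M n) n (w n) (T n)"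
    and t: "0 \<le> t" and l: "0 \<le> l"
  shows
    "(LLN_ex P M w \<pi> \<longrightarrow>
       (let L = (\<lambda>u. (exp (- u * (1 - laplace P t)) - exp (- u)) / (u * laplace P t));
            L1 = \<bar>laplace_deriv P t\<bar> / \<mu> * (if l = 0 then Lim (at_right 0) L else L l);
            L2 = \<bar>laplace_deriv P t\<bar> / \<mu> * integral {0..1} (\<lambda>x. exp (- l * laplace P t * x))
                   * exp (- l * (1 - laplace P t))
        in (\<lambda>n. out_transform (M n) n (\<pi> n) (T n) (real n * \<mu> * t) (l / real n)) \<longlonglongrightarrow> L1 \<and>
           L1 = L2)) \<and>
     (LLN_minus P M w \<pi> \<and> (l \<noteq> 0 \<longrightarrow> (\<forall>x>0. measure P {x} = 0)) \<longrightarrow>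
       (\<lambda>n. out_transform (M n) n (\<pi> n) (T n) (real n * \<mu> * t) (l / real n)) \<longlonglongrightarrow>
         1 / \<mu> * (LINT x|P. x * exp (- x * t) *
                     exp (- l * (LINT y:{x<..}|P. exp (- y * t))))
           * exp (- l * (1 - laplace P t))) \<and>
     (LLN_plus P M w \<pi> \<and> (l \<noteq> 0 \<longrightarrow> (\<forall>x>0. measure P {x} = 0)) \<longrightarrow>
       (\<lambda>n. out_transform (M n) n (\<pi> n) (T n) (real n * \<mu> * t) (l / real n)) \<longlonglongrightarrow>
         1 / \<mu> * (LINT x|P. x * exp (- x * t) *
                     exp (- l * (LINT y:{0..x}|P. exp (- y * t))))
           * exp (- l * (1 - laplace P t)))"
proof (intro conjI impI)
  have id: "(\<lambda>n. out_transform (M n) n (\<pi> n) (T n) (real n * \<mu> * t) (l / real n)) \<longlonglongrightarrow> x"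
    if "\<forall>n\<ge>1. \<pi> n = id"
      "(\<lambda>n. out_transform (M n) n id (T n) (real n * \<mu> * t) (l / real n)) \<longlonglongrightarrow> x" for x
    using that by (elim Lim_transform_eventually) (auto intro!: eventually_sequentiallyI[of 1])
  {
    assume ex: "LLN_ex P M w \<pi>"
    hence LLN: "LLN P M w" and pi: "\<forall>n\<ge>1. \<pi> n = id" and e: "\<And>n. n \<ge> 1 \<Longrightarrow> exchangeable (M n) n (w n)"
      by (auto simp: LLN_ex_def)
    note forms = exchangeable_limit_forms[OF laplace_pos[OF P t], of l]
    have "0 \<le> (LINT y|P. y * exp (- (y * t)))"
      by (intro integral_nonneg_AE AE_I2) (use Rplus_prob_facts(3)[OF P] in auto)
    hence d: "\<bar>laplace_deriv P t\<bar> = (LINT y|P. y * exp (- (y * t)))"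
      by (simp add: laplace_deriv_eq[OF P P_mean(1) t])
    show "let L = (\<lambda>u. (exp (- u * (1 - laplace P t)) - exp (- u)) / (u * laplace P t));
            L1 = \<bar>laplace_deriv P t\<bar> / \<mu> * (if l = 0 then Lim (at_right 0) L else L l);
            L2 = \<bar>laplace_deriv P t\<bar> / \<mu> * integral {0..1} (\<lambda>x. exp (- l * laplace P t * x))
                   * exp (- l * (1 - laplace P t))
        in (\<lambda>n. out_transform (M n) n (\<pi> n) (T n) (real n * \<mu> * t) (l / real n)) \<longlonglongrightarrow> L1 \<and> L1 = L2"
      unfolding Let_def forms d
    proof (intro conjI id[OF pi])
      show "(\<lambda>n. out_transform (M n) n id (T n) (real n * \<mu> * t) (l / real n)) \<longlonglongrightarrow>
        (LINT y|P. y * exp (- (y * t))) / \<mu> * (exp (- l * (1 - laplace P t)) *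
          (if l = 0 then 1 else (1 - exp (- l * laplace P t)) / (l * laplace P t)))"
        using exchangeable_limit[OF P P_mean M w_meas w_nonneg LLN requests t l e] by (simp only: mult.assoc)
    qed (simp only: mult_ac)
  next
    assume a: "LLN_minus P M w \<pi> \<and> (l \<noteq> 0 \<longrightarrow> (\<forall>x>0. measure P {x} = 0))"
    hence LLN: "LLN P M w" and pi: "\<forall>n\<ge>1. \<pi> n = id"
      and s: "\<And>n. n \<ge> 1 \<Longrightarrow> AE \<omega> in M n. \<forall>i j. 1 \<le> i \<and> i \<le> j \<and> j \<le> n \<longrightarrow> w n i \<omega> \<ge> w n j \<omega>"
      by (auto simp: LLN_minus_def)
    show "(\<lambda>n. out_transform (M n) n (\<pi> n) (T n) (real n * \<mu> * t) (l / real n)) \<longlonglongrightarrow>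
         1 / \<mu> * (LINT x|P. x * exp (- x * t) * exp (- l * (LINT y:{x<..}|P. exp (- y * t))))
           * exp (- l * (1 - laplace P t))"
    proof (intro id[OF pi] ordered_limit[OF P P_mean M w_meas w_nonneg LLN requests t l,
          where le = "(\<ge>)" and ?r1.0 = "(\<ge>)" and ?r2.0 = "(>)" and ?r0.0 = "(>)"] s)
      show "(LINT z|P. of_bool (z > y) * exp (- (z * t))) = (LINT z:{y<..}|P. exp (- z * t))" for y
        unfolding set_lebesgue_integral_def by (intro Bochner_Integration.integral_cong) (auto simp: indicator_def)
      fix a b :: "nat \<Rightarrow> real" and \<alpha> \<beta> assume "a \<longlonglongrightarrow> \<alpha>" "b \<longlonglongrightarrow> \<beta>" "\<alpha> \<noteq> \<beta>"
      note ev = eventually_compare[OF this(2,1)] this(3)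
      show "\<forall>\<^sub>F k in sequentially. (a k \<ge> b k) = (\<alpha> > \<beta>)" "\<forall>\<^sub>F k in sequentially. (a k > b k) = (\<alpha> > \<beta>)"
        using ev by (auto elim!: eventually_mono)
    qed (use a in auto)
  next
    assume a: "LLN_plus P M w \<pi> \<and> (l \<noteq> 0 \<longrightarrow> (\<forall>x>0. measure P {x} = 0))"
    hence LLN: "LLN P M w" and pi: "\<forall>n\<ge>1. \<pi> n = id"
      and s: "\<And>n. n \<ge> 1 \<Longrightarrow> AE \<omega> in M n. \<forall>i j. 1 \<le> i \<and> i \<le> j \<and> j \<le> n \<longrightarrow> w n i \<omega> \<le> w n j \<omega>"
      by (auto simp: LLN_plus_def)
    show "(\<lambda>n. out_transform (M n) n (\<pi> n) (T n) (real n * \<mu> * t) (l / real n)) \<longlonglongrightarrow>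
         1 / \<mu> * (LINT x|P. x * exp (- x * t) * exp (- l * (LINT y:{0..x}|P. exp (- y * t))))
           * exp (- l * (1 - laplace P t))"
    proof (intro id[OF pi] ordered_limit[OF P P_mean M w_meas w_nonneg LLN requests t l,
          where le = "(\<le>)" and ?r1.0 = "(\<le>)" and ?r2.0 = "(<)" and ?r0.0 = "(\<le>)"] s)
      show "(LINT z|P. of_bool (z \<le> y) * exp (- (z * t))) = (LINT z:{0..y}|P. exp (- z * t))" for y
        unfolding set_lebesgue_integral_def
        by (intro Bochner_Integration.integral_cong) (use Rplus_prob_facts(3)[OF P] in \<open>auto simp: indicator_def\<close>)
      fix a b :: "nat \<Rightarrow> real" and \<alpha> \<beta> assume ab: "a \<longlonglongrightarrow> \<alpha>" "b \<longlonglongrightarrow> \<beta>" "\<alpha> \<noteq> \<beta>"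
      note ev = eventually_compare[OF this]
      show "\<forall>\<^sub>F k in sequentially. (a k \<le> b k) = (\<alpha> \<le> \<beta>)" "\<forall>\<^sub>F k in sequentially. (a k < b k) = (\<alpha> \<le> \<beta>)"
        using ev ab(3) by (auto elim!: eventually_mono)
    qed (use a in auto)
  }
qed

end
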